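(* Let $(X_m)_{m\in\mathbb{N}}$ be a homogeneous Markov chain on a finite or denumerable state space $\mathcal{E}$ and let $E^{\rm o}\subset E^{\dag}\subset\mathcal{E}$ satisfy assumptions $(A_1)$ and $(A_2)$ stated in the context. Let $F\subset\mathcal{E}$. The generating function $\tilde K_i$, $i\in E^{\rm o}$, satisfies the equation $$\tilde K_i(x,y)=\tilde K_i(x,0)+\tilde K_i(0,y)+\sum_{j\in E^{\rm o}}\big(\tilde H_{ij}^{\pm+}(x)+\tilde H_{ij}^{\pm-}(y)\big)\tilde K_j(x,y)-\sum_{j\in E^{\rm o}}\tilde H_{ij}^{\pm+}(x)\tilde K_j(x,0)-\sum_{j\in E^{\rm o}}\tilde H_{ij}^{\pm-}(y)\tilde K_j(0,y)-\mathbf{1}_F(i)\,\mathbb{P}_i\{X_1\in E^{\pm}\},$$ where, for any $i\in E^{\rm o}$, $$\tilde K_i(x,0)=G_i^+(x)-\sum_{j\in E^-}H_{ij}^{-+}(x)G_j(x)+\mathbf{1}_F(i)\mathbb{P}_i\{X_1\in E^-\},$$ $$\tilde K_i(0,y)=G_i^-(y)-\sum_{j\in E^+}H_{ij}^{+-}(y)G_j(y)+\mathbf{1}_F(i)\mathbb{P}_i\{X_1\in E^+\},$$ and where the functions $\tilde H_{ij}^{\pm+},\tilde H_{ij}^{\pm-}$, $i,j\in E^{\rm o}$, are given by $$\tilde H_{ij}^{\pm+}(x)=x\sum_{k\in E^+,\,\ell\in E^{\rm o}}p_{ik}H_{k\ell}^{\rm o}(x)H_{\ell j}^{\pm}(x),\qquad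 \tilde H_{ij}^{\pm-}(x)=x\sum_{k\in E^-,\,\ell\in E^{\rm o}}p_{ik}H_{k\ell}^{\rm o}(x)H_{\ell j}^{\pm}(x),$$ and the functions $H_{ij}^{-+}$ ($i\in E^{\rm o}$, $j\in E^-$) and $H_{ij}^{+-}$ ($i\in E^{\rm o}$, $j\in E^+$) are given by $$H_{ij}^{-+}(x)=x\sum_{k\in E^+}p_{ik}H_{kj}^-(x),\qquad H_{ij}^{+-}(x)=x\sum_{k\in E^-}p_{ik}H_{kj}^+(x).$$
   Context: Notation: $\mathbb{N}=\{0,1,2,\dots\}$, $\mathbb{N}^*=\{1,2,\dots\}$, $\min(\varnothing)=+\infty$; $\mathbb{P}_i$, $\mathbb{E}_i$ denote probability and expectation given $X_0=i$; $p_{ij}=\mathbb{P}_i\{X_1=j\}$; $\mathbf{1}_F$ is the indicator of $F$. Set $E^+=E^{\dag}\setminus E^{\rm o}$, $E^-=\mathcal{E}\setminus E^{\dag}$, $E^{\pm}=E^+\cup E^-=\mathcal{E}\setminus E^{\rm o}$. For $u\in\{{\rm o},\dag,+,-,\pm\}$ let $\tau^u=\min\{m\in\mathbb{N}^*:X_m\in E^u\}$, and let $\tilde\tau^{\pm}=\min\{m\ge\tau^{\rm o}:X_m\in E^{\pm}\}$. Assumptions. $(A_1)$: if $X_0\in E^-$, then $\tau^{\rm o}=\tau^{\dag}$. $(A_2)$: if $X_0\in E^+$, then $\tau^{\rm o}\le\tau^--1$. (These hold almost surely.) Modified sojourn time: for $m\ge1$ let $\delta_m=1$ if there is $\ell\in\{0,\dots,m-1\}$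 with $X_{m-\ell}\in E^+$ and $X_{m-\ell+1},\dots,X_m\in E^{\rm o}$, and $\delta_m=0$ otherwise. Put $\tilde T_0=0$ and $\tilde T_n=\sum_{m=1}^n\delta_m$ for $n\ge1$. Generating functions (events involving $X_{\tau}$ are implicitly restricted to $\tau<\infty$): $G_i(x)=\sum_{m\ge0}\mathbb{P}_i\{X_m\in F\}x^m$; $H^u_{ij}(x)=\mathbb{E}_i\big(x^{\tau^u}\mathbf{1}_{\{X_{\tau^u}=j\}}\big)$ for $u\in\{{\rm o},+,-\}$. For $i\in E^{\rm o}$: $G_i^+(x)=\sum_{m\ge0}\mathbb{P}_i\{X_1\in E^+,X_m\in F\}x^m$, $G_i^-(x)=\sum_{m\ge0}\mathbb{P}_i\{X_1\in E^-,X_m\in F\}x^m$; $H_{ij}^{-+}(x)=\mathbb{E}_i\big(x^{\tau^-}\mathbf{1}_{\{X_1\in E^+,X_{\tau^-}=j\}}\big)$ for $j\in E^-$; $H_{ij}^{+-}(x)=\mathbb{E}_i\big(x^{\tau^+}\mathbf{1}_{\{X_1\in E^-,X_{\tau^+}=j\}}\big)$ for $j\in E^+$. For $i,j\in E^{\rm o}$: $H_{ij}^{\pm}(x)=\mathbb{E}_i\big(x^{\tau^{\pm}-1}\mathbf{1}_{\{X_{\tau^{\pm}-1}=j\}}\big)$, $\tilde H_{ij}^{\pm+}(x)=\mathbb{E}_i\big(x^{\tilde\tau^{\pm}-1}\mathbf{1}_{\{X_1\in E^+,X_{\tilde\tau^{\pm}-1}=j\}}\big)$, $\tilde H_{ij}^{\pm-}(x)=\mathbb{E}_i\big(x^{\tilde\tau^{\pm}-1}\mathbf{1}_{\{X_1\in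 E^-,X_{\tilde\tau^{\pm}-1}=j\}}\big)$. Finally, for $i\in E^{\rm o}$, $$\tilde K_i(x,y)=\sum_{m,n\in\mathbb{N}:\,m\le n}\mathbb{P}_i\{X_1\in E^{\pm},\,\tilde T_n=m,\,X_n\in F\}\,x^my^{n-m}$$ (with $0^0=1$). Identities are understood for real $x,y$ such that all the series involved converge absolutely (in particular for $|x|<1$, $|y|<1$).
   Formalization: The first equation fails as printed: the factor P_j{X_1 in E^±} is counted twice. In its three sums over j, K̃_j is replaced by K̃_j / P_j{X_1 in E^±} (0 if that probability is 0); the printed form is kept when all these probabilities are 0 or 1. *)

theory Defs
  imports "HOL-Probability.Probability"
begin

text \<open>
  A homogeneous Markov chain on a countable state space is given through the family of its laws:
  \<open>P i\<close> is the law of the chain started at \<open>i\<close>.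
\<close>

locale homogeneous_markov_chain =
  fixes P :: "'s :: countable \<Rightarrow> 'w measure" and X :: "nat \<Rightarrow> 'w \<Rightarrow> 's"
  assumes prob_space_P: "prob_space (P i)"
    and measurable_X: "X m \<in> measurable (P i) (count_space UNIV)"
    and initial_state: "\<P>(\<omega> in P i. X 0 \<omega> = i) = 1"
    and markov_property:
      "\<P>(\<omega> in P i. \<forall>m\<le>n. X m \<omega> = s m) > 0 \<Longrightarrow>
        \<P>(\<omega> in P i. X (Suc n) \<omega> = j \<bar> \<forall>m\<le>n. X m \<omega> = s m) =
        \<P>(\<omega> in P (s n). X 1 \<omega> = j)"

definition trans_prob ::
    "('s \<Rightarrow> 'w measure) \<Rightarrow> (nat \<Rightarrow> 'w \<Rightarrow> 's) \<Rightarrow> 's \<Rightarrow> 's \<Rightarrow> real" where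
  "trans_prob P X i j = \<P>(\<omega> in P i. X 1 \<omega> = j)"

definition first_prob ::
    "('s \<Rightarrow> 'w measure) \<Rightarrow> (nat \<Rightarrow> 'w \<Rightarrow> 's) \<Rightarrow> 's set \<Rightarrow> 's \<Rightarrow> real" where
  "first_prob P X A i = \<P>(\<omega> in P i. X 1 \<omega> \<in> A)"

text \<open>The infimum of the empty set in \<^typ>\<open>enat\<close> is \<open>\<infinity>\<close>.\<close>

definition hit :: "(nat \<Rightarrow> 'w \<Rightarrow> 's) \<Rightarrow> 's set \<Rightarrow> 'w \<Rightarrow> enat" where
  "hit X A \<omega> = Inf {enat m |m. 1 \<le> m \<and> X m \<omega> \<in> A}"

definition hit_after :: "(nat \<Rightarrow> 'w \<Rightarrow> 's) \<Rightarrow> 's set \<Rightarrow> 's set \<Rightarrow> 'w \<Rightarrow> enat" where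
  "hit_after X A B \<omega> = Inf {enat m |m. hit X A \<omega> \<le> enat m \<and> X m \<omega> \<in> B}"

definition assumption_A1 ::
    "('s \<Rightarrow> 'w measure) \<Rightarrow> (nat \<Rightarrow> 'w \<Rightarrow> 's) \<Rightarrow> 's set \<Rightarrow> 's set \<Rightarrow> 's set \<Rightarrow> bool" where
  "assumption_A1 P X Eo Ed Em \<longleftrightarrow>
     (\<forall>i\<in>Em. AE \<omega> in P i. hit X Eo \<omega> = hit X Ed \<omega>)"

text \<open>In \<^typ>\<open>enat\<close>, \<open>\<infinity> - 1 = \<infinity>\<close>.\<close>

definition assumption_A2 ::
    "('s \<Rightarrow> 'w measure) \<Rightarrow> (nat \<Rightarrow> 'w \<Rightarrow> 's) \<Rightarrow> 's set \<Rightarrow> 's set \<Rightarrow> 's set \<Rightarrow> bool" where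
  "assumption_A2 P X Eo Ep Em \<longleftrightarrow>
     (\<forall>i\<in>Ep. AE \<omega> in P i. hit X Eo \<omega> \<le> hit X Em \<omega> - 1)"

definition delta :: "(nat \<Rightarrow> 'w \<Rightarrow> 's) \<Rightarrow> 's set \<Rightarrow> 's set \<Rightarrow> nat \<Rightarrow> 'w \<Rightarrow> nat" where
  "delta X Eo Ep m \<omega> =
     (if \<exists>l<m. X (m - l) \<omega> \<in> Ep \<and> (\<forall>k\<in>{m - l + 1..m}. X k \<omega> \<in> Eo) then 1 else 0)"

definition sojourn :: "(nat \<Rightarrow> 'w \<Rightarrow> 's) \<Rightarrow> 's set \<Rightarrow> 's set \<Rightarrow> nat \<Rightarrow> 'w \<Rightarrow> nat" where
  "sojourn X Eo Ep n \<omega> = (\<Sum>m=1..n. delta X Eo Ep m \<omega>)"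

definition G_term ::
    "('s \<Rightarrow> 'w measure) \<Rightarrow> (nat \<Rightarrow> 'w \<Rightarrow> 's) \<Rightarrow> 's set \<Rightarrow> 's \<Rightarrow> real \<Rightarrow> nat \<Rightarrow> real" where
  "G_term P X F i x m = \<P>(\<omega> in P i. X m \<omega> \<in> F) * x ^ m"

definition G ::
    "('s \<Rightarrow> 'w measure) \<Rightarrow> (nat \<Rightarrow> 'w \<Rightarrow> 's) \<Rightarrow> 's set \<Rightarrow> 's \<Rightarrow> real \<Rightarrow> real" where
  "G P X F i x = (\<Sum>\<^sub>\<infinity>m\<in>UNIV. G_term P X F i x m)"

text \<open>\<open>G_first P X F A\<close> is $G^+$ for $A = E^+$ and $G^-$ for $A = E^-$.\<close>

definition G_first_term ::
    "('s \<Rightarrow> 'w measure) \<Rightarrow> (nat \<Rightarrow> 'w \<Rightarrow> 's) \<Rightarrow> 's set \<Rightarrow> 's set \<Rightarrow> 's \<Rightarrow> real \<Rightarrow> nat \<Rightarrow> real" where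
  "G_first_term P X F A i x m = \<P>(\<omega> in P i. X 1 \<omega> \<in> A \<and> X m \<omega> \<in> F) * x ^ m"

definition G_first ::
    "('s \<Rightarrow> 'w measure) \<Rightarrow> (nat \<Rightarrow> 'w \<Rightarrow> 's) \<Rightarrow> 's set \<Rightarrow> 's set \<Rightarrow> 's \<Rightarrow> real \<Rightarrow> real" where
  "G_first P X F A i x = (\<Sum>\<^sub>\<infinity>m\<in>UNIV. G_first_term P X F A i x m)"

text \<open>\<open>time_pow X \<tau> j x\<close> is $x^\tau 1_{\{\tau < \infty,\, X_\tau = j\}}$.\<close>

definition time_pow ::
    "(nat \<Rightarrow> 'w \<Rightarrow> 's) \<Rightarrow> ('w \<Rightarrow> enat) \<Rightarrow> 's \<Rightarrow> real \<Rightarrow> 'w \<Rightarrow> real" where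
  "time_pow X \<tau> j x \<omega> =
     (if \<tau> \<omega> \<noteq> \<infinity> \<and> X (the_enat (\<tau> \<omega>)) \<omega> = j then x ^ the_enat (\<tau> \<omega>) else 0)"

definition H_var :: "(nat \<Rightarrow> 'w \<Rightarrow> 's) \<Rightarrow> 's set \<Rightarrow> 's \<Rightarrow> real \<Rightarrow> 'w \<Rightarrow> real" where
  "H_var X A j x = time_pow X (hit X A) j x"

definition H ::
    "('s \<Rightarrow> 'w measure) \<Rightarrow> (nat \<Rightarrow> 'w \<Rightarrow> 's) \<Rightarrow> 's set \<Rightarrow> 's \<Rightarrow> 's \<Rightarrow> real \<Rightarrow> real" where
  "H P X A i j x = (\<integral>\<omega>. H_var X A j x \<omega> \<partial>P i)"

text \<open>
  \<open>H_first P X A B\<close> is $H^{-+}$ for $A = E^+$, $B = E^-$ and $H^{+-}$ for $A = E^-$, $B = E^+$.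
\<close>

definition H_first_var ::
    "(nat \<Rightarrow> 'w \<Rightarrow> 's) \<Rightarrow> 's set \<Rightarrow> 's set \<Rightarrow> 's \<Rightarrow> real \<Rightarrow> 'w \<Rightarrow> real" where
  "H_first_var X A B j x \<omega> = (if X 1 \<omega> \<in> A then time_pow X (hit X B) j x \<omega> else 0)"

definition H_first ::
    "('s \<Rightarrow> 'w measure) \<Rightarrow> (nat \<Rightarrow> 'w \<Rightarrow> 's) \<Rightarrow> 's set \<Rightarrow> 's set \<Rightarrow> 's \<Rightarrow> 's \<Rightarrow> real \<Rightarrow> real" where
  "H_first P X A B i j x = (\<integral>\<omega>. H_first_var X A B j x \<omega> \<partial>P i)"

definition H_pm_var :: "(nat \<Rightarrow> 'w \<Rightarrow> 's) \<Rightarrow> 's set \<Rightarrow> 's \<Rightarrow> real \<Rightarrow> 'w \<Rightarrow> real" where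
  "H_pm_var X Epm j x = time_pow X (\<lambda>\<omega>. hit X Epm \<omega> - 1) j x"

definition H_pm ::
    "('s \<Rightarrow> 'w measure) \<Rightarrow> (nat \<Rightarrow> 'w \<Rightarrow> 's) \<Rightarrow> 's set \<Rightarrow> 's \<Rightarrow> 's \<Rightarrow> real \<Rightarrow> real" where
  "H_pm P X Epm i j x = (\<integral>\<omega>. H_pm_var X Epm j x \<omega> \<partial>P i)"

text \<open>
  \<open>Ht P X Eo Epm A\<close> is $\tilde H^{\pm+}$ for $A = E^+$ and $\tilde H^{\pm-}$ for $A = E^-$.
  Here $\tilde\tau^\pm - 1$ is not a stopping time: the event $\{\tilde\tau^\pm - 1 = s, X_s = j\}$
  already requires the step from \<open>j\<close> at time \<open>s\<close> to lead into $E^\pm$, so every such function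
  contains the factor $P_j\{X_1 \in E^\pm\}$. This factor is contained in $\tilde K_j$ as well.
\<close>

definition Ht_var ::
    "(nat \<Rightarrow> 'w \<Rightarrow> 's) \<Rightarrow> 's set \<Rightarrow> 's set \<Rightarrow> 's set \<Rightarrow> 's \<Rightarrow> real \<Rightarrow> 'w \<Rightarrow> real" where
  "Ht_var X Eo Epm A j x \<omega> =
     (if X 1 \<omega> \<in> A then time_pow X (\<lambda>\<omega>. hit_after X Eo Epm \<omega> - 1) j x \<omega> else 0)"

definition Ht ::
    "('s \<Rightarrow> 'w measure) \<Rightarrow> (nat \<Rightarrow> 'w \<Rightarrow> 's) \<Rightarrow> 's set \<Rightarrow> 's set \<Rightarrow> 's set \<Rightarrow>
      's \<Rightarrow> 's \<Rightarrow> real \<Rightarrow> real" where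
  "Ht P X Eo Epm A i j x = (\<integral>\<omega>. Ht_var X Eo Epm A j x \<omega> \<partial>P i)"

definition Kt_term ::
    "('s \<Rightarrow> 'w measure) \<Rightarrow> (nat \<Rightarrow> 'w \<Rightarrow> 's) \<Rightarrow> 's set \<Rightarrow> 's set \<Rightarrow> 's set \<Rightarrow> 's set \<Rightarrow>
      's \<Rightarrow> real \<Rightarrow> real \<Rightarrow> nat \<times> nat \<Rightarrow> real" where
  "Kt_term P X Eo Ep Epm F i x y = (\<lambda>(m, n).
     \<P>(\<omega> in P i. X 1 \<omega> \<in> Epm \<and> sojourn X Eo Ep n \<omega> = m \<and> X n \<omega> \<in> F) * x ^ m * y ^ (n - m))"

definition Kt ::
    "('s \<Rightarrow> 'w measure) \<Rightarrow> (nat \<Rightarrow> 'w \<Rightarrow> 's) \<Rightarrow> 's set \<Rightarrow> 's set \<Rightarrow> 's set \<Rightarrow> 's set \<Rightarrow>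
      's \<Rightarrow> real \<Rightarrow> real \<Rightarrow> real" where
  "Kt P X Eo Ep Epm F i x y =
     (\<Sum>\<^sub>\<infinity>(m, n)\<in>{(m, n). m \<le> n}. Kt_term P X Eo Ep Epm F i x y (m, n))"

text \<open>
  \<open>Kt_cond\<close> is the generating function of the conditional probabilities
  $P_i\{\tilde T_n = m, X_n \in F \mid X_1 \in E^\pm\}$; it is 0 if $P_i\{X_1 \in E^\pm\} = 0$.
\<close>

definition Kt_cond ::
    "('s \<Rightarrow> 'w measure) \<Rightarrow> (nat \<Rightarrow> 'w \<Rightarrow> 's) \<Rightarrow> 's set \<Rightarrow> 's set \<Rightarrow> 's set \<Rightarrow> 's set \<Rightarrow>
      's \<Rightarrow> real \<Rightarrow> real \<Rightarrow> real" where
  "Kt_cond P X Eo Ep Epm F i x y = Kt P X Eo Ep Epm F i x y / first_prob P X Epm i"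

abbreviation abs_summable :: "('a \<Rightarrow> real) \<Rightarrow> 'a set \<Rightarrow> bool" where
  "abs_summable f A \<equiv> (\<lambda>a. \<bar>f a\<bar>) summable_on A"

text \<open>
  Absolute convergence of the series in the respective identities. Setting one variable of
  $\tilde K_j(x,y)$ to 0 selects a subseries, so $\tilde K_j(x,0)$ and $\tilde K_j(0,y)$ need no
  condition of their own in \<open>conv_main\<close>. In \<open>conv_boundary\<close> the series $\tilde K_i(x,0)$
  (or $\tilde K_i(0,x)$) is dominated by that of \<open>G_first\<close>, up to the term of index 0.
\<close>

definition conv_main ::
    "('s \<Rightarrow> 'w measure) \<Rightarrow> (nat \<Rightarrow> 'w \<Rightarrow> 's) \<Rightarrow> 's set \<Rightarrow> 's set \<Rightarrow> 's set \<Rightarrow> 's set \<Rightarrow> 's set \<Rightarrow>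
      's \<Rightarrow> real \<Rightarrow> real \<Rightarrow> bool" where
  "conv_main P X Eo Ep Em Epm F i x y \<longleftrightarrow>
     (\<forall>j\<in>Eo. abs_summable (Kt_term P X Eo Ep Epm F j x y) {(m, n). m \<le> n}) \<and>
     (\<forall>j\<in>Eo. integrable (P i) (Ht_var X Eo Epm Ep j x)) \<and>
     (\<forall>j\<in>Eo. integrable (P i) (Ht_var X Eo Epm Em j y)) \<and>
     abs_summable (\<lambda>j. (Ht P X Eo Epm Ep i j x + Ht P X Eo Epm Em i j y)
                        * Kt_cond P X Eo Ep Epm F j x y) Eo \<and>
     abs_summable (\<lambda>j. Ht P X Eo Epm Ep i j x * Kt_cond P X Eo Ep Epm F j x 0) Eo \<and>
     abs_summable (\<lambda>j. Ht P X Eo Epm Em i j y * Kt_cond P X Eo Ep Epm F j 0 y) Eo"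

definition conv_boundary ::
    "('s \<Rightarrow> 'w measure) \<Rightarrow> (nat \<Rightarrow> 'w \<Rightarrow> 's) \<Rightarrow> 's set \<Rightarrow> 's set \<Rightarrow> 's set \<Rightarrow>
      's \<Rightarrow> real \<Rightarrow> bool" where
  "conv_boundary P X F A B i x \<longleftrightarrow>
     abs_summable (G_first_term P X F A i x) UNIV \<and>
     (\<forall>j\<in>B. abs_summable (G_term P X F j x) UNIV) \<and>
     (\<forall>j\<in>B. integrable (P i) (H_first_var X A B j x)) \<and>
     abs_summable (\<lambda>j. H_first P X A B i j x * G P X F j x) B"

definition conv_Ht ::
    "('s \<Rightarrow> 'w measure) \<Rightarrow> (nat \<Rightarrow> 'w \<Rightarrow> 's) \<Rightarrow> 's set \<Rightarrow> 's set \<Rightarrow> 's set \<Rightarrow>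
      's \<Rightarrow> 's \<Rightarrow> real \<Rightarrow> bool" where
  "conv_Ht P X Eo Epm A i j x \<longleftrightarrow>
     integrable (P i) (Ht_var X Eo Epm A j x) \<and>
     (\<forall>k\<in>A. \<forall>l\<in>Eo. integrable (P k) (H_var X Eo l x)) \<and>
     (\<forall>l\<in>Eo. integrable (P l) (H_pm_var X Epm j x)) \<and>
     abs_summable (\<lambda>(k, l). trans_prob P X i k * H P X Eo k l x * H_pm P X Epm l j x) (A \<times> Eo)"

definition conv_H_first ::
    "('s \<Rightarrow> 'w measure) \<Rightarrow> (nat \<Rightarrow> 'w \<Rightarrow> 's) \<Rightarrow> 's set \<Rightarrow> 's set \<Rightarrow> 's \<Rightarrow> 's \<Rightarrow> real \<Rightarrow> bool" where
  "conv_H_first P X A B i j x \<longleftrightarrow>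
     integrable (P i) (H_first_var X A B j x) \<and>
     (\<forall>k\<in>A. integrable (P k) (H_var X B j x)) \<and>
     abs_summable (\<lambda>k. trans_prob P X i k * H P X B k j x) A"

end

theory Submission
  imports Defs
begin

text \<open>
The two assumptions only enter through one consequence: the chain never steps directly between
$E^+$ and $E^-$. Seen from \<open>E\<^sup>o\<close>, a trajectory is therefore a concatenation of excursions, each of
which stays in $E^+$ or in $E^-$ until it returns to \<open>E\<^sup>o\<close>. As long as the first excursion and
the stay in \<open>E\<^sup>o\<close> behind it last, the modified sojourn time grows by 1 at every step if the
excursion is positive, and by 0 if it is negative.

Let $\sigma = \tilde\tau^\pm - 1$ be the last time of that stay. From time $\sigma$ on the
trajectory is again one that starts in \<open>E\<^sup>o\<close> with a step out of \<open>E\<^sup>o\<close>, and its sojourn time adds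
to the $\sigma$ (or 0) units collected before. So the part of $\tilde K_i(x, y)$ with a positive
first excursion is a contribution of the times before $\sigma$, which does not involve \<open>y\<close>, plus
$\sum_j \tilde H^{\pm+}_{ij}(x)\,\tilde K_j(x, y) / P_j\{X_1 \in E^\pm\}$ (lemma
\<open>half_decomposition\<close>). The quotient appears because the step out of \<open>E\<^sup>o\<close> at time $\sigma$
belongs to both factors. For \<open>y = 0\<close> the same formula holds with the same first contribution, so
the difference of the two formulas eliminates it. The negative excursions are the same statement
with $E^+$ and $E^-$ exchanged, because the two sojourn times add up to \<open>n\<close>
(\<open>path_sojourn_complement\<close>). Adding both parts yields the functional equation; its last term
corrects for the trajectories of length 0, which occur in both $\tilde K_i(x, 0)$ and
$\tilde K_i(0, y)$. Apart from length 0, the boundary function $\tilde K_i(x, 0)$ counts the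
trajectories that step into $E^+$ and have not met $E^-$ so far: all that step into $E^+$, minus
those that have met $E^-$, which are decomposed at their first visit of $E^-$.

All four decompositions (at the first step, at the return to \<open>E\<^sup>o\<close>, at the first visit of
$E^-$, at $\sigma$) are instances of \<open>renewal_has_sum\<close>: the Markov property at a fixed time
factorises the probability of each piece, and a total of probabilities times monomials may be
regrouped freely as soon as it converges absolutely, because probabilities are nonnegative. Hence
absolute convergence of the series on one side is inherited by the decomposition, for arbitrary
real arguments, and for arguments in the open unit disc all conditions hold automatically.
\<close>

section \<open>Regrouping sums\<close>

lemma abs_summable_iff: "abs_summable f A \<longleftrightarrow> f summable_on A"
  using summable_on_iff_abs_summable_on_real[of f A] by simp

text \<open>
The weight is constant on every fibre of \<open>g\<close>, and the coefficients do not change sign there; so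
absolute convergence of the fibrewise totals already gives absolute convergence of the fine sum.
\<close>

lemma has_sum_regroup:
  fixes C :: "'t \<Rightarrow> real" and W c :: "'k \<Rightarrow> real"
  assumes fibre: "\<And>k. k \<in> K \<Longrightarrow> (C has_sum c k) {t \<in> T. g t = k}"
    and g: "\<And>t. t \<in> T \<Longrightarrow> g t \<in> K"
    and nonneg: "\<And>t. t \<in> T \<Longrightarrow> 0 \<le> C t"
    and cW: "((\<lambda>k. c k * W k) has_sum s) K"
  shows "((\<lambda>t. C t * W (g t)) has_sum s) T"
proof -
  let ?B = "\<lambda>k. {t \<in> T. g t = k}"
  let ?f = "\<lambda>(k, t). C t * W k"
  have c_nonneg: "0 \<le> c k" if "k \<in> K" for k
    by (rule has_sum_nonneg[OF fibre[OF that]]) (use nonneg in auto)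
  have "(\<lambda>k. c k * W k) summable_on K"
    using cW by (rule has_sum_imp_summable)
  then have "(\<lambda>k. \<bar>c k * W k\<bar>) summable_on K"
    by (simp only: abs_summable_iff)
  then have abs: "(\<lambda>k. c k * \<bar>W k\<bar>) summable_on K"
    by (rule summable_on_cong[THEN iffD1, rotated]) (use c_nonneg in \<open>auto simp: abs_mult\<close>)
  have "(\<lambda>(k, t). C t * \<bar>W k\<bar>) summable_on Sigma K ?B"
  proof (rule summable_on_SigmaI[OF _ abs])
    fix k assume "k \<in> K"
    then show "((\<lambda>t. case (k, t) of (k, t) \<Rightarrow> C t * \<bar>W k\<bar>) has_sum c k * \<bar>W k\<bar>) (?B k)"
      by (auto intro: has_sum_cmult_left fibre)
  qed (use nonneg in auto)
  then have "(\<lambda>p. \<bar>?f p\<bar>) summable_on Sigma K ?B"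
    by (rule summable_on_cong[THEN iffD1, rotated]) (use nonneg in \<open>auto simp: abs_mult\<close>)
  then have sm: "?f summable_on Sigma K ?B"
    by (simp only: abs_summable_iff)
  have "(?f has_sum s) (Sigma K ?B)"
  proof (rule has_sum_SigmaI[OF _ cW sm])
    fix k assume "k \<in> K"
    then show "((\<lambda>t. case (k, t) of (k, t) \<Rightarrow> C t * W k) has_sum c k * W k) (?B k)"
      by (auto intro: has_sum_cmult_left fibre)
  qed
  moreover have "bij_betw (\<lambda>t. (g t, t)) T (Sigma K ?B)"
    by (rule bij_betw_byWitness[where f' = snd]) (use g in auto)
  ultimately show ?thesis
    using has_sum_reindex_bij_betw[of "\<lambda>t. (g t, t)" T "Sigma K ?B" ?f s] by auto
qed

lemma has_sum_product:
  fixes a :: "'s \<Rightarrow> real" and b :: "'t \<Rightarrow> real"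
  assumes a: "(a has_sum A) S" and b: "(b has_sum B) T"
  shows "((\<lambda>(s, t). a s * b t) has_sum A * B) (S \<times> T)"
proof -
  have abs: "(\<lambda>s. \<bar>a s\<bar>) summable_on S" "(\<lambda>t. \<bar>b t\<bar>) summable_on T"
    using has_sum_imp_summable[OF a] has_sum_imp_summable[OF b] by (simp_all only: abs_summable_iff)
  have "(\<lambda>(s, t). \<bar>a s\<bar> * \<bar>b t\<bar>) summable_on S \<times> T"
  proof (rule summable_on_SigmaI)
    show "((\<lambda>t. case (s, t) of (s, t) \<Rightarrow> \<bar>a s\<bar> * \<bar>b t\<bar>) has_sum \<bar>a s\<bar> * infsum (\<lambda>t. \<bar>b t\<bar>) T) T" for s
      using abs(2) by (auto intro: has_sum_cmult_right)
    show "(\<lambda>s. \<bar>a s\<bar> * infsum (\<lambda>t. \<bar>b t\<bar>) T) summable_on S"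
      using abs(1) by (rule summable_on_cmult_left)
  qed auto
  then have "(\<lambda>p. \<bar>case p of (s, t) \<Rightarrow> a s * b t\<bar>) summable_on S \<times> T"
    by (rule summable_on_cong[THEN iffD1, rotated]) (auto simp: abs_mult)
  then have sm: "(\<lambda>(s, t). a s * b t) summable_on S \<times> T"
    by (simp only: abs_summable_iff)
  show ?thesis
  proof (rule has_sum_SigmaI[OF _ _ sm])
    show "((\<lambda>t. case (s, t) of (s, t) \<Rightarrow> a s * b t) has_sum a s * B) T" for s
      using b by (auto intro: has_sum_cmult_right)
    show "((\<lambda>s. a s * B) has_sum A * B) S"
      using a by (rule has_sum_cmult_left)
  qed
qed

lemma has_sum_product_blocks:
  fixes a :: "'j \<Rightarrow> 's \<Rightarrow> real" and b :: "'j \<Rightarrow> 't \<Rightarrow> real"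
  assumes total: "((\<lambda>(j, s, t). a j s * b j t) has_sum L) (J \<times> S \<times> T)"
    and a: "\<And>j. j \<in> J \<Longrightarrow> (a j has_sum A j) S"
    and b: "\<And>j. j \<in> J \<Longrightarrow> (b j has_sum B j) T"
  shows "((\<lambda>j. A j * B j) has_sum L) J"
proof (rule has_sum_SigmaD[OF total])
  fix j assume "j \<in> J"
  then show "((\<lambda>p. case (j, p) of (j, s, t) \<Rightarrow> a j s * b j t) has_sum A j * B j) (S \<times> T)"
    using has_sum_product[OF a b, of j j] by (simp add: case_prod_unfold)
qed

section \<open>Countable partitions of events\<close>

lemma (in prob_space) prob_has_sum:
  fixes Q :: "'t :: countable \<Rightarrow> 'a \<Rightarrow> bool"
  assumes Q: "\<And>t. t \<in> T \<Longrightarrow> {\<omega> \<in> space M. Q t \<omega>} \<in> events"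
    and E: "{\<omega> \<in> space M. E \<omega>} \<in> events"
    and cover: "AE \<omega> in M. E \<omega> \<longleftrightarrow> (\<exists>t\<in>T. Q t \<omega>)"
    and unique: "AE \<omega> in M. \<forall>t\<in>T. \<forall>t'\<in>T. Q t \<omega> \<longrightarrow> Q t' \<omega> \<longrightarrow> t = t'"
  shows "((\<lambda>t. \<P>(\<omega> in M. Q t \<omega>)) has_sum \<P>(\<omega> in M. E \<omega>)) T"
proof -
  let ?U = "\<lambda>\<omega>. \<forall>t\<in>T. \<forall>t'\<in>T. Q t \<omega> \<longrightarrow> Q t' \<omega> \<longrightarrow> t = t'"
  \<comment> \<open>Discarding the overlaps, a null set, makes the family disjoint.\<close>
  define R where "R n = {\<omega> \<in> space M. \<exists>t\<in>T. to_nat t = n \<and> Q t \<omega> \<and> ?U \<omega>}" for n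
  have ct: "countable T" by (rule countableI_type)
  have pred_Q: "Measurable.pred M (Q t)" if "t \<in> T" for t
    using Q[OF that] by (simp add: pred_def)
  have imp: "Measurable.pred M (\<lambda>\<omega>. Q t \<omega> \<longrightarrow> Q t' \<omega> \<longrightarrow> t = t')" if "t \<in> T" "t' \<in> T" for t t'
    by (rule pred_intros_logic pred_Q that | simp)+
  have pred_U: "Measurable.pred M ?U"
    by (intro pred_intros_countable_bounded ct imp)
  have pred_R: "Measurable.pred M (\<lambda>\<omega>. \<exists>t\<in>T. to_nat t = n \<and> Q t \<omega> \<and> ?U \<omega>)" for n
    by (rule pred_intros_countable_bounded(4) pred_intros_logic pred_Q pred_U ct | assumption | simp)+
  have R_events: "range R \<subseteq> events"
    using predE[OF pred_R] unfolding R_def by blast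
  have disj: "disjoint_family R"
    by (auto simp: disjoint_family_on_def R_def)
  have "(\<lambda>n. prob (R n)) sums prob (\<Union>n. R n)"
    using R_events disj by (rule finite_measure_UNION)
  then have "((\<lambda>n. prob (R n)) has_sum prob (\<Union>n. R n)) UNIV"
    by (rule sums_nonneg_imp_has_sum) simp
  moreover have "prob (\<Union>n. R n) = \<P>(\<omega> in M. E \<omega>)"
    by (rule finite_measure_eq_AE) (use cover unique R_events E in \<open>auto simp: R_def\<close>)
  moreover have "R n = {}" if "n \<notin> to_nat ` T" for n
    using that by (auto simp: R_def)
  ultimately have "((\<lambda>n. prob (R n)) has_sum \<P>(\<omega> in M. E \<omega>)) (to_nat ` T)"
    by (subst has_sum_cong_neutral[where T = UNIV]) auto
  then have "((\<lambda>t. prob (R (to_nat t))) has_sum \<P>(\<omega> in M. E \<omega>)) T"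
    by (subst (asm) has_sum_reindex) (auto simp: o_def inj_on_def)
  moreover have "prob (R (to_nat t)) = \<P>(\<omega> in M. Q t \<omega>)" if "t \<in> T" for t
  proof (rule finite_measure_eq_AE)
    show "AE \<omega> in M. \<omega> \<in> R (to_nat t) \<longleftrightarrow> \<omega> \<in> {\<omega> \<in> space M. Q t \<omega>}"
      using unique by eventually_elim (use that in \<open>auto simp: R_def\<close>)
    show "R (to_nat t) \<in> events" "{\<omega> \<in> space M. Q t \<omega>} \<in> events"
      using R_events Q[OF that] by auto
  qed
  ultimately show ?thesis
    by (simp cong: has_sum_cong)
qed

text \<open>
The expectation of \<open>x\<close> to the power of a random time is the generating function of its law. No
bound on \<open>x\<close> is imposed: integrability and absolute convergence of the power series are the same.
\<close>

lemma (in prob_space) expectation_power_time: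
  fixes E :: "nat \<Rightarrow> 'a \<Rightarrow> bool" and x :: real
  assumes E: "\<And>s. {\<omega> \<in> space M. E s \<omega>} \<in> events"
    and unique: "\<And>\<omega> s s'. E s \<omega> \<Longrightarrow> E s' \<omega> \<Longrightarrow> s = s'"
    and on: "\<And>\<omega> s. E s \<omega> \<Longrightarrow> f \<omega> = x ^ s"
    and off: "\<And>\<omega>. (\<And>s. \<not> E s \<omega>) \<Longrightarrow> f \<omega> = 0"
  shows "integrable M f \<longleftrightarrow> (\<lambda>s. \<P>(\<omega> in M. E s \<omega>) * x ^ s) summable_on UNIV" (is "?I \<longleftrightarrow> ?S")
    and "integrable M f \<Longrightarrow>
      ((\<lambda>s. \<P>(\<omega> in M. E s \<omega>) * x ^ s) has_sum expectation f) UNIV"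
proof -
  let ?A = "\<lambda>s. {\<omega> \<in> space M. E s \<omega>}"
  let ?g = "\<lambda>s \<omega>. x ^ s * indicator (?A s) \<omega>"
  have g_sums: "((\<lambda>s. ?g s \<omega>) sums f \<omega>) \<and> summable (\<lambda>s. norm (?g s \<omega>)) \<and>
      (\<Sum>s. ennreal (norm (?g s \<omega>))) = ennreal (norm (f \<omega>))" if "\<omega> \<in> space M" for \<omega>
  proof (cases "\<exists>s. E s \<omega>")
    case True
    then obtain s where s: "E s \<omega>" by auto
    have other: "?g s' \<omega> = 0" if "s' \<noteq> s" for s'
      using unique[OF s, of s'] that by (auto simp: indicator_def)
    have gs: "?g s \<omega> = f \<omega>" using on[OF s] s that by simp
    have one: "h sums h s" if "\<And>s'. s' \<noteq> s \<Longrightarrow> h s' = 0" for h :: "nat \<Rightarrow> 'b :: {comm_monoid_add, t2_space}"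
      using sums_finite[of "{s}" h] that by simp
    have 1: "(\<lambda>s. ?g s \<omega>) sums ?g s \<omega>"
      by (rule one) (rule other)
    have 2: "summable (\<lambda>s. norm (?g s \<omega>))"
      by (rule sums_summable, rule one) (subst other, simp_all)
    have 3: "(\<Sum>s. ennreal (norm (?g s \<omega>))) = ennreal (norm (?g s \<omega>))"
      by (rule sums_unique[symmetric], rule one) (subst other, simp_all)
    show ?thesis using 1 2 3 unfolding gs by simp
  next
    case False
    then show ?thesis using off[of \<omega>] by simp
  qed
  have sum_g: "(\<Sum>s. ?g s \<omega>) = f \<omega>" if "\<omega> \<in> space M" for \<omega>
    using g_sums[OF that] by (simp add: sums_iff)
  have [measurable]: "?A s \<in> sets M" for s using E .
  have meas_g [measurable]: "?g s \<in> borel_measurable M" for s by simp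
  have meas_f: "f \<in> borel_measurable M"
  proof -
    have "(\<lambda>\<omega>. \<Sum>s. ?g s \<omega>) \<in> borel_measurable M" by (intro borel_measurable_suminf meas_g)
    then show ?thesis
      by (rule measurable_cong[THEN iffD1, rotated]) (simp_all add: sum_g)
  qed
  have int_g: "integrable M (?g s)" for s
    by (intro integrable_mult_right) (simp add: emeasure_eq_measure)
  have norm_g: "(\<integral>\<omega>. norm (?g s \<omega>) \<partial>M) = norm (\<P>(\<omega> in M. E s \<omega>) * x ^ s)" for s
  proof -
    have "norm (?g s \<omega>) = norm (x ^ s) * indicator (?A s) \<omega>" for \<omega>
      by (simp add: abs_mult)
    then show ?thesis by (simp add: abs_mult)
  qed
  have expect_g: "(\<integral>\<omega>. ?g s \<omega> \<partial>M) = \<P>(\<omega> in M. E s \<omega>) * x ^ s" for s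
    by simp
  have iff_summable: "?S \<longleftrightarrow> summable (\<lambda>s. norm (\<P>(\<omega> in M. E s \<omega>) * x ^ s))"
    using abs_summable_iff[of "\<lambda>s. \<P>(\<omega> in M. E s \<omega>) * x ^ s" UNIV]
      summable_on_UNIV_nonneg_real_iff[of "\<lambda>s. norm (\<P>(\<omega> in M. E s \<omega>) * x ^ s)"]
    by (simp only: real_norm_def abs_ge_zero simp_thms)
  show iff: "?I \<longleftrightarrow> ?S"
  proof
    assume ?I
    have "(\<Sum>s. ennreal (norm (\<P>(\<omega> in M. E s \<omega>) * x ^ s))) = (\<Sum>s. \<integral>\<^sup>+\<omega>. norm (?g s \<omega>) \<partial>M)"
    proof (intro arg_cong[where f = suminf] ext)
      fix s
      have "(\<integral>\<^sup>+\<omega>. norm (?g s \<omega>) \<partial>M) = ennreal (\<integral>\<omega>. norm (?g s \<omega>) \<partial>M)"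
        by (intro nn_integral_eq_integral integrable_norm int_g) simp
      then show "ennreal (norm (\<P>(\<omega> in M. E s \<omega>) * x ^ s)) = (\<integral>\<^sup>+\<omega>. norm (?g s \<omega>) \<partial>M)"
        by (simp only: norm_g)
    qed
    also have "\<dots> = (\<integral>\<^sup>+\<omega>. (\<Sum>s. ennreal (norm (?g s \<omega>))) \<partial>M)"
      by (rule nn_integral_suminf[symmetric]) simp
    also have "\<dots> = (\<integral>\<^sup>+\<omega>. norm (f \<omega>) \<partial>M)"
      by (rule nn_integral_cong) (rule g_sums[THEN conjunct2, THEN conjunct2])
    also have "\<dots> < \<infinity>"
      using \<open>?I\<close> by (simp add: integrable_iff_bounded)
    finally have "(\<Sum>s. ennreal (norm (\<P>(\<omega> in M. E s \<omega>) * x ^ s))) \<noteq> top"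
      by simp
    then show ?S unfolding iff_summable by (intro summable_suminf_not_top) auto
  next
    assume ?S
    then have sm: "summable (\<lambda>s. \<integral>\<omega>. norm (?g s \<omega>) \<partial>M)"
      by (simp only: norm_g iff_summable)
    have "integrable M (\<lambda>\<omega>. \<Sum>s. ?g s \<omega>)"
      by (rule integrable_suminf[OF int_g _ sm]) (rule AE_I2, rule g_sums[THEN conjunct2, THEN conjunct1])
    then show ?I
      by (rule Bochner_Integration.integrable_cong[THEN iffD1, rotated 2]) (simp_all add: sum_g)
  qed
  assume ?I
  then have sm: "summable (\<lambda>s. \<integral>\<omega>. norm (?g s \<omega>) \<partial>M)"
    using iff by (simp only: norm_g iff_summable)
  have "(\<integral>\<omega>. (\<Sum>s. ?g s \<omega>) \<partial>M) = (\<Sum>s. \<integral>\<omega>. ?g s \<omega> \<partial>M)"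
    by (rule integral_suminf[OF int_g _ sm]) (rule AE_I2, rule g_sums[THEN conjunct2, THEN conjunct1])
  moreover have "(\<integral>\<omega>. (\<Sum>s. ?g s \<omega>) \<partial>M) = expectation f"
    by (rule Bochner_Integration.integral_cong) (simp_all add: sum_g)
  ultimately have val: "(\<Sum>s. \<P>(\<omega> in M. E s \<omega>) * x ^ s) = expectation f"
    unfolding expect_g by simp
  have nsm: "summable (\<lambda>s. norm (\<P>(\<omega> in M. E s \<omega>) * x ^ s))"
    using iff \<open>?I\<close> iff_summable by blast
  have "(\<lambda>s. \<P>(\<omega> in M. E s \<omega>) * x ^ s) sums expectation f"
    using summable_sums[OF summable_norm_cancel[OF nsm]] unfolding val .
  with nsm show "((\<lambda>s. \<P>(\<omega> in M. E s \<omega>) * x ^ s) has_sum expectation f) UNIV"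
    by (rule norm_summable_imp_has_sum)
qed

section \<open>Path events and the Markov property\<close>

text \<open>
Events are handled as predicates on trajectories \<open>u\<close>. A predicate that is determined by finitely
many coordinates is measurable, because the state space is countable.
\<close>

definition depends_upto :: "nat \<Rightarrow> ((nat \<Rightarrow> 's) \<Rightarrow> bool) \<Rightarrow> bool" where
  "depends_upto n \<phi> \<longleftrightarrow> (\<forall>u v. (\<forall>m\<le>n. u m = v m) \<longrightarrow> \<phi> u = \<phi> v)"

lemma depends_uptoD: "depends_upto n \<phi> \<Longrightarrow> (\<And>m. m \<le> n \<Longrightarrow> u m = v m) \<Longrightarrow> \<phi> u = \<phi> v"
  by (auto simp: depends_upto_def)

lemma depends_upto_mono: "depends_upto m \<phi> \<Longrightarrow> m \<le> n \<Longrightarrow> depends_upto n \<phi>"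
  unfolding depends_upto_def by (meson order_trans)

named_theorems depends

lemma depends_const [depends]: "depends_upto n (\<lambda>u. c)"
  by (simp add: depends_upto_def)

lemma depends_conj [depends]:
  "depends_upto n \<phi> \<Longrightarrow> depends_upto n \<psi> \<Longrightarrow> depends_upto n (\<lambda>u. \<phi> u \<and> \<psi> u)"
  unfolding depends_upto_def by meson

lemma depends_not [depends]: "depends_upto n \<phi> \<Longrightarrow> depends_upto n (\<lambda>u. \<not> \<phi> u)"
  unfolding depends_upto_def by meson

lemma depends_imp [depends]:
  "(c \<Longrightarrow> depends_upto n \<phi>) \<Longrightarrow> depends_upto n (\<lambda>u. c \<longrightarrow> \<phi> u)"
  unfolding depends_upto_def by meson

lemma depends_guard [depends]:
  "(c \<Longrightarrow> depends_upto n \<phi>) \<Longrightarrow> depends_upto n (\<lambda>u. c \<and> \<phi> u)"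
  unfolding depends_upto_def by meson

lemma depends_all [depends]:
  "(\<And>a. depends_upto n (\<lambda>u. \<phi> a u)) \<Longrightarrow> depends_upto n (\<lambda>u. \<forall>a. \<phi> a u)"
  unfolding depends_upto_def by meson

lemma depends_ex [depends]:
  "(\<And>a. depends_upto n (\<lambda>u. \<phi> a u)) \<Longrightarrow> depends_upto n (\<lambda>u. \<exists>a. \<phi> a u)"
  unfolding depends_upto_def by meson

lemma depends_coord [depends]: "m \<le> n \<Longrightarrow> depends_upto n (\<lambda>u. R (u m))"
  by (simp add: depends_upto_def)

lemma depends_shift: "depends_upto n \<psi> \<Longrightarrow> s + n \<le> N \<Longrightarrow> depends_upto N (\<lambda>u. \<psi> (\<lambda>m. u (s + m)))"
  unfolding depends_upto_def by simp

context homogeneous_markov_chain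
begin

definition path_prob :: "'s \<Rightarrow> ((nat \<Rightarrow> 's) \<Rightarrow> bool) \<Rightarrow> real" where
  "path_prob i \<phi> = \<P>(\<omega> in P i. \<phi> (\<lambda>m. X m \<omega>))"

sublocale chain: prob_space "P i" for i
  by (rule prob_space_P)

lemma event_depends:
  assumes "depends_upto n \<phi>"
  shows "{\<omega> \<in> space (P i). \<phi> (\<lambda>m. X m \<omega>)} \<in> sets (P i)"
proof -
  let ?path = "\<lambda>\<omega>. map (\<lambda>m. X m \<omega>) [0..<Suc n]"
  let ?L = "{l. \<phi> (\<lambda>m. l ! m)}"
  have "{\<omega> \<in> space (P i). \<phi> (\<lambda>m. X m \<omega>)} =
      (\<Union>l\<in>?L. {\<omega> \<in> space (P i). length l = Suc n \<and> (\<forall>m\<in>{..n}. X m \<omega> = l ! m)})" (is "?A = (\<Union>l\<in>?L. ?B l)")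
  proof (intro equalityI subsetI)
    fix \<omega> assume \<omega>: "\<omega> \<in> ?A"
    have "\<phi> (\<lambda>m. ?path \<omega> ! m) = \<phi> (\<lambda>m. X m \<omega>)"
      by (rule depends_uptoD[OF assms]) (simp add: less_Suc_eq_le nth_append del: upt_Suc)
    with \<omega> have "?path \<omega> \<in> ?L" "\<omega> \<in> ?B (?path \<omega>)"
      by (auto simp: less_Suc_eq_le simp del: upt_Suc)
    then show "\<omega> \<in> (\<Union>l\<in>?L. ?B l)" by blast
  next
    fix \<omega> assume "\<omega> \<in> (\<Union>l\<in>?L. ?B l)"
    then obtain l where l: "\<phi> (\<lambda>m. l ! m)" "\<omega> \<in> ?B l" by blast
    have "\<phi> (\<lambda>m. X m \<omega>) = \<phi> (\<lambda>m. l ! m)"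
      by (rule depends_uptoD[OF assms]) (use l in auto)
    with l show "\<omega> \<in> ?A" by auto
  qed
  moreover have "?B l \<in> sets (P i)" for l
  proof -
    have "{\<omega> \<in> space (P i). X m \<omega> = l ! m} \<in> sets (P i)" for m
      using measurable_sets[OF measurable_X, of "{l ! m}" m i]
      by (simp add: vimage_def Int_def conj_commute)
    then show ?thesis
      by (intro sets.sets_Collect_conj sets.sets_Collect_const sets.sets_Collect_finite_All) auto
  qed
  moreover have "countable ?L" by (rule countableI_type)
  ultimately show ?thesis
    by (simp only:) (rule sets.countable_UN', blast, blast)
qed

lemma path_prob_nonneg [simp]: "0 \<le> path_prob i \<phi>"
  by (simp add: path_prob_def)

lemma path_prob_le_1 [simp]: "path_prob i \<phi> \<le> 1"
  by (simp add: path_prob_def)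

lemma path_prob_False [simp]: "path_prob i (\<lambda>u. False) = 0"
  by (simp add: path_prob_def)

lemma path_prob_mono:
  assumes "depends_upto n \<psi>" and "\<And>u. \<phi> u \<Longrightarrow> \<psi> u"
  shows "path_prob i \<phi> \<le> path_prob i \<psi>"
  unfolding path_prob_def
  by (rule chain.finite_measure_mono) (use assms event_depends in auto)

lemma path_prob_has_sum:
  fixes \<psi> :: "'t :: countable \<Rightarrow> (nat \<Rightarrow> 's) \<Rightarrow> bool"
  assumes "\<And>t. t \<in> T \<Longrightarrow> depends_upto n (\<psi> t)" and "depends_upto n \<phi>"
    and "AE \<omega> in P i. \<phi> (\<lambda>m. X m \<omega>) \<longleftrightarrow> (\<exists>t\<in>T. \<psi> t (\<lambda>m. X m \<omega>))"
    and "AE \<omega> in P i. \<forall>t\<in>T. \<forall>t'\<in>T. \<psi> t (\<lambda>m. X m \<omega>) \<longrightarrow> \<psi> t' (\<lambda>m. X m \<omega>) \<longrightarrow> t = t'"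
  shows "((\<lambda>t. path_prob i (\<psi> t)) has_sum path_prob i \<phi>) T"
  unfolding path_prob_def
  by (rule chain.prob_has_sum) (use assms event_depends in auto)

lemma path_prob_cong_AE:
  assumes "depends_upto n \<phi>" "depends_upto n \<psi>"
    and "AE \<omega> in P i. \<phi> (\<lambda>m. X m \<omega>) \<longleftrightarrow> \<psi> (\<lambda>m. X m \<omega>)"
  shows "path_prob i \<phi> = path_prob i \<psi>"
  unfolding path_prob_def
  by (rule chain.finite_measure_eq_AE) (use assms event_depends in auto)

lemma AE_initial: "AE \<omega> in P i. X 0 \<omega> = i"
proof -
  have "depends_upto 0 (\<lambda>u. u 0 = i)" by (simp add: depends_upto_def)
  from event_depends[OF this] have "{\<omega> \<in> space (P i). X 0 \<omega> = i} \<in> sets (P i)" .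
  from chain.prob_Collect_eq_1[OF this] initial_state show ?thesis by simp
qed

lemma trans_prob_eq: "trans_prob P X i j = path_prob i (\<lambda>u. u 1 = j)"
  by (simp add: trans_prob_def path_prob_def)

text \<open>
The defining Markov property conditions on a single initial segment; an arbitrary past event is
a countable disjoint union of such cylinders.
\<close>

lemma one_step:
  assumes \<phi>: "depends_upto s \<phi>"
  shows "path_prob i (\<lambda>u. \<phi> u \<and> u s = j \<and> u (Suc s) = k) =
    path_prob i (\<lambda>u. \<phi> u \<and> u s = j) * trans_prob P X j k"
proof -
  let ?T = "{l :: 's list. length l = Suc s \<and> \<phi> (\<lambda>m. l ! m) \<and> l ! s = j}"
  let ?C = "\<lambda>l u. \<forall>m\<le>s. u m = l ! m"
  have C: "depends_upto s (?C l)" for l by (auto simp: depends_upto_def)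
  have ex: "(\<exists>l\<in>?T. ?C l u) \<longleftrightarrow> \<phi> u \<and> u s = j" for u
  proof
    assume "\<exists>l\<in>?T. ?C l u"
    then obtain l where "l \<in> ?T" "?C l u" by blast
    moreover from this have "\<phi> u = \<phi> (\<lambda>m. l ! m)" by (intro depends_uptoD[OF \<phi>]) auto
    ultimately show "\<phi> u \<and> u s = j" by auto
  next
    assume u: "\<phi> u \<and> u s = j"
    let ?l = "map u [0..<Suc s]"
    have "\<phi> (\<lambda>m. ?l ! m) = \<phi> u" by (rule depends_uptoD[OF \<phi>]) (simp add: less_Suc_eq_le del: upt_Suc)
    with u have "?l \<in> ?T" "?C ?l u" by (auto simp: less_Suc_eq_le simp del: upt_Suc)
    then show "\<exists>l\<in>?T. ?C l u" by blast
  qed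
  have unique: "l = l'" if "l \<in> ?T" "l' \<in> ?T" "?C l u" "?C l' u" for l l' u
    using that by (auto intro!: nth_equalityI simp: less_Suc_eq_le)
  \<comment> \<open>On a null cylinder the conditional probability is meaningless, but both sides are 0.\<close>
  have cyl: "path_prob i (\<lambda>u. ?C l u \<and> u (Suc s) = k) = path_prob i (?C l) * trans_prob P X j k"
    if "l \<in> ?T" for l
  proof (cases "path_prob i (?C l) = 0")
    case True
    have "path_prob i (\<lambda>u. ?C l u \<and> u (Suc s) = k) \<le> path_prob i (?C l)"
      by (rule path_prob_mono[OF C]) simp
    then have "path_prob i (\<lambda>u. ?C l u \<and> u (Suc s) = k) = 0"
      unfolding True by (rule order_antisym) (rule path_prob_nonneg)
    then show ?thesis unfolding True by simp
  next
    case False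
    then have pos: "\<P>(\<omega> in P i. \<forall>m\<le>s. X m \<omega> = l ! m) > 0"
      unfolding path_prob_def by (simp add: zero_less_measure_iff)
    have "l ! s = j" using that by simp
    with markov_property[OF pos, of k] show ?thesis
      using pos unfolding path_prob_def trans_prob_def cond_prob_def
      by (simp add: divide_eq_eq conj_commute mult.commute)
  qed
  have "((\<lambda>l. path_prob i (\<lambda>u. ?C l u \<and> u (Suc s) = k)) has_sum
      path_prob i (\<lambda>u. \<phi> u \<and> u s = j \<and> u (Suc s) = k)) ?T"
  proof (rule path_prob_has_sum[where n = "Suc s"])
    show "depends_upto (Suc s) (\<lambda>u. \<phi> u \<and> u s = j \<and> u (Suc s) = k)"
      by (intro depends depends_upto_mono[OF \<phi>]) auto
    show "depends_upto (Suc s) (\<lambda>u. ?C l u \<and> u (Suc s) = k)" for l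
      by (intro depends) auto
    show "AE \<omega> in P i. (\<phi> (\<lambda>m. X m \<omega>) \<and> X s \<omega> = j \<and> X (Suc s) \<omega> = k) \<longleftrightarrow>
        (\<exists>l\<in>?T. ?C l (\<lambda>m. X m \<omega>) \<and> X (Suc s) \<omega> = k)"
    proof (rule AE_I2)
      fix \<omega>
      show "(\<phi> (\<lambda>m. X m \<omega>) \<and> X s \<omega> = j \<and> X (Suc s) \<omega> = k) \<longleftrightarrow>
          (\<exists>l\<in>?T. ?C l (\<lambda>m. X m \<omega>) \<and> X (Suc s) \<omega> = k)"
        using ex[of "\<lambda>m. X m \<omega>"] by blast
    qed
    show "AE \<omega> in P i. \<forall>l\<in>?T. \<forall>l'\<in>?T. (?C l (\<lambda>m. X m \<omega>) \<and> X (Suc s) \<omega> = k) \<longrightarrow>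
        (?C l' (\<lambda>m. X m \<omega>) \<and> X (Suc s) \<omega> = k) \<longrightarrow> l = l'"
      by (intro AE_I2 ballI impI, (elim conjE), rule unique)
  qed
  moreover have "((\<lambda>l. path_prob i (?C l)) has_sum path_prob i (\<lambda>u. \<phi> u \<and> u s = j)) ?T"
  proof (rule path_prob_has_sum[where n = s])
    show "depends_upto s (\<lambda>u. \<phi> u \<and> u s = j)" by (intro depends \<phi>) auto
    show "AE \<omega> in P i. (\<phi> (\<lambda>m. X m \<omega>) \<and> X s \<omega> = j) \<longleftrightarrow> (\<exists>l\<in>?T. ?C l (\<lambda>m. X m \<omega>))"
      by (rule AE_I2) (rule ex[symmetric])
    show "AE \<omega> in P i. \<forall>l\<in>?T. \<forall>l'\<in>?T. ?C l (\<lambda>m. X m \<omega>) \<longrightarrow> ?C l' (\<lambda>m. X m \<omega>) \<longrightarrow> l = l'"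
      by (intro AE_I2 ballI impI) (rule unique)
  qed (rule C)
  then have "((\<lambda>l. path_prob i (?C l) * trans_prob P X j k) has_sum
      path_prob i (\<lambda>u. \<phi> u \<and> u s = j) * trans_prob P X j k) ?T"
    by (rule has_sum_cmult_left)
  then have "((\<lambda>l. path_prob i (\<lambda>u. ?C l u \<and> u (Suc s) = k)) has_sum
      path_prob i (\<lambda>u. \<phi> u \<and> u s = j) * trans_prob P X j k) ?T"
    by (rule has_sum_cong[THEN iffD1, rotated]) (rule cyl[symmetric])
  ultimately show ?thesis
    by (rule has_sum_unique)
qed

text \<open>
Induction on the length of the observed future: its first step is governed by \<open>one_step\<close>, and
the induction hypothesis applies at the next time. The probability under \<open>P j\<close> on the right is
expanded in the same way, from time 0.
\<close>

lemma markov: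
  assumes "depends_upto s \<phi>" and "depends_upto n \<psi>"
  shows "path_prob i (\<lambda>u. \<phi> u \<and> u s = j \<and> \<psi> (\<lambda>m. u (s + m))) =
    path_prob i (\<lambda>u. \<phi> u \<and> u s = j) * path_prob j \<psi>"
  using assms
proof (induction n arbitrary: i j s \<phi> \<psi>)
  case 0
  have start: "\<psi> v \<longleftrightarrow> \<psi> (\<lambda>_. j)" if "v 0 = j" for v
    by (rule depends_uptoD[OF "0.prems"(2)]) (use that in auto)
  have "path_prob j \<psi> = path_prob j (\<lambda>u. \<psi> (\<lambda>_. j))"
  proof (rule path_prob_cong_AE[OF "0.prems"(2) depends_const])
    show "AE \<omega> in P j. \<psi> (\<lambda>m. X m \<omega>) \<longleftrightarrow> \<psi> (\<lambda>_. j)"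
      using AE_initial[of j] by eventually_elim (rule start)
  qed
  moreover have "path_prob j (\<lambda>u. c) = of_bool c" for c
    by (simp add: path_prob_def chain.prob_space)
  moreover have "(\<lambda>u. \<phi> u \<and> u s = j \<and> \<psi> (\<lambda>m. u (s + m))) = (\<lambda>u. (\<phi> u \<and> u s = j) \<and> \<psi> (\<lambda>_. j))"
    using start[of "\<lambda>m. u (s + m)" for u] by auto
  ultimately show ?case
    by (cases "\<psi> (\<lambda>_. j)") simp_all
next
  case (Suc n)
  \<comment> \<open>The predicate on the future as seen from one step later, when the current state is \<open>j\<close>.\<close>
  define \<rho> where "\<rho> v = \<psi> (\<lambda>m. case m of 0 \<Rightarrow> j | Suc m' \<Rightarrow> v m')" for v
  have \<rho>: "depends_upto n \<rho>"
    unfolding depends_upto_def \<rho>_def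
    by (intro allI impI depends_uptoD[OF Suc.prems(2)]) (auto split: nat.split)
  have split: "((\<lambda>k. path_prob i (\<lambda>u. \<phi> u \<and> u s = j) * trans_prob P X j k * path_prob k \<rho>) has_sum
      path_prob i (\<lambda>u. \<phi> u \<and> u s = j \<and> \<psi> (\<lambda>m. u (s + m)))) UNIV"
    if \<phi>: "depends_upto s \<phi>" for i s \<phi>
  proof -
    have shift: "\<psi> (\<lambda>m. u (s + m)) \<longleftrightarrow> \<rho> (\<lambda>m. u (Suc s + m))" if "u s = j" for u
      unfolding \<rho>_def by (rule arg_cong[where f = \<psi>]) (use that in \<open>auto split: nat.split\<close>)
    have "((\<lambda>k. path_prob i (\<lambda>u. (\<phi> u \<and> u s = j) \<and> u (Suc s) = k \<and> \<rho> (\<lambda>m. u (Suc s + m)))) has_sum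
        path_prob i (\<lambda>u. \<phi> u \<and> u s = j \<and> \<psi> (\<lambda>m. u (s + m)))) UNIV"
    proof (rule path_prob_has_sum[where n = "s + Suc n"])
      show "depends_upto (s + Suc n) (\<lambda>u. \<phi> u \<and> u s = j \<and> \<psi> (\<lambda>m. u (s + m)))"
        by (intro depends depends_upto_mono[OF \<phi>] depends_shift[OF Suc.prems(2)]) auto
      show "depends_upto (s + Suc n) (\<lambda>u. (\<phi> u \<and> u s = j) \<and> u (Suc s) = k \<and> \<rho> (\<lambda>m. u (Suc s + m)))" for k
        by (intro depends depends_upto_mono[OF \<phi>] depends_shift[OF \<rho>]) auto
      show "AE \<omega> in P i. (\<phi> (\<lambda>m. X m \<omega>) \<and> X s \<omega> = j \<and> \<psi> (\<lambda>m. X (s + m) \<omega>)) \<longleftrightarrow>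
          (\<exists>k\<in>UNIV. (\<phi> (\<lambda>m. X m \<omega>) \<and> X s \<omega> = j) \<and> X (Suc s) \<omega> = k \<and> \<rho> (\<lambda>m. X (Suc s + m) \<omega>))"
      proof (rule AE_I2)
        fix \<omega>
        show "(\<phi> (\<lambda>m. X m \<omega>) \<and> X s \<omega> = j \<and> \<psi> (\<lambda>m. X (s + m) \<omega>)) \<longleftrightarrow>
            (\<exists>k\<in>UNIV. (\<phi> (\<lambda>m. X m \<omega>) \<and> X s \<omega> = j) \<and> X (Suc s) \<omega> = k \<and> \<rho> (\<lambda>m. X (Suc s + m) \<omega>))"
          using shift[of "\<lambda>m. X m \<omega>"] by auto
      qed
    qed auto
    moreover have "path_prob i (\<lambda>u. (\<phi> u \<and> u s = j) \<and> u (Suc s) = k \<and> \<rho> (\<lambda>m. u (Suc s + m))) =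
        path_prob i (\<lambda>u. \<phi> u \<and> u s = j) * trans_prob P X j k * path_prob k \<rho>" for k
    proof -
      have "depends_upto (Suc s) (\<lambda>u. \<phi> u \<and> u s = j)"
        by (intro depends depends_upto_mono[OF \<phi>]) auto
      from Suc.IH[OF this \<rho>, of i k] show ?thesis
        using one_step[OF \<phi>, of i j k] by simp
    qed
    ultimately show ?thesis by simp
  qed
  have "path_prob j (\<lambda>u. u 0 = j) = 1"
    using initial_state by (simp add: path_prob_def)
  moreover have "path_prob j (\<lambda>u. u 0 = j \<and> \<psi> u) = path_prob j \<psi>"
  proof (rule path_prob_cong_AE[OF _ Suc.prems(2)])
    show "depends_upto (Suc n) (\<lambda>u. u 0 = j \<and> \<psi> u)"
      by (intro depends Suc.prems(2)) auto
    show "AE \<omega> in P j. (X 0 \<omega> = j \<and> \<psi> (\<lambda>m. X m \<omega>)) \<longleftrightarrow> \<psi> (\<lambda>m. X m \<omega>)"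
      using AE_initial[of j] by eventually_elim simp
  qed
  moreover have "((\<lambda>k. path_prob j (\<lambda>u. True \<and> u 0 = j) * trans_prob P X j k * path_prob k \<rho>) has_sum
      path_prob j (\<lambda>u. True \<and> u 0 = j \<and> \<psi> (\<lambda>m. u (0 + m)))) UNIV"
    by (rule split) (rule depends_const)
  ultimately have "((\<lambda>k. trans_prob P X j k * path_prob k \<rho>) has_sum path_prob j \<psi>) UNIV"
    by simp
  then have "((\<lambda>k. path_prob i (\<lambda>u. \<phi> u \<and> u s = j) * (trans_prob P X j k * path_prob k \<rho>)) has_sum
      path_prob i (\<lambda>u. \<phi> u \<and> u s = j) * path_prob j \<psi>) UNIV"
    by (rule has_sum_cmult_right)
  with split[OF Suc.prems(1), of i] show ?case
    by (simp add: mult.assoc has_sum_unique)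
qed

lemma AE_no_transition:
  assumes "\<And>k l. k \<in> A \<Longrightarrow> l \<in> B \<Longrightarrow> trans_prob P X k l = 0"
  shows "AE \<omega> in P i. \<forall>m. X m \<omega> \<in> A \<longrightarrow> X (Suc m) \<omega> \<notin> B"
proof -
  have "AE \<omega> in P i. \<not> (X m \<omega> = k \<and> X (Suc m) \<omega> = l)" if "k \<in> A" "l \<in> B" for m k l
  proof -
    have "path_prob i (\<lambda>u. True \<and> u m = k \<and> u (Suc m) = l) = 0"
      using one_step[OF depends_const, of i True m k l] assms[OF that] by simp
    moreover have "depends_upto (Suc m) (\<lambda>u. u m = k \<and> u (Suc m) = l)"
      by (intro depends) auto
    ultimately show ?thesis
      using chain.prob_Collect_eq_0[OF event_depends, of "Suc m" "\<lambda>u. u m = k \<and> u (Suc m) = l" i]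
      by (simp add: path_prob_def)
  qed
  then have "AE \<omega> in P i. \<forall>m. \<forall>k\<in>A. \<forall>l\<in>B. \<not> (X m \<omega> = k \<and> X (Suc m) \<omega> = l)"
    unfolding AE_all_countable AE_ball_countable[OF countableI_type] by blast
  then show ?thesis by eventually_elim auto
qed

end

section \<open>Passage times along a path\<close>

text \<open>
\<open>first_at A s\<close> says that the passage time of \<open>A\<close> is \<open>s\<close>, and \<open>returned Eo s\<close> that \<open>Eo\<close> has been
reached by time \<open>s\<close> and has not been left since. The time $\tilde\tau^\pm - 1$ is the \<open>s\<close> with
\<open>returned Eo s u\<close> and \<open>u (Suc s) \<notin> Eo\<close>.
\<close>

definition first_at :: "'s set \<Rightarrow> nat \<Rightarrow> (nat \<Rightarrow> 's) \<Rightarrow> bool" where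
  "first_at A s u \<longleftrightarrow> 1 \<le> s \<and> u s \<in> A \<and> (\<forall>m. 1 \<le> m \<and> m < s \<longrightarrow> u m \<notin> A)"

definition returned :: "'s set \<Rightarrow> nat \<Rightarrow> (nat \<Rightarrow> 's) \<Rightarrow> bool" where
  "returned Eo s u \<longleftrightarrow> (\<exists>t\<le>s. first_at Eo t u \<and> (\<forall>m. t \<le> m \<and> m \<le> s \<longrightarrow> u m \<in> Eo))"

lemma first_at_pos: "first_at A s u \<Longrightarrow> 1 \<le> s"
  by (simp add: first_at_def)

lemma first_at_in: "first_at A s u \<Longrightarrow> u s \<in> A"
  by (simp add: first_at_def)

lemma first_at_unique: "first_at A s u \<Longrightarrow> first_at A t u \<Longrightarrow> s = t"
  unfolding first_at_def by (metis linorder_neqE_nat)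

lemma first_at_le: "first_at A s u \<Longrightarrow> 1 \<le> m \<Longrightarrow> u m \<in> A \<Longrightarrow> s \<le> m"
  unfolding first_at_def by (metis not_le)

lemma first_at_exists: "1 \<le> m \<Longrightarrow> u m \<in> A \<Longrightarrow> \<exists>s\<le>m. first_at A s u"
proof -
  assume m: "1 \<le> m" "u m \<in> A"
  let ?s = "LEAST s. 1 \<le> s \<and> u s \<in> A"
  have "1 \<le> ?s \<and> u ?s \<in> A" by (rule LeastI[of _ m]) (use m in auto)
  moreover have "?s \<le> m" by (rule Least_le) (use m in auto)
  moreover have "u k \<notin> A" if "1 \<le> k" "k < ?s" for k
    using not_less_Least[of k "\<lambda>s. 1 \<le> s \<and> u s \<in> A"] that by blast
  ultimately show ?thesis unfolding first_at_def by blast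
qed

lemma first_at_Suc:
  assumes "u 1 \<notin> A"
  shows "first_at A (Suc s) u \<longleftrightarrow> first_at A s (\<lambda>m. u (Suc m))"
proof
  assume *: "first_at A (Suc s) u"
  then have "s \<noteq> 0" using assms by (auto simp: first_at_def)
  with * show "first_at A s (\<lambda>m. u (Suc m))" by (auto simp: first_at_def)
next
  assume *: "first_at A s (\<lambda>m. u (Suc m))"
  have "u m \<notin> A" if "1 \<le> m" "m < Suc s" for m
  proof (cases "m = 1")
    case False
    with that obtain m' where "m = Suc m'" "1 \<le> m'" "m' < s" by (cases m) auto
    with * show ?thesis by (auto simp: first_at_def)
  qed (use assms in simp)
  with * show "first_at A (Suc s) u" by (auto simp: first_at_def)
qed

lemma returned_unique:
  assumes "returned Eo s u" "u (Suc s) \<notin> Eo" "returned Eo s' u" "u (Suc s') \<notin> Eo"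
  shows "s = s'"
proof -
  obtain t where t: "t \<le> s" "first_at Eo t u" "\<And>m. t \<le> m \<Longrightarrow> m \<le> s \<Longrightarrow> u m \<in> Eo"
    using assms(1) by (auto simp: returned_def)
  obtain t' where t': "t' \<le> s'" "first_at Eo t' u" "\<And>m. t' \<le> m \<Longrightarrow> m \<le> s' \<Longrightarrow> u m \<in> Eo"
    using assms(3) by (auto simp: returned_def)
  have "t' = t" using t(2) t'(2) by (rule first_at_unique[symmetric])
  have "\<not> s < s'"
    using t'(3)[of "Suc s"] t(1) assms(2) \<open>t' = t\<close> by auto
  moreover have "\<not> s' < s"
    using t(3)[of "Suc s'"] t'(1) assms(4) \<open>t' = t\<close> by auto
  ultimately show ?thesis by simp
qed

lemma first_at_depends: "depends_upto s (first_at A s)"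
  unfolding depends_upto_def first_at_def by (metis less_imp_le order_refl)

lemma returned_depends: "depends_upto s (returned Eo s)"
proof -
  have "depends_upto s (\<lambda>u. \<exists>t. t \<le> s \<and> first_at Eo t u \<and> (\<forall>m. t \<le> m \<and> m \<le> s \<longrightarrow> u m \<in> Eo))"
    by (intro depends depends_upto_mono[OF first_at_depends]) auto
  then show ?thesis by (simp add: returned_def[abs_def] conj_assoc)
qed

text \<open>
This reduces the infima in the definitions of \<open>hit\<close> and \<open>hit_after\<close> to conditions on the
trajectory.
\<close>

lemma Inf_enat_eq:
  "Inf {enat m |m. R m} = enat s \<longleftrightarrow> R s \<and> (\<forall>m<s. \<not> R m)"
proof (cases "\<exists>m. R m")
  case True
  let ?l = "LEAST m. R m"
  have l: "R ?l" using True by (rule LeastI_ex)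
  have "Inf {enat m |m. R m} = enat ?l"
    by (rule antisym[OF Inf_lower Inf_greatest]) (use l Least_le in \<open>auto\<close>)
  moreover have "?l = s \<longleftrightarrow> R s \<and> (\<forall>m<s. \<not> R m)"
    using l not_less_Least[of _ R] by (metis Least_le nat_neq_iff order_le_less)
  ultimately show ?thesis by simp
next
  case False
  then have "{enat m |m. R m} = {}" by auto
  then have "Inf {enat m |m. R m} = \<infinity>" by (simp add: top_enat_def)
  with False show ?thesis by auto
qed

lemma hit_eq: "hit X A \<omega> = enat s \<longleftrightarrow> first_at A s (\<lambda>m. X m \<omega>)"
  unfolding hit_def Inf_enat_eq first_at_def by auto

lemma enat_pred_eq: "e - 1 = enat s \<longleftrightarrow> e = enat (Suc s) \<or> (s = 0 \<and> e = 0)"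
proof (cases e)
  case (enat n)
  then show ?thesis by (cases n) (auto simp: one_enat_def zero_enat_def)
qed (auto simp: zero_enat_def)

lemma hit_pred_eq: "hit X A \<omega> - 1 = enat s \<longleftrightarrow> first_at A (Suc s) (\<lambda>m. X m \<omega>)"
proof -
  have "hit X A \<omega> \<noteq> 0"
    using hit_eq[of X A \<omega> 0] by (auto simp: zero_enat_def first_at_def)
  then show ?thesis by (simp add: enat_pred_eq hit_eq)
qed

lemma hit_after_pred_eq:
  "hit_after X Eo (UNIV - Eo) \<omega> - 1 = enat s \<longleftrightarrow>
    returned Eo s (\<lambda>m. X m \<omega>) \<and> X (Suc s) \<omega> \<notin> Eo"
proof -
  let ?u = "\<lambda>m. X m \<omega>"
  have after: "hit_after X Eo (UNIV - Eo) \<omega> = enat r \<longleftrightarrow>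
      (hit X Eo \<omega> \<le> enat r \<and> ?u r \<notin> Eo) \<and> (\<forall>m<r. \<not> (hit X Eo \<omega> \<le> enat m \<and> ?u m \<notin> Eo))" for r
    unfolding hit_after_def Inf_enat_eq by simp
  show ?thesis
  proof (cases "hit X Eo \<omega>")
    case (enat t)
    then have t: "first_at Eo t ?u" by (simp add: hit_eq)
    have after': "hit_after X Eo (UNIV - Eo) \<omega> = enat r \<longleftrightarrow>
        t \<le> r \<and> ?u r \<notin> Eo \<and> (\<forall>m<r. t \<le> m \<longrightarrow> ?u m \<in> Eo)" for r
      unfolding after enat by auto
    have ret: "returned Eo s ?u \<longleftrightarrow> t \<le> s \<and> (\<forall>m. t \<le> m \<and> m \<le> s \<longrightarrow> ?u m \<in> Eo)"
      unfolding returned_def using t first_at_unique[OF t] by blast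
    have "hit_after X Eo (UNIV - Eo) \<omega> \<noteq> 0"
      using after'[of 0] first_at_pos[OF t] by (auto simp: zero_enat_def)
    then have "hit_after X Eo (UNIV - Eo) \<omega> - 1 = enat s \<longleftrightarrow>
        t \<le> Suc s \<and> ?u (Suc s) \<notin> Eo \<and> (\<forall>m<Suc s. t \<le> m \<longrightarrow> ?u m \<in> Eo)"
      by (simp add: enat_pred_eq after')
    then show ?thesis
      unfolding ret using first_at_in[OF t] by (auto simp: less_Suc_eq_le le_Suc_eq)
  next
    case infinity
    then have "\<not> first_at Eo t ?u" for t
      using hit_eq[of X Eo \<omega> t] by auto
    moreover have "hit_after X Eo (UNIV - Eo) \<omega> \<noteq> enat r" for r
      unfolding after infinity by simp
    ultimately show ?thesis
      by (auto simp: enat_pred_eq returned_def zero_enat_def)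
  qed
qed

section \<open>Modified sojourn time along a path\<close>

text \<open>
The sojourn time as a function of the trajectory is that of the coordinate process.
\<close>

abbreviation path_sojourn :: "'s set \<Rightarrow> 's set \<Rightarrow> nat \<Rightarrow> (nat \<Rightarrow> 's) \<Rightarrow> nat" where
  "path_sojourn Eo A n u \<equiv> sojourn (\<lambda>m u. u m) Eo A n u"

abbreviation path_delta :: "'s set \<Rightarrow> 's set \<Rightarrow> nat \<Rightarrow> (nat \<Rightarrow> 's) \<Rightarrow> nat" where
  "path_delta Eo A n u \<equiv> delta (\<lambda>m u. u m) Eo A n u"

lemma sojourn_path: "sojourn X Eo A n \<omega> = path_sojourn Eo A n (\<lambda>m. X m \<omega>)"
  by (simp add: sojourn_def delta_def)

lemma delta_le_1: "delta X Eo A m \<omega> \<le> 1"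
  by (simp add: delta_def)

lemma delta_iff:
  "delta X Eo A m \<omega> = 1 \<longleftrightarrow> (\<exists>r. 1 \<le> r \<and> r \<le> m \<and> X r \<omega> \<in> A \<and> (\<forall>k. r < k \<and> k \<le> m \<longrightarrow> X k \<omega> \<in> Eo))"
proof -
  have "(\<exists>l<m. X (m - l) \<omega> \<in> A \<and> (\<forall>k\<in>{m - l + 1..m}. X k \<omega> \<in> Eo)) \<longleftrightarrow>
      (\<exists>r. 1 \<le> r \<and> r \<le> m \<and> X r \<omega> \<in> A \<and> (\<forall>k. r < k \<and> k \<le> m \<longrightarrow> X k \<omega> \<in> Eo))" (is "?L \<longleftrightarrow> ?R")
  proof
    assume ?L
    then obtain l where "l < m" "X (m - l) \<omega> \<in> A" "\<forall>k\<in>{m - l + 1..m}. X k \<omega> \<in> Eo" by blast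
    then show ?R by (intro exI[of _ "m - l"]) auto
  next
    assume ?R
    then obtain r where "1 \<le> r" "r \<le> m" "X r \<omega> \<in> A" "\<forall>k. r < k \<and> k \<le> m \<longrightarrow> X k \<omega> \<in> Eo" by blast
    then show ?L by (intro exI[of _ "m - r"]) auto
  qed
  then show ?thesis by (simp add: delta_def)
qed

lemma sojourn_le: "sojourn X Eo A n \<omega> \<le> n"
proof -
  have "sojourn X Eo A n \<omega> \<le> (\<Sum>m=1..n. 1)"
    unfolding sojourn_def by (rule sum_mono) (rule delta_le_1)
  then show ?thesis by simp
qed

lemma path_sojourn_depends:
  fixes Eo :: "'s set"
  shows "depends_upto n (\<lambda>u. path_sojourn Eo A n u = k)"
proof -
  have "path_sojourn Eo A n u = path_sojourn Eo A n v" if "\<forall>m\<le>n. u m = v m" for u v :: "nat \<Rightarrow> 's"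
    unfolding sojourn_def
  proof (rule sum.cong[OF refl])
    fix m assume "m \<in> {1..n}"
    then have "path_delta Eo A m u = 1 \<longleftrightarrow> path_delta Eo A m v = 1"
      using that unfolding delta_iff by (auto intro!: ex_cong)
    then show "path_delta Eo A m u = path_delta Eo A m v"
      using delta_le_1[of _ Eo A m u] delta_le_1[of _ Eo A m v] by (metis (no_types) le_antisym less_one not_le)
  qed
  then show ?thesis unfolding depends_upto_def by metis
qed

lemma last_outside:
  fixes u :: "nat \<Rightarrow> 's"
  assumes "u 1 \<notin> Eo" "1 \<le> m"
  obtains r where "1 \<le> r" "r \<le> m" "u r \<notin> Eo" "\<forall>k. r < k \<and> k \<le> m \<longrightarrow> u k \<in> Eo"
proof -
  let ?R = "\<lambda>r. 1 \<le> r \<and> r \<le> m \<and> u r \<notin> Eo"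
  let ?r = "GREATEST r. ?R r"
  have ex: "?R 1" using assms by simp
  have "?R ?r" by (rule GreatestI_nat[where k = 1 and b = m]) (use ex in auto)
  moreover have "u k \<in> Eo" if "?r < k" "k \<le> m" for k
  proof (rule ccontr)
    assume "u k \<notin> Eo"
    then have "k \<le> ?r" by (intro Greatest_le_nat[where b = m]) (use that in auto)
    with that show False by simp
  qed
  ultimately show ?thesis
    by (intro that[of ?r]) auto
qed

text \<open>
\<open>\<delta>\<^sub>m\<close> only looks at the last state outside \<open>Eo\<close> up to time \<open>m\<close>, which lies in exactly one of the
two sides. It exists because the trajectory leaves \<open>Eo\<close> in its first step.
\<close>

lemma path_delta_complement:
  assumes "u 1 \<notin> Eo" "1 \<le> m" and "A \<inter> B = {}" "A \<union> B = UNIV - Eo"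
  shows "path_delta Eo A m u + path_delta Eo B m u = 1"
proof -
  obtain r where r: "1 \<le> r" "r \<le> m" "u r \<notin> Eo" "\<forall>k. r < k \<and> k \<le> m \<longrightarrow> u k \<in> Eo"
    using last_outside[of u Eo m] assms(1,2) by metis
  have *: "path_delta Eo C m u = 1 \<longleftrightarrow> u r \<in> C" if "C \<subseteq> UNIV - Eo" for C
  proof
    assume "path_delta Eo C m u = 1"
    then obtain r' where r': "1 \<le> r'" "r' \<le> m" "u r' \<in> C" "\<forall>k. r' < k \<and> k \<le> m \<longrightarrow> u k \<in> Eo"
      unfolding delta_iff by blast
    then have "u r' \<notin> Eo" using that by auto
    with r r' have "r' = r" by (metis linorder_neqE_nat)
    with r' show "u r \<in> C" by simp
  next
    assume "u r \<in> C"
    with r show "path_delta Eo C m u = 1" unfolding delta_iff by blast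
  qed
  have "u r \<in> A \<longleftrightarrow> u r \<notin> B" using r(3) assms(3,4) by auto
  then have "path_delta Eo A m u = 1 \<longleftrightarrow> path_delta Eo B m u \<noteq> 1"
    using *[of A] *[of B] assms(4) by auto
  then show ?thesis
    using delta_le_1[of "\<lambda>m u. u m" Eo A m u] delta_le_1[of "\<lambda>m u. u m" Eo B m u] by linarith
qed

lemma path_sojourn_complement:
  assumes "u 1 \<notin> Eo" and "A \<inter> B = {}" "A \<union> B = UNIV - Eo"
  shows "path_sojourn Eo A n u + path_sojourn Eo B n u = n"
proof -
  have "path_sojourn Eo A n u + path_sojourn Eo B n u = (\<Sum>m=1..n. 1)"
    unfolding sojourn_def sum.distrib[symmetric]
    by (rule sum.cong[OF refl]) (use path_delta_complement[of u Eo _ A B] assms in auto)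
  then show ?thesis by simp
qed

lemma path_sojourn_full_iff:
  assumes "u 1 \<notin> Eo" and AB: "A \<inter> B = {}" "A \<union> B = UNIV - Eo"
  shows "path_sojourn Eo A n u = n \<longleftrightarrow> (\<forall>s. 1 \<le> s \<and> s \<le> n \<longrightarrow> u s \<notin> B)"
proof -
  have "path_sojourn Eo A n u = n \<longleftrightarrow> path_sojourn Eo B n u = 0"
    using path_sojourn_complement[of u Eo A B n] assms by linarith
  also have "\<dots> \<longleftrightarrow> (\<forall>m\<in>{1..n}. path_delta Eo B m u \<noteq> 1)"
    unfolding sojourn_def using delta_le_1[of "\<lambda>m u. u m" Eo B _ u]
    by (auto simp: le_Suc_eq)
  also have "\<dots> \<longleftrightarrow> (\<forall>s. 1 \<le> s \<and> s \<le> n \<longrightarrow> u s \<notin> B)"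
  proof (intro iffI allI impI ballI notI)
    fix s assume "\<forall>m\<in>{1..n}. path_delta Eo B m u \<noteq> 1" "1 \<le> s \<and> s \<le> n" "u s \<in> B"
    moreover from this have "path_delta Eo B s u = 1" unfolding delta_iff by (intro exI[of _ s]) auto
    ultimately show False by auto
  next
    fix m assume "\<forall>s. 1 \<le> s \<and> s \<le> n \<longrightarrow> u s \<notin> B" "m \<in> {1..n}" "path_delta Eo B m u = 1"
    then show False unfolding delta_iff by (metis atLeastAtMost_iff order_trans)
  qed
  finally show ?thesis .
qed

text \<open>
A step out of \<open>Eo\<close> at time \<open>s\<close> makes the trajectory forget its past: no later \<open>\<delta>\<^sub>m\<close> looks behind
time \<open>s\<close>.
\<close>

lemma path_sojourn_shift:
  assumes "u (Suc s) \<notin> Eo" "A \<inter> Eo = {}"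
  shows "path_sojourn Eo A (s + n) u = path_sojourn Eo A s u + path_sojourn Eo A n (\<lambda>m. u (s + m))"
proof -
  have delta: "path_delta Eo A (s + m) u = path_delta Eo A m (\<lambda>m. u (s + m))" if "1 \<le> m" for m
  proof -
    have "path_delta Eo A (s + m) u = 1 \<longleftrightarrow> path_delta Eo A m (\<lambda>m. u (s + m)) = 1"
      unfolding delta_iff
    proof
      assume "\<exists>r. 1 \<le> r \<and> r \<le> s + m \<and> u r \<in> A \<and> (\<forall>k. r < k \<and> k \<le> s + m \<longrightarrow> u k \<in> Eo)"
      then obtain r where r: "1 \<le> r" "r \<le> s + m" "u r \<in> A" "\<forall>k. r < k \<and> k \<le> s + m \<longrightarrow> u k \<in> Eo"
        by blast
      have "\<not> r < Suc s" using r(4) assms(1) that by auto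
      then show "\<exists>r. 1 \<le> r \<and> r \<le> m \<and> u (s + r) \<in> A \<and> (\<forall>k. r < k \<and> k \<le> m \<longrightarrow> u (s + k) \<in> Eo)"
        using r by (intro exI[of _ "r - s"]) auto
    next
      assume "\<exists>r. 1 \<le> r \<and> r \<le> m \<and> u (s + r) \<in> A \<and> (\<forall>k. r < k \<and> k \<le> m \<longrightarrow> u (s + k) \<in> Eo)"
      then obtain r where r: "1 \<le> r" "r \<le> m" "u (s + r) \<in> A"
          "\<And>k. r < k \<Longrightarrow> k \<le> m \<Longrightarrow> u (s + k) \<in> Eo"
        by blast
      have "u k \<in> Eo" if "s + r < k" "k \<le> s + m" for k
        using r(4)[of "k - s"] that by auto
      with r show "\<exists>r. 1 \<le> r \<and> r \<le> s + m \<and> u r \<in> A \<and> (\<forall>k. r < k \<and> k \<le> s + m \<longrightarrow> u k \<in> Eo)"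
        by (intro exI[of _ "s + r"]) auto
    qed
    then show ?thesis
      using delta_le_1[of "\<lambda>m u. u m" Eo A "s + m" u] delta_le_1[of "\<lambda>m u. u m" Eo A m "\<lambda>m. u (s + m)"]
      by linarith
  qed
  have "path_sojourn Eo A (s + n) u = path_sojourn Eo A s u + (\<Sum>m=Suc s..s + n. path_delta Eo A m u)"
    unfolding sojourn_def by (subst sum.ub_add_nat) auto
  also have "(\<Sum>m=Suc s..s + n. path_delta Eo A m u) = (\<Sum>m=1..n. path_delta Eo A (s + m) u)"
    using sum.shift_bounds_cl_nat_ivl[of "\<lambda>m. path_delta Eo A m u" 1 s n] by (simp add: add.commute)
  also have "\<dots> = path_sojourn Eo A n (\<lambda>m. u (s + m))"
    unfolding sojourn_def by (rule sum.cong[OF refl]) (use delta in auto)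
  finally show ?thesis .
qed

definition no_direct :: "'s set \<Rightarrow> 's set \<Rightarrow> (nat \<Rightarrow> 's) \<Rightarrow> bool" where
  "no_direct A B u \<longleftrightarrow> (\<forall>m. u m \<in> A \<longrightarrow> u (Suc m) \<notin> B)"

lemma returned_avoids:
  assumes good: "no_direct A B u" and AB: "A \<inter> B = {}" "A \<union> B = UNIV - Eo"
    and u1: "u 1 \<in> A" and ret: "returned Eo s u" and m: "1 \<le> m" "m \<le> s"
  shows "u m \<notin> B"
proof -
  obtain t where t: "t \<le> s" "first_at Eo t u" "\<And>m. t \<le> m \<Longrightarrow> m \<le> s \<Longrightarrow> u m \<in> Eo"
    using ret by (auto simp: returned_def)
  \<comment> \<open>Before the return the trajectory cannot change sides.\<close>
  have before: "u m \<in> A" if "1 \<le> m" "m < t" for m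
    using that
  proof (induction m rule: nat_induct_at_least)
    case base
    show ?case using u1 by simp
  next
    case (Suc m)
    then have "u m \<in> A" by simp
    then have "u (Suc m) \<notin> B" using good by (auto simp: no_direct_def)
    moreover have "u (Suc m) \<notin> Eo" using t(2) Suc by (auto simp: first_at_def)
    ultimately show ?case using AB by auto
  qed
  show ?thesis
  proof (cases "m < t")
    case True
    with before m AB show ?thesis by auto
  next
    case False
    with t(3)[of m] m AB show ?thesis by auto
  qed
qed

text \<open>
The opposite side can only be entered from \<open>Eo\<close>, so that the first stay in \<open>Eo\<close> is over by then.
\<close>

lemma visit_completes_return:
  assumes good: "no_direct A B u" and AB: "A \<inter> B = {}" "A \<union> B = UNIV - Eo"
    and u1: "u 1 \<in> A" and s: "1 \<le> s" "u s \<in> B"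
  shows "\<exists>r<s. returned Eo r u \<and> u (Suc r) \<notin> Eo"
proof -
  obtain f where f: "f \<le> s" "first_at B f u" using first_at_exists[of s u B] s by blast
  have "f \<noteq> 1" using f(2) u1 AB by (auto simp: first_at_def)
  with f(2) obtain g where g: "f = Suc g" "1 \<le> g" by (cases f) (auto simp: first_at_def)
  have "u g \<notin> B" using f(2) g by (auto simp: first_at_def)
  moreover have "u g \<notin> A" using good f(2) g by (auto simp: first_at_def no_direct_def)
  ultimately have "u g \<in> Eo" using AB by auto
  then obtain t where t: "t \<le> g" "first_at Eo t u" using first_at_exists[of g u Eo] g(2) by blast
  let ?r = "LEAST r. t \<le> r \<and> u (Suc r) \<notin> Eo"
  have "u (Suc g) \<notin> Eo" using f(2) g AB by (auto simp: first_at_def)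
  with t have ex: "t \<le> g \<and> u (Suc g) \<notin> Eo" by simp
  have r: "t \<le> ?r \<and> u (Suc ?r) \<notin> Eo" using ex by (rule LeastI)
  have le: "?r \<le> g" using ex by (rule Least_le)
  have "u m \<in> Eo" if "t \<le> m" "m \<le> ?r" for m
  proof (cases "m = t")
    case True
    then show ?thesis using t(2) by (simp add: first_at_def)
  next
    case False
    with that obtain m' where "m = Suc m'" "t \<le> m'" "m' < ?r" by (cases m) auto
    then show ?thesis using not_less_Least[of m' "\<lambda>r. t \<le> r \<and> u (Suc r) \<notin> Eo"] by blast
  qed
  with r t(2) have "returned Eo ?r u" unfolding returned_def by blast
  with r le g f(1) show ?thesis by (intro exI[of _ ?r]) auto
qed

section \<open>Renewal sums\<close>

lemma geometric_summable: "\<bar>x\<bar> < 1 \<Longrightarrow> (\<lambda>n. \<bar>x\<bar> ^ n) summable_on (UNIV :: nat set)" for x :: real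
  by (subst summable_on_UNIV_nonneg_real_iff) (auto intro: summable_geometric)

lemma summable_on_weighted:
  fixes f g :: "'a \<Rightarrow> real"
  assumes "(\<lambda>a. \<bar>g a\<bar>) summable_on A" and "\<And>a. a \<in> A \<Longrightarrow> \<bar>f a\<bar> \<le> \<bar>g a\<bar>"
  shows "f summable_on A"
proof -
  have "(\<lambda>a. norm (f a)) summable_on A"
    by (rule Infinite_Sum.abs_summable_on_comparison_test'[OF assms(1)]) (use assms(2) in auto)
  then show ?thesis by (rule abs_summable_summable)
qed

context homogeneous_markov_chain
begin

text \<open>
The common form of all decompositions. The events \<open>E k\<close> of a series with weights \<open>W\<close> split into
pieces \<open>Q (j, m, t)\<close>, where \<open>j\<close> is the state at the time of the cut, \<open>m\<close> records what happened
before it and \<open>t\<close> what happens after it. If probability and weight of the pieces factorise into a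
past and a future part, then so does the generating function. The splitting is only required on
trajectories in a set \<open>good\<close> of full measure.
\<close>

lemma renewal_has_sum:
  fixes Q :: "'j :: countable \<times> 'm :: countable \<times> 't :: countable \<Rightarrow> (nat \<Rightarrow> 's) \<Rightarrow> bool"
    and E :: "'k \<Rightarrow> (nat \<Rightarrow> 's) \<Rightarrow> bool"
  assumes dep_Q: "\<And>p. p \<in> J \<times> S \<times> T \<Longrightarrow> \<exists>n. depends_upto n (Q p)"
    and dep_E: "\<And>k. k \<in> K \<Longrightarrow> \<exists>n. depends_upto n (E k)"
    and good: "AE \<omega> in P i. good (\<lambda>m. X m \<omega>)"
    and g: "\<And>p. p \<in> J \<times> S \<times> T \<Longrightarrow> g p \<in> K"
    and cover: "\<And>k u. k \<in> K \<Longrightarrow> good u \<Longrightarrow> E k u \<longleftrightarrow> (\<exists>p \<in> J \<times> S \<times> T. g p = k \<and> Q p u)"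
    and unique: "\<And>p p' u. p \<in> J \<times> S \<times> T \<Longrightarrow> p' \<in> J \<times> S \<times> T \<Longrightarrow> good u \<Longrightarrow>
      g p = g p' \<Longrightarrow> Q p u \<Longrightarrow> Q p' u \<Longrightarrow> p = p'"
    and factor: "\<And>j m t. j \<in> J \<Longrightarrow> m \<in> S \<Longrightarrow> t \<in> T \<Longrightarrow> path_prob i (Q (j, m, t)) = a j m * b j t"
    and weight: "\<And>j m t. j \<in> J \<Longrightarrow> m \<in> S \<Longrightarrow> t \<in> T \<Longrightarrow> W (g (j, m, t)) = v m * w t"
    and total: "((\<lambda>k. path_prob i (E k) * W k) has_sum z) K"
    and A: "\<And>j. j \<in> J \<Longrightarrow> ((\<lambda>m. a j m * v m) has_sum A j) S"
    and B: "\<And>j. j \<in> J \<Longrightarrow> ((\<lambda>t. b j t * w t) has_sum B j) T"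
  shows "((\<lambda>j. A j * B j) has_sum z) J"
proof (rule has_sum_product_blocks[OF _ A B])
  have "((\<lambda>p. path_prob i (Q p) * W (g p)) has_sum z) (J \<times> S \<times> T)"
  proof (rule has_sum_regroup[OF _ g _ total])
    fix k assume k: "k \<in> K"
    show "((\<lambda>p. path_prob i (Q p)) has_sum path_prob i (E k)) {p \<in> J \<times> S \<times> T. g p = k}"
      unfolding path_prob_def
    proof (rule chain.prob_has_sum)
      show "{\<omega> \<in> space (P i). Q p (\<lambda>m. X m \<omega>)} \<in> sets (P i)" if "p \<in> {p \<in> J \<times> S \<times> T. g p = k}" for p
        using dep_Q[of p] that event_depends by blast
      show "{\<omega> \<in> space (P i). E k (\<lambda>m. X m \<omega>)} \<in> sets (P i)"
        using dep_E[OF k] event_depends by blast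
      show "AE \<omega> in P i. E k (\<lambda>m. X m \<omega>) \<longleftrightarrow>
          (\<exists>p\<in>{p \<in> J \<times> S \<times> T. g p = k}. Q p (\<lambda>m. X m \<omega>))"
        using good
      proof eventually_elim
        case (elim \<omega>)
        show ?case unfolding cover[OF k elim] by blast
      qed
      show "AE \<omega> in P i. \<forall>p\<in>{p \<in> J \<times> S \<times> T. g p = k}. \<forall>p'\<in>{p \<in> J \<times> S \<times> T. g p = k}.
          Q p (\<lambda>m. X m \<omega>) \<longrightarrow> Q p' (\<lambda>m. X m \<omega>) \<longrightarrow> p = p'"
        using good
      proof eventually_elim
        case (elim \<omega>)
        then show ?case using unique by blast
      qed
    qed
  qed simp_all
  then show "((\<lambda>(j, m, t). a j m * v m * (b j t * w t)) has_sum z) (J \<times> S \<times> T)"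
    by (rule has_sum_cong[THEN iffD1, rotated]) (auto simp: factor weight)
qed

section \<open>Generating functions as sums over path probabilities\<close>

lemma time_pow_sum:
  assumes dep: "\<And>s. \<exists>n. depends_upto n (\<lambda>u. c u \<and> E s u \<and> u s = j)"
    and \<tau>: "\<And>\<omega> s. \<tau> \<omega> = enat s \<longleftrightarrow> E s (\<lambda>m. X m \<omega>)"
    and f: "\<And>\<omega>. f \<omega> = (if c (\<lambda>m. X m \<omega>) then time_pow X \<tau> j x \<omega> else 0)"
  shows "integrable (P i) f \<longleftrightarrow> (\<lambda>s. path_prob i (\<lambda>u. c u \<and> E s u \<and> u s = j) * x ^ s) summable_on UNIV"
    and "integrable (P i) f \<Longrightarrow>
      ((\<lambda>s. path_prob i (\<lambda>u. c u \<and> E s u \<and> u s = j) * x ^ s) has_sum (\<integral>\<omega>. f \<omega> \<partial>P i)) UNIV"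
proof -
  let ?E = "\<lambda>s \<omega>. c (\<lambda>m. X m \<omega>) \<and> E s (\<lambda>m. X m \<omega>) \<and> X s \<omega> = j"
  have ev: "{\<omega> \<in> space (P i). ?E s \<omega>} \<in> sets (P i)" for s
    using dep[of s] event_depends by blast
  have unique: "s = s'" if "?E s \<omega>" "?E s' \<omega>" for \<omega> s s'
    using that \<tau>[of \<omega> s] \<tau>[of \<omega> s'] by simp
  have on: "f \<omega> = x ^ s" if "?E s \<omega>" for \<omega> s
    using that \<tau>[of \<omega> s] by (simp add: f time_pow_def)
  have off: "f \<omega> = 0" if none: "\<And>s. \<not> ?E s \<omega>" for \<omega>
  proof (cases "\<tau> \<omega>")
    case (enat s)
    with none[of s] \<tau>[of \<omega> s] show ?thesis by (auto simp: f time_pow_def)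
  qed (simp add: f time_pow_def)
  show "integrable (P i) f \<longleftrightarrow> (\<lambda>s. path_prob i (\<lambda>u. c u \<and> E s u \<and> u s = j) * x ^ s) summable_on UNIV"
    unfolding path_prob_def
    by (rule chain.expectation_power_time(1)[where E = ?E], rule ev, erule (1) unique, erule on, rule off, blast)
  show "((\<lambda>s. path_prob i (\<lambda>u. c u \<and> E s u \<and> u s = j) * x ^ s) has_sum (\<integral>\<omega>. f \<omega> \<partial>P i)) UNIV"
    if "integrable (P i) f"
    unfolding path_prob_def
    by (rule chain.expectation_power_time(2)[where E = ?E], rule ev, erule (1) unique, erule on, rule off, blast, rule that)
qed

lemma path_prob_powers_summable:
  assumes "\<bar>x\<bar> < 1"
  shows "(\<lambda>s. path_prob i (E s) * x ^ s) summable_on UNIV"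
proof (rule summable_on_weighted)
  show "(\<lambda>s. \<bar>x ^ s\<bar>) summable_on UNIV"
    unfolding power_abs by (rule geometric_summable[OF assms])
  show "\<bar>path_prob i (E s) * x ^ s\<bar> \<le> \<bar>x ^ s\<bar>" for s
    unfolding abs_mult by (rule mult_left_le_one_le) simp_all
qed

lemma time_pow_integrable:
  assumes dep: "\<And>s. \<exists>n. depends_upto n (\<lambda>u. c u \<and> E s u \<and> u s = j)"
    and \<tau>: "\<And>\<omega> s. \<tau> \<omega> = enat s \<longleftrightarrow> E s (\<lambda>m. X m \<omega>)"
    and f: "\<And>\<omega>. f \<omega> = (if c (\<lambda>m. X m \<omega>) then time_pow X \<tau> j x \<omega> else 0)"
    and x: "\<bar>x\<bar> < 1"
  shows "integrable (P i) f"
  unfolding time_pow_sum(1)[where \<tau> = \<tau> and E = E and c = c, OF dep \<tau> f]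
  by (rule path_prob_powers_summable[OF x])

lemma H_dep: "\<exists>n. depends_upto n (\<lambda>u. True \<and> first_at A s u \<and> u s = j)"
  by (intro exI[of _ s] depends first_at_depends) auto

lemma H_var_eq: "H_var X A j x \<omega> = (if True then time_pow X (hit X A) j x \<omega> else 0)"
  by (simp add: H_var_def)

lemma H_has_sum:
  assumes "integrable (P i) (H_var X A j x)"
  shows "((\<lambda>s. path_prob i (\<lambda>u. first_at A s u \<and> u s = j) * x ^ s) has_sum H P X A i j x) UNIV"
  using time_pow_sum(2)[OF H_dep hit_eq H_var_eq assms] by (simp add: H_def)

lemma H_integrable: "\<bar>x\<bar> < 1 \<Longrightarrow> integrable (P i) (H_var X A j x)"
  by (rule time_pow_integrable[OF H_dep hit_eq H_var_eq])

lemma H_zero: "H P X A i j 0 = 0"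
proof -
  have "((\<lambda>s. path_prob i (\<lambda>u. first_at A s u \<and> u s = j) * 0 ^ s) has_sum H P X A i j 0) UNIV"
    by (rule H_has_sum, rule H_integrable) simp
  moreover have "path_prob i (\<lambda>u. first_at A s u \<and> u s = j) * 0 ^ s = 0" for s
    by (cases s) (auto simp: first_at_def)
  ultimately show ?thesis
    using has_sum_unique[OF _ has_sum_0] by force
qed

lemma H_first_dep: "\<exists>n. depends_upto n (\<lambda>u. u 1 \<in> A \<and> first_at B s u \<and> u s = j)"
  by (intro exI[of _ "Suc s"] depends depends_upto_mono[OF first_at_depends]) auto

lemma H_first_has_sum:
  assumes "integrable (P i) (H_first_var X A B j x)"
  shows "((\<lambda>s. path_prob i (\<lambda>u. u 1 \<in> A \<and> first_at B s u \<and> u s = j) * x ^ s) has_sum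
    H_first P X A B i j x) UNIV"
  using time_pow_sum(2)[OF H_first_dep hit_eq H_first_var_def assms] by (simp add: H_first_def)

lemma H_first_integrable: "\<bar>x\<bar> < 1 \<Longrightarrow> integrable (P i) (H_first_var X A B j x)"
  by (rule time_pow_integrable[OF H_first_dep hit_eq H_first_var_def])

lemma H_pm_dep: "\<exists>n. depends_upto n (\<lambda>u. True \<and> first_at A (Suc s) u \<and> u s = j)"
  by (intro exI[of _ "Suc s"] depends first_at_depends) auto

lemma H_pm_var_eq: "H_pm_var X A j x \<omega> = (if True then time_pow X (\<lambda>\<omega>. hit X A \<omega> - 1) j x \<omega> else 0)"
  by (simp add: H_pm_var_def)

lemma H_pm_has_sum:
  assumes "integrable (P i) (H_pm_var X A j x)"
  shows "((\<lambda>s. path_prob i (\<lambda>u. first_at A (Suc s) u \<and> u s = j) * x ^ s) has_sum H_pm P X A i j x) UNIV"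
  using time_pow_sum(2)[OF H_pm_dep hit_pred_eq H_pm_var_eq assms] by (simp add: H_pm_def)

lemma H_pm_integrable: "\<bar>x\<bar> < 1 \<Longrightarrow> integrable (P i) (H_pm_var X A j x)"
  by (rule time_pow_integrable[OF H_pm_dep hit_pred_eq H_pm_var_eq])

lemma Ht_dep: "\<exists>n. depends_upto n (\<lambda>u. u 1 \<in> A \<and> (returned Eo s u \<and> u (Suc s) \<notin> Eo) \<and> u s = j)"
  by (intro exI[of _ "Suc s"] depends depends_upto_mono[OF returned_depends]) auto

lemma Ht_has_sum:
  assumes "integrable (P i) (Ht_var X Eo (UNIV - Eo) A j x)"
  shows "((\<lambda>s. path_prob i (\<lambda>u. u 1 \<in> A \<and> (returned Eo s u \<and> u (Suc s) \<notin> Eo) \<and> u s = j) * x ^ s) has_sum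
    Ht P X Eo (UNIV - Eo) A i j x) UNIV"
  using time_pow_sum(2)[OF Ht_dep hit_after_pred_eq Ht_var_def assms] by (simp add: Ht_def)

lemma Ht_integrable: "\<bar>x\<bar> < 1 \<Longrightarrow> integrable (P i) (Ht_var X Eo (UNIV - Eo) A j x)"
  by (rule time_pow_integrable[OF Ht_dep hit_after_pred_eq Ht_var_def])

section \<open>Cutting at passage times\<close>

lemma first_step_markov:
  assumes "depends_upto n \<psi>"
  shows "path_prob i (\<lambda>u. u 1 = k \<and> \<psi> (\<lambda>m. u (Suc m))) = trans_prob P X i k * path_prob k \<psi>"
  using markov[OF depends_const assms, of i True 1 k] by (simp add: trans_prob_eq)

text \<open>
The cut is at time 1, so the past is trivial apart from the state \<open>k\<close> and contributes the factor
\<open>x\<close> for one step.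
\<close>

lemma H_first_first_step:
  assumes AB: "A \<inter> B = {}"
    and int: "integrable (P i) (H_first_var X A B j x)"
    and int_k: "\<And>k. k \<in> A \<Longrightarrow> integrable (P k) (H_var X B j x)"
  shows "((\<lambda>k. trans_prob P X i k * x * H P X B k j x) has_sum H_first P X A B i j x) A"
proof (rule renewal_has_sum[where good = "\<lambda>_. True" and S = "{()}" and T = UNIV and K = UNIV and
    Q = "\<lambda>(k, _, s) u. u 1 = k \<and> first_at B s (\<lambda>m. u (Suc m)) \<and> u (Suc s) = j" and
    g = "\<lambda>(k, _, s). Suc s" and W = "\<lambda>s. x ^ s" and v = "\<lambda>_. x" and w = "\<lambda>s. x ^ s" and
    E = "\<lambda>s u. u 1 \<in> A \<and> first_at B s u \<and> u s = j" and
    a = "\<lambda>k _. trans_prob P X i k" and b = "\<lambda>k s. path_prob k (\<lambda>u. first_at B s u \<and> u s = j)"])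
  let ?\<psi> = "\<lambda>s u. first_at B s u \<and> u s = j"
  have dep: "depends_upto s (?\<psi> s)" for s
    by (intro depends first_at_depends) auto
  show "\<exists>n. depends_upto n (case p of (k, _, s) \<Rightarrow> \<lambda>u. u 1 = k \<and> first_at B s (\<lambda>m. u (Suc m)) \<and> u (Suc s) = j)"
    for p :: "'s \<times> unit \<times> nat"
  proof (cases p)
    case (fields k _ s)
    have "depends_upto (Suc s) (\<lambda>u. u 1 = k \<and> first_at B s (\<lambda>m. u (1 + m)) \<and> u (Suc s) = j)"
      by (intro depends depends_shift[OF first_at_depends]) auto
    then show ?thesis unfolding fields by auto
  qed
  show "\<exists>n. depends_upto n (\<lambda>u. u 1 \<in> A \<and> first_at B s u \<and> u s = j)" for s
    by (rule H_first_dep)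
  show "(u 1 \<in> A \<and> first_at B n u \<and> u n = j) \<longleftrightarrow> (\<exists>p\<in>A \<times> {()} \<times> UNIV. (case p of (k, _, s) \<Rightarrow> Suc s) = n \<and>
      (case p of (k, _, s) \<Rightarrow> \<lambda>u. u 1 = k \<and> first_at B s (\<lambda>m. u (Suc m)) \<and> u (Suc s) = j) u)" for n u
  proof -
    have "first_at B (Suc s') u \<longleftrightarrow> first_at B s' (\<lambda>m. u (Suc m))" if "u 1 \<in> A" for s'
      by (rule first_at_Suc) (use that AB in auto)
    then show ?thesis by (cases n) (auto simp: first_at_def[of _ 0])
  qed
  show "path_prob i (case (k, m, s) of (k, _, s) \<Rightarrow> \<lambda>u. u 1 = k \<and> first_at B s (\<lambda>m. u (Suc m)) \<and> u (Suc s) = j)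
      = trans_prob P X i k * path_prob k (?\<psi> s)" for k s and m :: unit
    using first_step_markov[OF dep, of i k s] by simp
  show "((\<lambda>s. path_prob i (\<lambda>u. u 1 \<in> A \<and> first_at B s u \<and> u s = j) * x ^ s) has_sum
      H_first P X A B i j x) UNIV"
    using int by (rule H_first_has_sum)
  show "((\<lambda>s. path_prob k (\<lambda>u. first_at B s u \<and> u s = j) * x ^ s) has_sum H P X B k j x) UNIV"
    if "k \<in> A" for k
    using int_k[OF that] by (rule H_has_sum)
qed (auto simp: has_sum_finite_iff)

text \<open>
The cut is at the first return to \<open>Eo\<close>. What comes before it is the first step to \<open>k\<close> followed by
the passage from \<open>k\<close> to \<open>l\<close>, so that the index of the outer sum is the pair of both states.
\<close>

lemma Ht_decomposition:
  assumes A: "A \<inter> Eo = {}"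
    and int: "integrable (P i) (Ht_var X Eo (UNIV - Eo) A j x)"
    and int_k: "\<And>k l. k \<in> A \<Longrightarrow> l \<in> Eo \<Longrightarrow> integrable (P k) (H_var X Eo l x)"
    and int_l: "\<And>l. l \<in> Eo \<Longrightarrow> integrable (P l) (H_pm_var X (UNIV - Eo) j x)"
  shows "((\<lambda>p. (x * (trans_prob P X i (fst p) * H P X Eo (fst p) (snd p) x)) * H_pm P X (UNIV - Eo) (snd p) j x)
    has_sum Ht P X Eo (UNIV - Eo) A i j x) (A \<times> Eo)"
proof (rule renewal_has_sum[where good = "\<lambda>_. True" and S = UNIV and T = UNIV and K = UNIV and
    Q = "\<lambda>(p, s, t) u. (u 1 = fst p \<and> first_at Eo s (\<lambda>m. u (Suc m))) \<and> u (Suc s) = snd p \<and>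
      first_at (UNIV - Eo) (Suc t) (\<lambda>m. u (Suc s + m)) \<and> u (Suc s + t) = j" and
    g = "\<lambda>(p, s, t). Suc s + t" and W = "\<lambda>s. x ^ s" and v = "\<lambda>s. x * x ^ s" and w = "\<lambda>t. x ^ t" and
    E = "\<lambda>s u. u 1 \<in> A \<and> (returned Eo s u \<and> u (Suc s) \<notin> Eo) \<and> u s = j" and
    a = "\<lambda>p s. trans_prob P X i (fst p) * path_prob (fst p) (\<lambda>u. first_at Eo s u \<and> u s = snd p)" and
    b = "\<lambda>p t. path_prob (snd p) (\<lambda>u. first_at (UNIV - Eo) (Suc t) u \<and> u t = j)"])
  let ?Q = "\<lambda>(p, s, t) u. (u 1 = fst p \<and> first_at Eo s (\<lambda>m. u (Suc m))) \<and> u (Suc s) = snd p \<and>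
      first_at (UNIV - Eo) (Suc t) (\<lambda>m. u (Suc s + m)) \<and> u (Suc s + t) = j"
  have dep_1: "depends_upto (Suc s) (\<lambda>u. u 1 = k \<and> first_at Eo s (\<lambda>m. u (Suc m)))" for k s
  proof -
    have "depends_upto (Suc s) (\<lambda>u. u 1 = k \<and> first_at Eo s (\<lambda>m. u (1 + m)))"
      by (intro depends depends_shift[OF first_at_depends]) auto
    then show ?thesis by simp
  qed
  have dep_2: "depends_upto (Suc t) (\<lambda>u. first_at (UNIV - Eo) (Suc t) u \<and> u t = j)" for t
    by (intro depends first_at_depends) auto
  have dep_3: "depends_upto s (\<lambda>u. first_at Eo s u \<and> u s = l)" for l s
    by (intro depends first_at_depends) auto
  show "\<exists>n. depends_upto n (?Q p)" for p :: "('s \<times> 's) \<times> nat \<times> nat"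
  proof (cases p)
    case (fields q s t)
    have "depends_upto (Suc s + Suc t) (\<lambda>u. (u 1 = fst q \<and> first_at Eo s (\<lambda>m. u (Suc m))) \<and> u (Suc s) = snd q \<and>
        first_at (UNIV - Eo) (Suc t) (\<lambda>m. u (Suc s + m)) \<and> u (Suc s + t) = j)"
      by (intro depends_conj[OF depends_upto_mono[OF dep_1]] depends depends_shift[OF first_at_depends]) auto
    then show ?thesis unfolding fields by auto
  qed
  show "\<exists>n. depends_upto n (\<lambda>u. u 1 \<in> A \<and> (returned Eo s u \<and> u (Suc s) \<notin> Eo) \<and> u s = j)" for s
    by (rule Ht_dep)
  have Q_iff: "?Q (p, s, t) u \<longleftrightarrow> p = (u 1, u (Suc s)) \<and> first_at Eo (Suc s) u \<and>
      (\<forall>m. Suc s \<le> m \<and> m \<le> Suc s + t \<longrightarrow> u m \<in> Eo) \<and> u (Suc (Suc s + t)) \<notin> Eo \<and> u (Suc s + t) = j"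
    if "p \<in> A \<times> Eo" for p s t u
  proof (cases "p = (u 1, u (Suc s))")
    case True
    then have "u 1 \<notin> Eo" "u (Suc s) \<in> Eo" using that A by auto
    have "first_at (UNIV - Eo) (Suc t) (\<lambda>m. u (Suc s + m)) \<longleftrightarrow>
        u (Suc (Suc s + t)) \<notin> Eo \<and> (\<forall>m. 1 \<le> m \<and> m \<le> t \<longrightarrow> u (Suc s + m) \<in> Eo)"
      by (auto simp: first_at_def less_Suc_eq_le)
    also have "(\<forall>m. 1 \<le> m \<and> m \<le> t \<longrightarrow> u (Suc s + m) \<in> Eo) \<longleftrightarrow> (\<forall>m. Suc s \<le> m \<and> m \<le> Suc s + t \<longrightarrow> u m \<in> Eo)"
    proof (intro iffI allI impI)
      fix m assume *: "\<forall>m. 1 \<le> m \<and> m \<le> t \<longrightarrow> u (Suc s + m) \<in> Eo" "Suc s \<le> m \<and> m \<le> Suc s + t"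
      show "u m \<in> Eo"
      proof (cases "m = Suc s")
        case False
        then have "u (Suc s + (m - Suc s)) \<in> Eo" using * by (intro *(1)[rule_format]) auto
        with *(2) show ?thesis by simp
      qed (use \<open>u (Suc s) \<in> Eo\<close> in simp)
    qed auto
    finally show ?thesis
      using True first_at_Suc[of u Eo s] \<open>u 1 \<notin> Eo\<close> by auto
  qed auto
  show "(u 1 \<in> A \<and> (returned Eo n u \<and> u (Suc n) \<notin> Eo) \<and> u n = j) \<longleftrightarrow>
      (\<exists>p\<in>(A \<times> Eo) \<times> UNIV \<times> UNIV. (case p of (p, s, t) \<Rightarrow> Suc s + t) = n \<and> ?Q p u)" (is "?L \<longleftrightarrow> ?R") for n u
  proof
    assume L: ?L
    then obtain t where t: "t \<le> n" "first_at Eo t u" "\<forall>m. t \<le> m \<and> m \<le> n \<longrightarrow> u m \<in> Eo"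
      by (auto simp: returned_def)
    then obtain t' where t': "t = Suc t'" by (cases t) (auto simp: first_at_def)
    have "u t \<in> Eo" using t(2) by (rule first_at_in)
    with L t t' have "?Q ((u 1, u t), t', n - t) u"
      by (subst Q_iff) auto
    with L t t' \<open>u t \<in> Eo\<close> show ?R
      by (intro bexI[of _ "((u 1, u t), t', n - t)"]) auto
  next
    assume ?R
    then obtain p r t where p: "p \<in> A \<times> Eo" "Suc r + t = n" "?Q (p, r, t) u" by auto
    from p(3) show ?L
      unfolding Q_iff[OF p(1)] p(2) returned_def using p(1,2) by (auto intro!: exI[of _ "Suc r"])
  qed
  show "p = p'" if "p \<in> (A \<times> Eo) \<times> UNIV \<times> UNIV" "p' \<in> (A \<times> Eo) \<times> UNIV \<times> UNIV"
    "(case p of (p, s, t) \<Rightarrow> Suc s + t) = (case p' of (p, s, t) \<Rightarrow> Suc s + t)" "?Q p u" "?Q p' u" for p p' u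
  proof -
    obtain q s t q' s' t' where p: "p = (q, s, t)" "p' = (q', s', t')" by (cases p, cases p') auto
    have Q: "?Q (q, s, t) u" "?Q (q', s', t') u" and q: "q \<in> A \<times> Eo" "q' \<in> A \<times> Eo"
      using that p by auto
    note Q1 = Q_iff[OF q(1), THEN iffD1, OF Q(1)] and Q2 = Q_iff[OF q(2), THEN iffD1, OF Q(2)]
    have "Suc s = Suc s'"
      using Q1 Q2 first_at_unique[of Eo "Suc s" u "Suc s'"] by blast
    moreover have "Suc s + t = Suc s' + t'"
      using that(3) unfolding p by simp
    moreover have "q = (u 1, u (Suc s))" "q' = (u 1, u (Suc s'))"
      using Q1 Q2 by blast+
    ultimately show ?thesis unfolding p by simp
  qed
  show "path_prob i (?Q (p, s, t)) = trans_prob P X i (fst p) * path_prob (fst p) (\<lambda>u. first_at Eo s u \<and> u s = snd p) *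
      path_prob (snd p) (\<lambda>u. first_at (UNIV - Eo) (Suc t) u \<and> u t = j)" for p s t
    using markov[OF dep_1 dep_2, of i "fst p" s "snd p" t] first_step_markov[OF dep_3, of i "fst p" s "snd p"]
    by (simp add: conj_assoc)
  show "((\<lambda>s. trans_prob P X i (fst p) * path_prob (fst p) (\<lambda>u. first_at Eo s u \<and> u s = snd p) * (x * x ^ s))
      has_sum x * (trans_prob P X i (fst p) * H P X Eo (fst p) (snd p) x)) UNIV" if "p \<in> A \<times> Eo" for p
    using has_sum_cmult_right[OF H_has_sum[OF int_k, of "fst p" "snd p"], of "x * trans_prob P X i (fst p)"] that
    by (auto simp: ac_simps)
  show "((\<lambda>s. path_prob i (\<lambda>u. u 1 \<in> A \<and> (returned Eo s u \<and> u (Suc s) \<notin> Eo) \<and> u s = j) * x ^ s) has_sum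
      Ht P X Eo (UNIV - Eo) A i j x) UNIV"
    using int by (rule Ht_has_sum)
  show "((\<lambda>t. path_prob (snd p) (\<lambda>u. first_at (UNIV - Eo) (Suc t) u \<and> u t = j) * x ^ t) has_sum
      H_pm P X (UNIV - Eo) (snd p) j x) UNIV" if "p \<in> A \<times> Eo" for p
    by (rule H_pm_has_sum, rule int_l) (use that in auto)
qed (simp_all add: power_add)

text \<open>
Trajectories that visit \<open>B\<close> no later than \<open>n\<close> are cut at their first visit. Their total is
dominated by the series of all trajectories, which is the source of absolute convergence.
\<close>

lemma first_visit_decomposition:
  assumes sm: "G_first_term P X F A i x summable_on UNIV"
    and sm_j: "\<And>j. j \<in> B \<Longrightarrow> G_term P X F j x summable_on UNIV"
    and int: "\<And>j. j \<in> B \<Longrightarrow> integrable (P i) (H_first_var X A B j x)"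
  shows "((\<lambda>j. H_first P X A B i j x * G P X F j x) has_sum
    (\<Sum>\<^sub>\<infinity>n. path_prob i (\<lambda>u. u 1 \<in> A \<and> u n \<in> F \<and> (\<exists>s\<le>n. first_at B s u)) * x ^ n)) B"
proof (rule renewal_has_sum[where good = "\<lambda>_. True" and S = UNIV and T = UNIV and K = UNIV and
    Q = "\<lambda>(j, s, t) u. (u 1 \<in> A \<and> first_at B s u) \<and> u s = j \<and> u (s + t) \<in> F" and
    g = "\<lambda>(j, s, t). s + t" and W = "\<lambda>s. x ^ s" and v = "\<lambda>s. x ^ s" and w = "\<lambda>t. x ^ t" and
    E = "\<lambda>n u. u 1 \<in> A \<and> u n \<in> F \<and> (\<exists>s\<le>n. first_at B s u)" and
    a = "\<lambda>j s. path_prob i (\<lambda>u. (u 1 \<in> A \<and> first_at B s u) \<and> u s = j)" and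
    b = "\<lambda>j t. path_prob j (\<lambda>u. u t \<in> F)"])
  let ?Q = "\<lambda>(j, s, t) u. (u 1 \<in> A \<and> first_at B s u) \<and> u s = j \<and> u (s + t) \<in> F"
  have dep: "depends_upto s (\<lambda>u. u 1 \<in> A \<and> first_at B s u)" for s
  proof (cases s)
    case 0
    then show ?thesis by (simp add: first_at_def depends_const)
  next
    case (Suc r)
    then show ?thesis by (intro depends first_at_depends) auto
  qed
  have dep_F: "depends_upto t (\<lambda>u. u t \<in> F)" for t
    by (intro depends) auto
  have dep_E: "depends_upto (Suc n) (\<lambda>u. u 1 \<in> A \<and> u n \<in> F \<and> (\<exists>s. s \<le> n \<and> first_at B s u))" for n
    by (intro depends depends_upto_mono[OF first_at_depends]) auto
  then show "\<exists>m. depends_upto m (\<lambda>u. u 1 \<in> A \<and> u n \<in> F \<and> (\<exists>s\<le>n. first_at B s u))" for n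
    by auto
  show "\<exists>n. depends_upto n (?Q p)" for p :: "'s \<times> nat \<times> nat"
  proof (cases p)
    case (fields j s t)
    have "depends_upto (s + t) (\<lambda>u. (u 1 \<in> A \<and> first_at B s u) \<and> u s = j \<and> u (s + t) \<in> F)"
      by (intro depends_conj[OF depends_upto_mono[OF dep]] depends) auto
    then show ?thesis unfolding fields by auto
  qed
  show "(u 1 \<in> A \<and> u n \<in> F \<and> (\<exists>s\<le>n. first_at B s u)) \<longleftrightarrow>
      (\<exists>p\<in>B \<times> UNIV \<times> UNIV. (case p of (j, s, t) \<Rightarrow> s + t) = n \<and> ?Q p u)" (is "?L \<longleftrightarrow> ?R") for n u
  proof
    assume L: ?L
    then obtain s where s: "s \<le> n" "first_at B s u" by auto
    with L first_at_in[OF s(2)] show ?R by (intro bexI[of _ "(u s, s, n - s)"]) auto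
  next
    assume ?R
    then obtain s t where "u 1 \<in> A" "first_at B s u" "u (s + t) \<in> F" "s + t = n" by auto
    then show ?L by (auto intro!: exI[of _ s])
  qed
  show "p = p'" if "p \<in> B \<times> UNIV \<times> UNIV" "p' \<in> B \<times> UNIV \<times> UNIV"
    "(case p of (j, s, t) \<Rightarrow> s + t) = (case p' of (j, s, t) \<Rightarrow> s + t)" "?Q p u" "?Q p' u" for p p' u
  proof -
    obtain j s t j' s' t' where p: "p = (j, s, t)" "p' = (j', s', t')" by (cases p, cases p') auto
    have "s = s'" using that(4,5) unfolding p by (auto dest: first_at_unique)
    with that show ?thesis unfolding p by auto
  qed
  show "path_prob i (?Q (j, s, t)) = path_prob i (\<lambda>u. (u 1 \<in> A \<and> first_at B s u) \<and> u s = j) * path_prob j (\<lambda>u. u t \<in> F)" for j s t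
    using markov[OF dep dep_F, of i s j t] by simp
  have sm': "(\<lambda>n. path_prob i (\<lambda>u. u 1 \<in> A \<and> u n \<in> F) * x ^ n) summable_on UNIV"
    using sm by (simp add: G_first_term_def[abs_def] path_prob_def)
  have "(\<lambda>n. path_prob i (\<lambda>u. u 1 \<in> A \<and> u n \<in> F \<and> (\<exists>s\<le>n. first_at B s u)) * x ^ n) summable_on UNIV"
  proof (rule summable_on_weighted)
    show "(\<lambda>n. \<bar>path_prob i (\<lambda>u. u 1 \<in> A \<and> u n \<in> F) * x ^ n\<bar>) summable_on UNIV"
      using sm' by (simp only: abs_summable_iff)
    show "\<bar>path_prob i (\<lambda>u. u 1 \<in> A \<and> u n \<in> F \<and> (\<exists>s\<le>n. first_at B s u)) * x ^ n\<bar> \<le>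
        \<bar>path_prob i (\<lambda>u. u 1 \<in> A \<and> u n \<in> F) * x ^ n\<bar>" for n
    proof -
      have "path_prob i (\<lambda>u. u 1 \<in> A \<and> u n \<in> F \<and> (\<exists>s\<le>n. first_at B s u)) \<le> path_prob i (\<lambda>u. u 1 \<in> A \<and> u n \<in> F)"
        by (rule path_prob_mono[of "Suc n"]) (auto intro!: depends)
      then show ?thesis by (simp add: abs_mult mult_right_mono)
    qed
  qed
  then show "((\<lambda>n. path_prob i (\<lambda>u. u 1 \<in> A \<and> u n \<in> F \<and> (\<exists>s\<le>n. first_at B s u)) * x ^ n) has_sum
      (\<Sum>\<^sub>\<infinity>n. path_prob i (\<lambda>u. u 1 \<in> A \<and> u n \<in> F \<and> (\<exists>s\<le>n. first_at B s u)) * x ^ n)) UNIV"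
    by (rule has_sum_infsum)
  show "((\<lambda>s. path_prob i (\<lambda>u. (u 1 \<in> A \<and> first_at B s u) \<and> u s = j) * x ^ s) has_sum H_first P X A B i j x) UNIV"
    if "j \<in> B" for j
    using H_first_has_sum[OF int[OF that]] by (simp add: conj_assoc)
  show "((\<lambda>t. path_prob j (\<lambda>u. u t \<in> F) * x ^ t) has_sum G P X F j x) UNIV" if "j \<in> B" for j
    using has_sum_infsum[OF sm_j[OF that]] by (simp add: G_def G_term_def[abs_def] path_prob_def)
qed (simp_all add: power_add)

end

section \<open>Splitting by the side of the first excursion\<close>

abbreviation triangle :: "(nat \<times> nat) set" where
  "triangle \<equiv> {(m, n). m \<le> n}"

lemma has_sum_diagonal:
  assumes "\<And>m n. m < n \<Longrightarrow> f (m, n) = 0"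
  shows "(f has_sum S) triangle \<longleftrightarrow> ((\<lambda>n. f (n, n)) has_sum S) UNIV"
proof -
  have "(f has_sum S) triangle \<longleftrightarrow> (f has_sum S) (range (\<lambda>n. (n, n)))"
  proof (rule has_sum_cong_neutral)
    fix p assume "p \<in> triangle - range (\<lambda>n. (n, n))"
    then obtain m n where p: "p = (m, n)" "m \<le> n" "m \<noteq> n" by auto
    then show "f p = 0" using assms[of m n] by simp
  qed auto
  also have "\<dots> \<longleftrightarrow> ((\<lambda>n. f (n, n)) has_sum S) UNIV"
    by (subst has_sum_reindex) (auto simp: inj_on_def o_def)
  finally show ?thesis .
qed

context homogeneous_markov_chain
begin

text \<open>
The part of the series of $\tilde K_i$ that belongs to trajectories whose first step leads into
\<open>C\<close>; sojourn times are those of the side \<open>A\<close>. For \<open>C = E\<^sup>\<plusminus>\<close> this is the full series.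
\<close>

definition half_term :: "'s set \<Rightarrow> 's set \<Rightarrow> 's set \<Rightarrow> 's set \<Rightarrow> 's \<Rightarrow> real \<Rightarrow> real \<Rightarrow> nat \<times> nat \<Rightarrow> real" where
  "half_term Eo A C F i x y = (\<lambda>(m, n).
     path_prob i (\<lambda>u. u 1 \<in> C \<and> path_sojourn Eo A n u = m \<and> u n \<in> F) * x ^ m * y ^ (n - m))"

lemma half_dep: "depends_upto (Suc n) (\<lambda>u. u 1 \<in> C \<and> path_sojourn Eo A n u = m \<and> u n \<in> F)"
  by (intro depends depends_upto_mono[OF path_sojourn_depends]) auto

lemma Kt_term_eq: "Kt_term P X Eo A C F i x y = half_term Eo A C F i x y"
  unfolding Kt_term_def half_term_def path_prob_def sojourn_path[of X] by simp

lemma Kt_eq: "(half_term Eo A C F i x y has_sum S) triangle \<Longrightarrow> Kt P X Eo A C F i x y = S"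
  unfolding Kt_def Kt_term_eq by (auto dest: infsumI simp: case_prod_eta)

lemma path_prob_split:
  assumes "depends_upto n \<phi>" "depends_upto n \<psi>"
  shows "path_prob i \<phi> = path_prob i (\<lambda>u. \<phi> u \<and> \<psi> u) + path_prob i (\<lambda>u. \<phi> u \<and> \<not> \<psi> u)"
proof -
  have "((\<lambda>b. path_prob i (\<lambda>u. \<phi> u \<and> \<psi> u = b)) has_sum path_prob i \<phi>) UNIV"
  proof (rule path_prob_has_sum[where n = n])
    show "depends_upto n (\<lambda>u. \<phi> u \<and> \<psi> u = b)" for b
      by (cases b) (simp_all add: depends_conj depends_not assms)
  qed (use assms(1) in auto)
  then show ?thesis
    by (simp add: has_sum_finite_iff UNIV_bool add.commute)
qed

text \<open>
For \<open>y = 0\<close> only the terms with \<open>m = n\<close> survive, and these do not depend on \<open>y\<close>.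
\<close>

lemma half_term_weight_zero:
  assumes "(half_term Eo A C F i x y) summable_on triangle"
  shows "(half_term Eo A C F i x 0) summable_on triangle"
proof (rule summable_on_weighted)
  show "(\<lambda>p. \<bar>half_term Eo A C F i x y p\<bar>) summable_on triangle"
    using assms by (simp only: abs_summable_iff)
  show "\<bar>half_term Eo A C F i x 0 p\<bar> \<le> \<bar>half_term Eo A C F i x y p\<bar>" for p
    by (cases p, cases "snd p - fst p") (auto simp: half_term_def)
qed

lemma half_term_summable:
  assumes "\<bar>x\<bar> < 1" "\<bar>y\<bar> < 1"
  shows "half_term Eo A C F i x y summable_on triangle"
proof (rule summable_on_weighted)
  have "(\<lambda>(m, n). \<bar>x\<bar> ^ m * \<bar>y\<bar> ^ n) summable_on UNIV \<times> (UNIV :: nat set)"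
    using has_sum_product[OF has_sum_infsum[OF geometric_summable[OF assms(1)]]
      has_sum_infsum[OF geometric_summable[OF assms(2)]]]
    by (rule has_sum_imp_summable)
  also have "?this \<longleftrightarrow> (\<lambda>(m, n). \<bar>x\<bar> ^ m * \<bar>y\<bar> ^ (n - m)) summable_on triangle"
    by (rule summable_on_reindex_bij_witness[where i = "\<lambda>(m, n). (m, n - m)" and j = "\<lambda>(m, n). (m, m + n)"]) auto
  also have "(\<lambda>(m, n). \<bar>x\<bar> ^ m * \<bar>y\<bar> ^ (n - m)) = (\<lambda>p. \<bar>case p of (m, n) \<Rightarrow> x ^ m * y ^ (n - m)\<bar>)"
    by (auto simp: abs_mult power_abs)
  finally show "(\<lambda>p. \<bar>case p of (m, n) \<Rightarrow> x ^ m * y ^ (n - m)\<bar>) summable_on triangle" .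
  show "\<bar>half_term Eo A C F i x y p\<bar> \<le> \<bar>case p of (m, n) \<Rightarrow> x ^ m * y ^ (n - m)\<bar>" for p
  proof (cases p)
    case (Pair m n)
    have "\<bar>path_prob i \<phi> * z\<bar> \<le> \<bar>z\<bar>" for \<phi> z
      unfolding abs_mult by (rule mult_left_le_one_le) simp_all
    then show ?thesis unfolding Pair half_term_def prod.case mult.assoc .
  qed
qed

end

text \<open>
The setting is symmetric in the two sides, so each statement below is also available with \<open>A\<close> and
\<open>B\<close> exchanged.
\<close>

locale separated_excursions = homogeneous_markov_chain P X
  for P :: "'s :: countable \<Rightarrow> 'w measure" and X +
  fixes Eo A B :: "'s set"
  assumes disjoint: "A \<inter> B = {}" and cover: "A \<union> B = UNIV - Eo"
    and no_AB: "\<And>k l. k \<in> A \<Longrightarrow> l \<in> B \<Longrightarrow> trans_prob P X k l = 0"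
    and no_BA: "\<And>k l. k \<in> B \<Longrightarrow> l \<in> A \<Longrightarrow> trans_prob P X k l = 0"
begin

lemma swapped: "separated_excursions P X Eo B A"
  by unfold_locales (use disjoint cover no_AB no_BA in auto)

lemma AE_no_direct: "AE \<omega> in P i. no_direct A B (\<lambda>m. X m \<omega>)"
  unfolding no_direct_def by (rule AE_no_transition[OF no_AB])

lemma A_Eo: "A \<inter> Eo = {}" and B_Eo: "B \<inter> Eo = {}"
  using cover by auto

text \<open>
Times that do not count for one side count for the other, so exchanging the sides amounts to
exchanging the variables.
\<close>

lemma half_term_swap:
  assumes "C \<inter> Eo = {}"
  shows "(half_term Eo A C F i x y has_sum S) triangle \<longleftrightarrow> (half_term Eo B C F i y x has_sum S) triangle"
proof (rule has_sum_reindex_bij_witness[where i = "\<lambda>(m, n). (n - m, n)" and j = "\<lambda>(m, n). (n - m, n)"])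
  fix p assume "p \<in> triangle"
  then obtain m n where p: "p = (m, n)" "m \<le> n" by auto
  have "path_sojourn Eo B n u = n - m \<longleftrightarrow> path_sojourn Eo A n u = m" if "u 1 \<in> C" for u
  proof -
    have "path_sojourn Eo A n u + path_sojourn Eo B n u = n"
      by (rule path_sojourn_complement) (use that assms disjoint cover in auto)
    with p(2) show ?thesis by linarith
  qed
  then have "path_prob i (\<lambda>u. u 1 \<in> C \<and> path_sojourn Eo B n u = n - m \<and> u n \<in> F) =
      path_prob i (\<lambda>u. u 1 \<in> C \<and> path_sojourn Eo A n u = m \<and> u n \<in> F)"
    by (intro arg_cong[where f = "path_prob i"] ext) auto
  then show "half_term Eo B C F i y x (case p of (m, n) \<Rightarrow> (n - m, n)) = half_term Eo A C F i x y p"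
    using p by (simp add: half_term_def ac_simps)
qed auto

lemma half_term_split:
  "half_term Eo A (UNIV - Eo) F i x y p = half_term Eo A A F i x y p + half_term Eo A B F i x y p"
proof (cases p)
  case (Pair m n)
  let ?\<phi> = "\<lambda>u. u 1 \<in> UNIV - Eo \<and> path_sojourn Eo A n u = m \<and> u n \<in> F"
  have "path_prob i ?\<phi> = path_prob i (\<lambda>u. ?\<phi> u \<and> u 1 \<in> A) + path_prob i (\<lambda>u. ?\<phi> u \<and> u 1 \<notin> A)"
    by (rule path_prob_split[where n = "Suc n"]) (rule half_dep, intro depends, auto)
  also have "(\<lambda>u. ?\<phi> u \<and> u 1 \<in> A) = (\<lambda>u. u 1 \<in> A \<and> path_sojourn Eo A n u = m \<and> u n \<in> F)"
    using A_Eo by auto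
  also have "(\<lambda>u. ?\<phi> u \<and> u 1 \<notin> A) = (\<lambda>u. u 1 \<in> B \<and> path_sojourn Eo A n u = m \<and> u n \<in> F)"
  proof -
    have "v \<in> B \<longleftrightarrow> v \<in> UNIV - Eo \<and> v \<notin> A" for v
      using disjoint cover by blast
    then show ?thesis by auto
  qed
  finally show ?thesis
    unfolding Pair by (simp add: half_term_def distrib_right)
qed

lemma half_term_le:
  assumes "C \<subseteq> UNIV - Eo"
  shows "\<bar>half_term Eo A C F i x y p\<bar> \<le> \<bar>half_term Eo A (UNIV - Eo) F i x y p\<bar>"
proof (cases p)
  case (Pair m n)
  have "path_prob i (\<lambda>u. u 1 \<in> C \<and> path_sojourn Eo A n u = m \<and> u n \<in> F) \<le>
      path_prob i (\<lambda>u. u 1 \<in> UNIV - Eo \<and> path_sojourn Eo A n u = m \<and> u n \<in> F)"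
    by (rule path_prob_mono[OF half_dep]) (use assms in auto)
  then show ?thesis
    unfolding Pair half_term_def by (simp add: abs_mult mult_right_mono)
qed

lemma half_summable:
  assumes "C \<subseteq> UNIV - Eo" "half_term Eo A (UNIV - Eo) F i x y summable_on triangle"
  shows "half_term Eo A C F i x y summable_on triangle"
  by (rule summable_on_weighted[OF _ half_term_le[OF assms(1)]]) (use assms(2) in \<open>simp only: abs_summable_iff\<close>)

text \<open>
The first excursion and the stay in \<open>Eo\<close> after it are over by time \<open>n\<close>, that is,
$\tilde\tau^\pm - 1 \le n$. Deciding this requires the state at time \<open>n + 1\<close>.
\<close>

definition completed :: "nat \<Rightarrow> (nat \<Rightarrow> 's) \<Rightarrow> bool" where
  "completed n u \<longleftrightarrow> (\<exists>s\<le>n. returned Eo s u \<and> u (Suc s) \<notin> Eo)"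

lemma completed_dep: "depends_upto (Suc n) (completed n)"
proof -
  have "depends_upto (Suc n) (\<lambda>u. \<exists>s. s \<le> n \<and> (returned Eo s u \<and> u (Suc s) \<notin> Eo))"
    by (intro depends depends_upto_mono[OF returned_depends]) auto
  then show ?thesis unfolding completed_def[abs_def] .
qed

lemma not_completed_sojourn:
  assumes "no_direct A B u" "u 1 \<in> A" "\<not> completed n u"
  shows "path_sojourn Eo A n u = n"
proof -
  have "u s \<notin> B" if "1 \<le> s" "s \<le> n" for s
    using visit_completes_return[of A B u Eo s] that assms disjoint cover
    unfolding completed_def by (meson less_imp_le order_trans)
  then show ?thesis
    using path_sojourn_full_iff[of u Eo A B n] assms(2) A_Eo disjoint cover by auto
qed

lemma completed_sojourn:
  assumes "no_direct A B u" "u 1 \<in> A" "returned Eo s u" "u (Suc s) \<notin> Eo"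
  shows "path_sojourn Eo A (s + n) u = s + path_sojourn Eo A n (\<lambda>m. u (s + m))"
proof -
  have "u m \<notin> B" if "1 \<le> m" "m \<le> s" for m
    using returned_avoids[of A B u Eo s m] that assms disjoint cover by auto
  then have "path_sojourn Eo A s u = s"
    using path_sojourn_full_iff[of u Eo A B s] assms(2) A_Eo disjoint cover by auto
  then show ?thesis
    using path_sojourn_shift[of u s Eo A n] assms(4) A_Eo by simp
qed

text \<open>
The contribution of the times before $\tilde\tau^\pm - 1$. All these times are counted, which is
why it is a power series in \<open>x\<close> alone.
\<close>

definition stay_sum :: "'s set \<Rightarrow> 's \<Rightarrow> real \<Rightarrow> real" where
  "stay_sum F i x = (\<Sum>\<^sub>\<infinity>n. path_prob i (\<lambda>u. u 1 \<in> A \<and> u n \<in> F \<and> \<not> completed n u) * x ^ n)"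

text \<open>
The cut is at \<open>s\<close> $= \tilde\tau^\pm - 1$. The event before the cut already contains the step out of
\<open>Eo\<close> after time \<open>s\<close>, hence it has an additional factor $P_j\{X_1 \in E^\pm\}$, which the future
part has to be divided by. If this factor is 0, then both sides vanish.
\<close>

lemma completed_has_sum:
  assumes total: "((\<lambda>(m, n). path_prob i (\<lambda>u. (u 1 \<in> A \<and> path_sojourn Eo A n u = m \<and> u n \<in> F) \<and> completed n u)
      * (x ^ m * y ^ (n - m))) has_sum z) triangle"
    and int: "\<And>j. j \<in> Eo \<Longrightarrow> integrable (P i) (Ht_var X Eo (UNIV - Eo) A j x)"
    and smj: "\<And>j. j \<in> Eo \<Longrightarrow> half_term Eo A (UNIV - Eo) F j x y summable_on triangle"
  shows "((\<lambda>j. Ht P X Eo (UNIV - Eo) A i j x * Kt_cond P X Eo A (UNIV - Eo) F j x y) has_sum z) Eo"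
proof (rule renewal_has_sum[where good = "no_direct A B" and S = UNIV and T = triangle and K = triangle and
    Q = "\<lambda>(j, s, (m, n)) u. (u 1 \<in> A \<and> returned Eo s u) \<and> u s = j \<and>
      (u (s + 1) \<in> UNIV - Eo \<and> path_sojourn Eo A n (\<lambda>m. u (s + m)) = m \<and> u (s + n) \<in> F)" and
    g = "\<lambda>(j, s, (m, n)). (s + m, s + n)" and W = "\<lambda>(m, n). x ^ m * y ^ (n - m)" and
    v = "\<lambda>s. x ^ s" and w = "\<lambda>(m, n). x ^ m * y ^ (n - m)" and
    E = "\<lambda>(m, n) u. (u 1 \<in> A \<and> path_sojourn Eo A n u = m \<and> u n \<in> F) \<and> completed n u" and
    a = "\<lambda>j s. path_prob i (\<lambda>u. u 1 \<in> A \<and> (returned Eo s u \<and> u (Suc s) \<notin> Eo) \<and> u s = j)" and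
    b = "\<lambda>j (m, n). path_prob j (\<lambda>u. u 1 \<in> UNIV - Eo \<and> path_sojourn Eo A n u = m \<and> u n \<in> F) /
      path_prob j (\<lambda>u. u 1 \<in> UNIV - Eo)"])
  let ?Q = "\<lambda>(j, s, (m, n)) u. (u 1 \<in> A \<and> returned Eo s u) \<and> u s = j \<and>
      (u (s + 1) \<in> UNIV - Eo \<and> path_sojourn Eo A n (\<lambda>m. u (s + m)) = m \<and> u (s + n) \<in> F)"
  have dep_A: "depends_upto s (\<lambda>u. u 1 \<in> A \<and> returned Eo s u)" for s
  proof (cases s)
    case 0
    then show ?thesis by (simp add: returned_def first_at_def depends_const)
  next
    case (Suc r)
    then show ?thesis by (intro depends returned_depends) auto
  qed
  have dep_1: "depends_upto 1 (\<lambda>u. u 1 \<in> UNIV - Eo)"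
    by (intro depends) auto
  show "\<exists>n. depends_upto n (?Q p)" for p :: "'s \<times> nat \<times> (nat \<times> nat)"
  proof (cases p)
    case (fields j s m n)
    have "depends_upto (s + Suc n) (\<lambda>u. (u 1 \<in> A \<and> returned Eo s u) \<and> u s = j \<and>
        (u (s + 1) \<in> UNIV - Eo \<and> path_sojourn Eo A n (\<lambda>m. u (s + m)) = m \<and> u (s + n) \<in> F))"
      by (intro depends_conj[OF depends_upto_mono[OF dep_A]] depends_conj[OF depends_coord]
        depends_shift[OF half_dep]) auto
    then show ?thesis unfolding fields by auto
  qed
  show "\<exists>n. depends_upto n (case k of (m, n) \<Rightarrow> \<lambda>u. (u 1 \<in> A \<and> path_sojourn Eo A n u = m \<and> u n \<in> F) \<and> completed n u)" for k
  proof (cases k)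
    case (Pair m n)
    show ?thesis unfolding Pair prod.case
      by (rule exI) (rule depends_conj[OF half_dep completed_dep])
  qed
  show "AE \<omega> in P i. no_direct A B (\<lambda>m. X m \<omega>)" by (rule AE_no_direct)
  show "(case k of (m, n) \<Rightarrow> \<lambda>u. (u 1 \<in> A \<and> path_sojourn Eo A n u = m \<and> u n \<in> F) \<and> completed n u) u \<longleftrightarrow>
      (\<exists>p\<in>Eo \<times> UNIV \<times> triangle. (case p of (j, s, (m, n)) \<Rightarrow> (s + m, s + n)) = k \<and> ?Q p u)" (is "?L \<longleftrightarrow> ?R")
    if "k \<in> triangle" "no_direct A B u" for k u
  proof -
    obtain m n where k: "k = (m, n)" "m \<le> n" using \<open>k \<in> triangle\<close> by auto
    show ?thesis
    proof
      assume ?L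
      then have L: "u 1 \<in> A" "path_sojourn Eo A n u = m" "u n \<in> F" "completed n u" unfolding k by auto
      then obtain s where s: "s \<le> n" "returned Eo s u" "u (Suc s) \<notin> Eo" unfolding completed_def by blast
      have m: "m = s + path_sojourn Eo A (n - s) (\<lambda>m. u (s + m))"
        using completed_sojourn[OF that(2) L(1) s(2,3), of "n - s"] L(2) s(1) by simp
      have "u s \<in> Eo" using s(2) unfolding returned_def by auto
      then show ?R
        using L s m k sojourn_le[of "\<lambda>m u. u m" Eo A "n - s" "\<lambda>m. u (s + m)"]
        by (intro bexI[of _ "(u s, s, (m - s, n - s))"]) auto
    next
      assume ?R
      then obtain j s m' n' where p: "(j, s, (m', n')) \<in> Eo \<times> UNIV \<times> triangle" "s + m' = m" "s + n' = n"
          "?Q (j, s, (m', n')) u"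
        unfolding k by auto
      have "path_sojourn Eo A (s + n') u = s + path_sojourn Eo A n' (\<lambda>m. u (s + m))"
        by (rule completed_sojourn[OF that(2)]) (use p(4) in auto)
      moreover have "completed n u"
        unfolding completed_def by (rule exI[of _ s]) (use p in auto)
      ultimately show ?L unfolding k using p by auto
    qed
  qed
  show "p = p'" if "p \<in> Eo \<times> UNIV \<times> triangle" "p' \<in> Eo \<times> UNIV \<times> triangle"
    "(case p of (j, s, (m, n)) \<Rightarrow> (s + m, s + n)) = (case p' of (j, s, (m, n)) \<Rightarrow> (s + m, s + n))" "?Q p u" "?Q p' u"
    for p p' u
  proof -
    obtain j s m n j' s' m' n' where p: "p = (j, s, (m, n))" "p' = (j', s', (m', n'))"
      by (cases p, cases p') auto
    have "s = s'"
      by (rule returned_unique[of Eo s u s']) (use that(4,5) p in auto)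
    with that show ?thesis unfolding p by auto
  qed
  show "path_prob i (?Q (j, s, q)) = path_prob i (\<lambda>u. u 1 \<in> A \<and> (returned Eo s u \<and> u (Suc s) \<notin> Eo) \<and> u s = j) *
      (case q of (m, n) \<Rightarrow> path_prob j (\<lambda>u. u 1 \<in> UNIV - Eo \<and> path_sojourn Eo A n u = m \<and> u n \<in> F) /
        path_prob j (\<lambda>u. u 1 \<in> UNIV - Eo))" for j s q
  proof (cases q)
    case (Pair m n)
    let ?a = "path_prob i (\<lambda>u. (u 1 \<in> A \<and> returned Eo s u) \<and> u s = j)"
    let ?b = "path_prob j (\<lambda>u. u 1 \<in> UNIV - Eo \<and> path_sojourn Eo A n u = m \<and> u n \<in> F)"
    let ?q = "path_prob j (\<lambda>u. u 1 \<in> UNIV - Eo)"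
    have 1: "path_prob i (\<lambda>u. (u 1 \<in> A \<and> returned Eo s u) \<and> u s = j \<and> u (s + 1) \<in> UNIV - Eo) = ?a * ?q"
      by (rule markov[OF dep_A dep_1])
    have 2: "path_prob i (?Q (j, s, q)) = ?a * ?b"
      unfolding Pair prod.case by (rule markov[OF dep_A half_dep])
    have 3: "?b \<le> ?q"
      by (rule path_prob_mono[OF dep_1]) simp
    \<comment> \<open>The event of the first factor is a cut at \<open>s\<close> with the future event \<open>u 1 \<notin> Eo\<close>.\<close>
    have 4: "(\<lambda>u. u 1 \<in> A \<and> (returned Eo s u \<and> u (Suc s) \<notin> Eo) \<and> u s = j) =
        (\<lambda>u. (u 1 \<in> A \<and> returned Eo s u) \<and> u s = j \<and> u (s + 1) \<in> UNIV - Eo)"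
      by auto
    have "?a * ?b = ?a * ?q * (?b / ?q)"
    proof (cases "?q = 0")
      case True
      then have "?b = 0" using 3 path_prob_nonneg[of j] by (intro order_antisym) auto
      then show ?thesis by simp
    qed simp
    then show ?thesis unfolding 4 1 Pair prod.case 2[unfolded Pair prod.case] .
  qed
  show "((\<lambda>q. (case q of (m, n) \<Rightarrow> path_prob j (\<lambda>u. u 1 \<in> UNIV - Eo \<and> path_sojourn Eo A n u = m \<and> u n \<in> F) /
        path_prob j (\<lambda>u. u 1 \<in> UNIV - Eo)) * (case q of (m, n) \<Rightarrow> x ^ m * y ^ (n - m)))
      has_sum Kt_cond P X Eo A (UNIV - Eo) F j x y) triangle" if "j \<in> Eo" for j
  proof -
    have "Kt P X Eo A (UNIV - Eo) F j x y = infsum (half_term Eo A (UNIV - Eo) F j x y) triangle"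
      by (rule Kt_eq) (rule has_sum_infsum[OF smj[OF that]])
    then have "((\<lambda>p. half_term Eo A (UNIV - Eo) F j x y p * inverse (path_prob j (\<lambda>u. u 1 \<in> UNIV - Eo)))
        has_sum Kt_cond P X Eo A (UNIV - Eo) F j x y) triangle"
      using has_sum_cmult_left[OF has_sum_infsum[OF smj[OF that]], of "inverse (path_prob j (\<lambda>u. u 1 \<in> UNIV - Eo))"]
      by (simp add: Kt_cond_def first_prob_def path_prob_def divide_inverse)
    then show ?thesis
      by (rule has_sum_cong[THEN iffD1, rotated]) (auto simp: half_term_def divide_inverse)
  qed
  show "((\<lambda>s. path_prob i (\<lambda>u. u 1 \<in> A \<and> (returned Eo s u \<and> u (Suc s) \<notin> Eo) \<and> u s = j) * x ^ s) has_sum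
    Ht P X Eo (UNIV - Eo) A i j x) UNIV" if "j \<in> Eo" for j
    by (rule Ht_has_sum[OF int[OF that]])
  show "((\<lambda>k. path_prob i (case k of (m, n) \<Rightarrow> \<lambda>u. (u 1 \<in> A \<and> path_sojourn Eo A n u = m \<and> u n \<in> F) \<and> completed n u)
      * (case k of (m, n) \<Rightarrow> x ^ m * y ^ (n - m))) has_sum z) triangle"
    using total by (rule has_sum_cong[THEN iffD1, rotated]) auto
qed (auto simp: power_add)

text \<open>
Splitting off the times before $\tilde\tau^\pm - 1$ leaves the series to which
\<open>completed_has_sum\<close> applies. What is split off is concentrated on the diagonal \<open>m = n\<close> and
therefore independent of \<open>y\<close>.
\<close>

lemma half_decomposition:
  assumes sm: "half_term Eo A A F i x y summable_on triangle"
    and int: "\<And>j. j \<in> Eo \<Longrightarrow> integrable (P i) (Ht_var X Eo (UNIV - Eo) A j x)"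
    and smj: "\<And>j. j \<in> Eo \<Longrightarrow> half_term Eo A (UNIV - Eo) F j x y summable_on triangle"
  obtains z where
    "((\<lambda>j. Ht P X Eo (UNIV - Eo) A i j x * Kt_cond P X Eo A (UNIV - Eo) F j x y) has_sum z) Eo"
    "(half_term Eo A A F i x y has_sum stay_sum F i x + z) triangle"
proof -
  let ?\<phi> = "\<lambda>m n u. u 1 \<in> A \<and> path_sojourn Eo A n u = m \<and> u n \<in> F"
  let ?c = "\<lambda>(m, n). path_prob i (\<lambda>u. ?\<phi> m n u \<and> completed n u) * (x ^ m * y ^ (n - m))"
  let ?d = "\<lambda>(m, n). path_prob i (\<lambda>u. ?\<phi> m n u \<and> \<not> completed n u) * (x ^ m * y ^ (n - m))"
  have half: "half_term Eo A A F i x y p = ?c p + ?d p" for p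
  proof (cases p)
    case (Pair m n)
    show ?thesis
      unfolding Pair half_term_def prod.case mult.assoc
      by (subst path_prob_split[OF half_dep completed_dep]) (simp add: distrib_right)
  qed
  have sm_c: "?c summable_on triangle"
  proof (rule summable_on_weighted)
    show "(\<lambda>p. \<bar>half_term Eo A A F i x y p\<bar>) summable_on triangle"
      using sm by (simp only: abs_summable_iff)
    show "\<bar>?c p\<bar> \<le> \<bar>half_term Eo A A F i x y p\<bar>" for p
    proof (cases p)
      case (Pair m n)
      have "path_prob i (\<lambda>u. ?\<phi> m n u \<and> completed n u) \<le> path_prob i (?\<phi> m n)"
        by (rule path_prob_mono[OF half_dep]) simp
      then show ?thesis
        unfolding Pair half_term_def prod.case mult.assoc
        by (simp add: abs_mult mult_right_mono)
    qed
  qed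
  define z where "z = infsum ?c triangle"
  have c: "(?c has_sum z) triangle"
    unfolding z_def by (rule has_sum_infsum[OF sm_c])
  have diff: "((\<lambda>p. half_term Eo A A F i x y p + - 1 * ?c p) has_sum
      infsum (half_term Eo A A F i x y) triangle + - 1 * z) triangle"
    by (intro has_sum_add has_sum_cmult_right c has_sum_infsum sm)
  have d: "(?d has_sum infsum (half_term Eo A A F i x y) triangle - z) triangle"
    using diff by (simp add: half)
  have off_diagonal: "path_prob i (\<lambda>u. ?\<phi> m n u \<and> \<not> completed n u) = 0" if "m < n" for m n
  proof -
    have "path_prob i (\<lambda>u. ?\<phi> m n u \<and> \<not> completed n u) = path_prob i (\<lambda>u. False)"
    proof (rule path_prob_cong_AE[OF depends_conj[OF half_dep depends_not[OF completed_dep]] depends_const])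
      show "AE \<omega> in P i. (?\<phi> m n (\<lambda>m. X m \<omega>) \<and> \<not> completed n (\<lambda>m. X m \<omega>)) \<longleftrightarrow> False"
        using AE_no_direct[of i]
      proof eventually_elim
        case (elim \<omega>)
        from not_completed_sojourn[OF elim, of n] \<open>m < n\<close> show ?case by (metis less_irrefl)
      qed
    qed
    then show ?thesis by simp
  qed
  have diagonal: "path_prob i (\<lambda>u. ?\<phi> n n u \<and> \<not> completed n u) =
      path_prob i (\<lambda>u. u 1 \<in> A \<and> u n \<in> F \<and> \<not> completed n u)" for n
  proof (rule path_prob_cong_AE[OF depends_conj[OF half_dep depends_not[OF completed_dep]]])
    show "depends_upto (Suc n) (\<lambda>u. u 1 \<in> A \<and> u n \<in> F \<and> \<not> completed n u)"
      by (intro depends_conj[OF depends_coord] depends_conj[OF depends_coord] depends_not completed_dep) auto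
    show "AE \<omega> in P i. (?\<phi> n n (\<lambda>m. X m \<omega>) \<and> \<not> completed n (\<lambda>m. X m \<omega>)) \<longleftrightarrow>
        (X 1 \<omega> \<in> A \<and> X n \<omega> \<in> F \<and> \<not> completed n (\<lambda>m. X m \<omega>))"
      using AE_no_direct[of i]
    proof eventually_elim
      case (elim \<omega>)
      from not_completed_sojourn[OF elim, of n] show ?case by auto
    qed
  qed
  have "((\<lambda>n. ?d (n, n)) has_sum infsum (half_term Eo A A F i x y) triangle - z) UNIV"
    using d by (subst (asm) has_sum_diagonal) (simp_all only: prod.case off_diagonal mult_zero_left)
  then have "((\<lambda>n. path_prob i (\<lambda>u. u 1 \<in> A \<and> u n \<in> F \<and> \<not> completed n u) * x ^ n) has_sum
      infsum (half_term Eo A A F i x y) triangle - z) UNIV"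
    unfolding prod.case diagonal by simp
  then have "stay_sum F i x = infsum (half_term Eo A A F i x y) triangle - z"
    unfolding stay_sum_def by (rule infsumI)
  then have "(half_term Eo A A F i x y has_sum stay_sum F i x + z) triangle"
    using has_sum_infsum[OF sm] by simp
  with completed_has_sum[OF c int smj] show ?thesis
    by (rule that)
qed

text \<open>
If the first step leads into \<open>B\<close>, then time 1 is not counted for \<open>A\<close>, so the sojourn time is
equal to \<open>n\<close> only for \<open>n = 0\<close>.
\<close>

lemma half_other_boundary:
  "(half_term Eo A B F i x 0 has_sum indicator F i * first_prob P X B i) triangle"
proof -
  have diag: "half_term Eo A B F i x 0 (n, n) = (if n = 0 then indicator F i * first_prob P X B i else 0)" for n
  proof (cases "n = 0")
    case True
    have "path_prob i (\<lambda>u. u 1 \<in> B \<and> path_sojourn Eo A 0 u = 0 \<and> u 0 \<in> F) = path_prob i (\<lambda>u. u 1 \<in> B \<and> i \<in> F)"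
    proof (rule path_prob_cong_AE[OF half_dep])
      show "depends_upto (Suc 0) (\<lambda>u. u 1 \<in> B \<and> i \<in> F)"
        by (intro depends) auto
      show "AE \<omega> in P i. (X 1 \<omega> \<in> B \<and> path_sojourn Eo A 0 (\<lambda>m. X m \<omega>) = 0 \<and> X 0 \<omega> \<in> F) \<longleftrightarrow> (X 1 \<omega> \<in> B \<and> i \<in> F)"
        using AE_initial[of i] by eventually_elim (simp add: sojourn_def)
    qed
    also have "\<dots> = indicator F i * first_prob P X B i"
      by (cases "i \<in> F") (simp_all add: first_prob_def path_prob_def)
    finally show ?thesis using True by (simp add: half_term_def)
  next
    case False
    have "u 1 \<notin> B" if "path_sojourn Eo A n u = n" "u 1 \<in> B" for u
      using path_sojourn_full_iff[of u Eo A B n] that B_Eo disjoint cover False by auto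
    then have "(\<lambda>u. u 1 \<in> B \<and> path_sojourn Eo A n u = n \<and> u n \<in> F) = (\<lambda>u. False)"
      by auto
    with False show ?thesis by (simp add: half_term_def)
  qed
  have "((\<lambda>n. half_term Eo A B F i x 0 (n, n)) has_sum indicator F i * first_prob P X B i) {0}"
    by (simp add: diag has_sum_finite_iff)
  then have "((\<lambda>n. half_term Eo A B F i x 0 (n, n)) has_sum indicator F i * first_prob P X B i) UNIV"
    by (rule has_sum_cong_neutral[THEN iffD1, rotated 3]) (auto simp: diag)
  then show ?thesis
    by (subst has_sum_diagonal) (auto simp: half_term_def)
qed

text \<open>
After a first step into \<open>A\<close>, all times up to \<open>n\<close> are counted if and only if \<open>B\<close> has not been
visited by time \<open>n\<close>.
\<close>

lemma half_boundary:
  assumes sm: "G_first_term P X F A i x summable_on UNIV"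
    and sm_j: "\<And>j. j \<in> B \<Longrightarrow> G_term P X F j x summable_on UNIV"
    and int: "\<And>j. j \<in> B \<Longrightarrow> integrable (P i) (H_first_var X A B j x)"
  shows "(half_term Eo A A F i x 0 has_sum
    G_first P X F A i x - (\<Sum>\<^sub>\<infinity>j\<in>B. H_first P X A B i j x * G P X F j x)) triangle"
proof -
  let ?\<phi> = "\<lambda>n u. u 1 \<in> A \<and> u n \<in> F"
  let ?h = "\<lambda>n u. \<exists>s\<le>n. first_at B s u"
  have dep: "depends_upto (Suc n) (?\<phi> n)" for n
    by (intro depends) auto
  have dep_h: "depends_upto (Suc n) (?h n)" for n
    by (intro depends depends_upto_mono[OF first_at_depends]) auto
  have g: "((\<lambda>n. path_prob i (?\<phi> n) * x ^ n) has_sum G_first P X F A i x) UNIV"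
    using has_sum_infsum[OF sm] by (simp add: G_first_def G_first_term_def[abs_def] path_prob_def)
  have sm_h: "(\<lambda>n. path_prob i (\<lambda>u. ?\<phi> n u \<and> ?h n u) * x ^ n) summable_on UNIV"
  proof (rule summable_on_weighted)
    show "(\<lambda>n. \<bar>path_prob i (?\<phi> n) * x ^ n\<bar>) summable_on UNIV"
      using has_sum_imp_summable[OF g] by (simp only: abs_summable_iff)
    show "\<bar>path_prob i (\<lambda>u. ?\<phi> n u \<and> ?h n u) * x ^ n\<bar> \<le> \<bar>path_prob i (?\<phi> n) * x ^ n\<bar>" for n
      using path_prob_mono[OF dep, of "\<lambda>u. ?\<phi> n u \<and> ?h n u" n i]
      by (simp add: abs_mult mult_right_mono)
  qed
  have "(\<Sum>\<^sub>\<infinity>j\<in>B. H_first P X A B i j x * G P X F j x) =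
      (\<Sum>\<^sub>\<infinity>n. path_prob i (\<lambda>u. ?\<phi> n u \<and> ?h n u) * x ^ n)"
    using infsumI[OF first_visit_decomposition[OF sm sm_j int]] by (simp add: conj_assoc)
  with has_sum_infsum[OF sm_h]
  have h: "((\<lambda>n. path_prob i (\<lambda>u. ?\<phi> n u \<and> ?h n u) * x ^ n) has_sum
      (\<Sum>\<^sub>\<infinity>j\<in>B. H_first P X A B i j x * G P X F j x)) UNIV"
    by simp
  have full: "path_sojourn Eo A n u = n \<longleftrightarrow> \<not> ?h n u" if "u 1 \<in> A" for n u
  proof -
    have "path_sojourn Eo A n u = n \<longleftrightarrow> (\<forall>s. 1 \<le> s \<and> s \<le> n \<longrightarrow> u s \<notin> B)"
      by (rule path_sojourn_full_iff) (use that A_Eo disjoint cover in auto)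
    also have "\<dots> \<longleftrightarrow> \<not> ?h n u"
      using first_at_exists[of _ u B] first_at_pos first_at_in by (metis order_trans)
    finally show ?thesis .
  qed
  have "path_prob i (\<lambda>u. u 1 \<in> A \<and> path_sojourn Eo A n u = n \<and> u n \<in> F) * x ^ n =
      path_prob i (?\<phi> n) * x ^ n + - 1 * (path_prob i (\<lambda>u. ?\<phi> n u \<and> ?h n u) * x ^ n)" for n
  proof -
    have "(\<lambda>u. u 1 \<in> A \<and> path_sojourn Eo A n u = n \<and> u n \<in> F) = (\<lambda>u. ?\<phi> n u \<and> \<not> ?h n u)"
    proof (rule ext)
      fix u
      show "(u 1 \<in> A \<and> path_sojourn Eo A n u = n \<and> u n \<in> F) \<longleftrightarrow> (?\<phi> n u \<and> \<not> ?h n u)"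
        using full[of u n] by blast
    qed
    then show ?thesis
      using path_prob_split[OF dep[of n] dep_h[of n], of i] by (simp add: algebra_simps)
  qed
  then have "((\<lambda>n. half_term Eo A A F i x 0 (n, n)) has_sum
      G_first P X F A i x + - 1 * (\<Sum>\<^sub>\<infinity>j\<in>B. H_first P X A B i j x * G P X F j x)) UNIV"
    using has_sum_add[OF g has_sum_cmult_right[OF h, of "- 1"]] by (simp add: half_term_def)
  then show ?thesis
    by (subst has_sum_diagonal) (auto simp: half_term_def)
qed

end

section \<open>The functional equation and its ingredients\<close>

context homogeneous_markov_chain
begin

lemma Kt_zero:
  assumes "first_prob P X C j = 0"
  shows "Kt P X Eo A C F j x y = 0"
proof (rule Kt_eq)
  have "path_prob j (\<lambda>u. u 1 \<in> C \<and> path_sojourn Eo A n u = m \<and> u n \<in> F) \<le> path_prob j (\<lambda>u. u 1 \<in> C)" for m n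
    by (rule path_prob_mono[of 1]) (intro depends, auto)
  then have "path_prob j (\<lambda>u. u 1 \<in> C \<and> path_sojourn Eo A n u = m \<and> u n \<in> F) = 0" for m n
    using assms by (intro order_antisym) (auto simp: first_prob_def path_prob_def)
  then have "half_term Eo A C F j x y = (\<lambda>_. 0)"
    unfolding half_term_def by (intro ext) (simp only: mult_zero_left split: prod.split, simp)
  then show "(half_term Eo A C F j x y has_sum 0) triangle" by simp
qed

lemma Kt_cond_eq_Kt:
  "first_prob P X C j \<in> {0, 1} \<Longrightarrow> Kt_cond P X Eo A C F j x y = Kt P X Eo A C F j x y"
  by (auto simp: Kt_cond_def Kt_zero)

lemma conv_Ht_identity:
  assumes A: "A \<inter> Eo = {}" and conv: "conv_Ht P X Eo (UNIV - Eo) A i j x"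
  shows "Ht P X Eo (UNIV - Eo) A i j x =
    x * (\<Sum>\<^sub>\<infinity>(k, l)\<in>A \<times> Eo. trans_prob P X i k * H P X Eo k l x * H_pm P X (UNIV - Eo) l j x)"
proof -
  have "((\<lambda>p. (x * (trans_prob P X i (fst p) * H P X Eo (fst p) (snd p) x)) * H_pm P X (UNIV - Eo) (snd p) j x)
      has_sum Ht P X Eo (UNIV - Eo) A i j x) (A \<times> Eo)"
    by (rule Ht_decomposition[OF A]) (use conv in \<open>auto simp: conv_Ht_def\<close>)
  from infsumI[OF this] show ?thesis
    unfolding infsum_cmult_right'[symmetric] by (simp add: case_prod_unfold mult.assoc)
qed

lemma conv_Ht_unit_disc:
  assumes A: "A \<inter> Eo = {}" and x: "\<bar>x\<bar> < 1"
  shows "conv_Ht P X Eo (UNIV - Eo) A i j x"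
proof -
  have "(\<lambda>(k, l). trans_prob P X i k * H P X Eo k l x * H_pm P X (UNIV - Eo) l j x) summable_on (A \<times> Eo)"
  proof (cases "x = 0")
    case True
    then show ?thesis by (simp add: H_zero case_prod_unfold)
  next
    case False
    have "(\<lambda>p. (x * (trans_prob P X i (fst p) * H P X Eo (fst p) (snd p) x)) * H_pm P X (UNIV - Eo) (snd p) j x)
        summable_on (A \<times> Eo)"
      by (rule has_sum_imp_summable, rule Ht_decomposition[OF A])
        (auto intro: Ht_integrable H_integrable H_pm_integrable x)
    then have "(\<lambda>p. inverse x * ((x * (trans_prob P X i (fst p) * H P X Eo (fst p) (snd p) x)) *
        H_pm P X (UNIV - Eo) (snd p) j x)) summable_on (A \<times> Eo)"
      by (rule summable_on_cmult_right)
    then show ?thesis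
      by (rule summable_on_cong[THEN iffD1, rotated]) (use False in \<open>auto simp: field_simps\<close>)
  qed
  then show ?thesis
    unfolding conv_Ht_def abs_summable_iff
    using Ht_integrable[OF x] H_integrable[OF x] H_pm_integrable[OF x] by simp
qed

lemma conv_H_first_identity:
  assumes AB: "A \<inter> B = {}" and conv: "conv_H_first P X A B i j x"
  shows "H_first P X A B i j x = x * (\<Sum>\<^sub>\<infinity>k\<in>A. trans_prob P X i k * H P X B k j x)"
proof -
  have "((\<lambda>k. trans_prob P X i k * x * H P X B k j x) has_sum H_first P X A B i j x) A"
    by (rule H_first_first_step[OF AB]) (use conv in \<open>auto simp: conv_H_first_def\<close>)
  from infsumI[OF this] show ?thesis
    unfolding infsum_cmult_right'[symmetric] by (simp add: ac_simps)
qed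

lemma conv_H_first_unit_disc:
  assumes AB: "A \<inter> B = {}" and x: "\<bar>x\<bar> < 1"
  shows "conv_H_first P X A B i j x"
proof -
  have "(\<lambda>k. trans_prob P X i k * H P X B k j x) summable_on A"
  proof (cases "x = 0")
    case True
    then show ?thesis by (simp add: H_zero)
  next
    case False
    have "(\<lambda>k. trans_prob P X i k * x * H P X B k j x) summable_on A"
      by (rule has_sum_imp_summable, rule H_first_first_step[OF AB])
        (auto intro: H_first_integrable H_integrable x)
    then have "(\<lambda>k. inverse x * (trans_prob P X i k * x * H P X B k j x)) summable_on A"
      by (rule summable_on_cmult_right)
    then show ?thesis
      by (rule summable_on_cong[THEN iffD1, rotated]) (use False in \<open>auto simp: field_simps\<close>)
  qed
  then show ?thesis
    unfolding conv_H_first_def abs_summable_iff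
    using H_first_integrable[OF x] H_integrable[OF x] by simp
qed

lemma conv_boundary_unit_disc:
  assumes x: "\<bar>x\<bar> < 1"
  shows "conv_boundary P X F A B i x"
proof -
  have G1: "G_first_term P X F A i x summable_on UNIV"
    using path_prob_powers_summable[OF x, of i "\<lambda>m u. u 1 \<in> A \<and> u m \<in> F"]
    by (simp add: G_first_term_def[abs_def] path_prob_def)
  have G2: "G_term P X F j x summable_on UNIV" for j
    using path_prob_powers_summable[OF x, of j "\<lambda>m u. u m \<in> F"]
    by (simp add: G_term_def[abs_def] path_prob_def)
  have "(\<lambda>j. H_first P X A B i j x * G P X F j x) summable_on B"
    by (rule has_sum_imp_summable, rule first_visit_decomposition[OF G1 G2 H_first_integrable[OF x]])
  with G1 G2 H_first_integrable[OF x] show ?thesis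
    unfolding conv_boundary_def abs_summable_iff by blast
qed

end

context separated_excursions
begin

lemma summable_swap:
  "half_term Eo A (UNIV - Eo) F j x y summable_on triangle \<Longrightarrow>
    half_term Eo B (UNIV - Eo) F j y x summable_on triangle"
  using half_term_swap[of "UNIV - Eo" F j x y] unfolding summable_on_def by auto

lemma Kt_swap:
  assumes "half_term Eo A (UNIV - Eo) F j x y summable_on triangle"
  shows "Kt P X Eo A (UNIV - Eo) F j x y = Kt P X Eo B (UNIV - Eo) F j y x"
proof -
  obtain S where S: "(half_term Eo A (UNIV - Eo) F j x y has_sum S) triangle"
    using assms by (auto simp: summable_on_def)
  then have "(half_term Eo B (UNIV - Eo) F j y x has_sum S) triangle"
    using half_term_swap[of "UNIV - Eo" F j x y S] by auto
  with S show ?thesis by (simp add: Kt_eq)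
qed

lemma Kt_x_0:
  assumes "(half_term Eo A A F i x 0 has_sum h) triangle"
  shows "(half_term Eo A (UNIV - Eo) F i x 0 has_sum h + indicator F i * first_prob P X B i) triangle"
proof -
  have "((\<lambda>p. half_term Eo A A F i x 0 p + half_term Eo A B F i x 0 p) has_sum
      h + indicator F i * first_prob P X B i) triangle"
    by (rule has_sum_add[OF assms half_other_boundary])
  then show ?thesis by (simp only: half_term_split[symmetric])
qed

lemma Kt_x_y:
  assumes "(half_term Eo A A F i x y has_sum h) triangle" and "(half_term Eo B B F i y x has_sum h') triangle"
  shows "(half_term Eo A (UNIV - Eo) F i x y has_sum h + h') triangle"
proof -
  have "(half_term Eo A B F i x y has_sum h') triangle"
    using assms(2) half_term_swap[OF B_Eo] by blast
  from has_sum_add[OF assms(1) this] show ?thesis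
    by (simp only: half_term_split[symmetric])
qed

lemma first_prob_add: "first_prob P X (UNIV - Eo) i = first_prob P X A i + first_prob P X B i"
proof -
  have eq: "first_prob P X C i = path_prob i (\<lambda>u. u 1 \<in> C)" for C
    by (simp add: first_prob_def path_prob_def)
  have "path_prob i (\<lambda>u. u 1 \<in> UNIV - Eo) =
      path_prob i (\<lambda>u. u 1 \<in> UNIV - Eo \<and> u 1 \<in> A) + path_prob i (\<lambda>u. u 1 \<in> UNIV - Eo \<and> \<not> u 1 \<in> A)"
    by (rule path_prob_split[where n = 1]) (intro depends, simp)+
  moreover have "v \<in> UNIV - Eo \<and> v \<in> A \<longleftrightarrow> v \<in> A" "v \<in> UNIV - Eo \<and> \<not> v \<in> A \<longleftrightarrow> v \<in> B" for v
    using disjoint cover by blast+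
  ultimately show ?thesis unfolding eq by simp
qed

text \<open>
\<open>half_decomposition\<close> is used four times: for both sides, at \<open>(x, y)\<close> and on the boundary. The
two sums \<open>stay_sum\<close> cancel.
\<close>

lemma functional_equation:
  assumes kt: "\<And>j. j \<in> Eo \<Longrightarrow> half_term Eo A (UNIV - Eo) F j x y summable_on triangle"
    and int_A: "\<And>j. j \<in> Eo \<Longrightarrow> integrable (P i) (Ht_var X Eo (UNIV - Eo) A j x)"
    and int_B: "\<And>j. j \<in> Eo \<Longrightarrow> integrable (P i) (Ht_var X Eo (UNIV - Eo) B j y)"
    and i: "i \<in> Eo"
  obtains z z1 z2 where
    "((\<lambda>j. (Ht P X Eo (UNIV - Eo) A i j x + Ht P X Eo (UNIV - Eo) B i j y)
        * Kt_cond P X Eo A (UNIV - Eo) F j x y) has_sum z) Eo"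
    "((\<lambda>j. Ht P X Eo (UNIV - Eo) A i j x * Kt_cond P X Eo A (UNIV - Eo) F j x 0) has_sum z1) Eo"
    "((\<lambda>j. Ht P X Eo (UNIV - Eo) B i j y * Kt_cond P X Eo A (UNIV - Eo) F j 0 y) has_sum z2) Eo"
    "Kt P X Eo A (UNIV - Eo) F i x y =
      Kt P X Eo A (UNIV - Eo) F i x 0 + Kt P X Eo A (UNIV - Eo) F i 0 y + z - z1 - z2
        - indicator F i * first_prob P X (UNIV - Eo) i"
proof -
  interpret sw: separated_excursions P X Eo B A by (rule swapped)
  have ktB: "half_term Eo B (UNIV - Eo) F j y x summable_on triangle" if "j \<in> Eo" for j
    by (rule summable_swap[OF kt[OF that]])
  note kt0 = half_term_weight_zero[OF kt] and ktB0 = half_term_weight_zero[OF ktB]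
  have sub: "A \<subseteq> UNIV - Eo" "B \<subseteq> UNIV - Eo" using cover by auto
  note hA = half_summable[OF sub(1) kt[OF i]] and hA0 = half_summable[OF sub(1) kt0[OF i]]
  note hB = sw.half_summable[OF sub(2) ktB[OF i]] and hB0 = sw.half_summable[OF sub(2) ktB0[OF i]]
  obtain a where a: "((\<lambda>j. Ht P X Eo (UNIV - Eo) A i j x * Kt_cond P X Eo A (UNIV - Eo) F j x y) has_sum a) Eo"
    "(half_term Eo A A F i x y has_sum stay_sum F i x + a) triangle"
    using half_decomposition[OF hA int_A kt] by blast
  obtain a0 where a0: "((\<lambda>j. Ht P X Eo (UNIV - Eo) A i j x * Kt_cond P X Eo A (UNIV - Eo) F j x 0) has_sum a0) Eo"
    "(half_term Eo A A F i x 0 has_sum stay_sum F i x + a0) triangle"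
    using half_decomposition[OF hA0 int_A kt0] by blast
  obtain b where b: "((\<lambda>j. Ht P X Eo (UNIV - Eo) B i j y * Kt_cond P X Eo B (UNIV - Eo) F j y x) has_sum b) Eo"
    "(half_term Eo B B F i y x has_sum sw.stay_sum F i y + b) triangle"
    using sw.half_decomposition[OF hB int_B ktB] by blast
  obtain b0 where b0: "((\<lambda>j. Ht P X Eo (UNIV - Eo) B i j y * Kt_cond P X Eo B (UNIV - Eo) F j y 0) has_sum b0) Eo"
    "(half_term Eo B B F i y 0 has_sum sw.stay_sum F i y + b0) triangle"
    using sw.half_decomposition[OF hB0 int_B ktB0] by blast
  have cond_swap: "Kt_cond P X Eo A (UNIV - Eo) F j x y = Kt_cond P X Eo B (UNIV - Eo) F j y x" if "j \<in> Eo" for j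
    unfolding Kt_cond_def Kt_swap[OF kt[OF that]] ..
  have cond_swap0: "Kt_cond P X Eo A (UNIV - Eo) F j 0 y = Kt_cond P X Eo B (UNIV - Eo) F j y 0" if "j \<in> Eo" for j
    unfolding Kt_cond_def sw.Kt_swap[OF ktB0[OF that]] ..
  show thesis
  proof (rule that)
    have "((\<lambda>j. Ht P X Eo (UNIV - Eo) A i j x * Kt_cond P X Eo A (UNIV - Eo) F j x y +
        Ht P X Eo (UNIV - Eo) B i j y * Kt_cond P X Eo B (UNIV - Eo) F j y x) has_sum a + b) Eo"
      by (rule has_sum_add[OF a(1) b(1)])
    then show "((\<lambda>j. (Ht P X Eo (UNIV - Eo) A i j x + Ht P X Eo (UNIV - Eo) B i j y)
        * Kt_cond P X Eo A (UNIV - Eo) F j x y) has_sum a + b) Eo"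
      by (rule has_sum_cong[THEN iffD1, rotated]) (simp add: cond_swap distrib_right)
    show "((\<lambda>j. Ht P X Eo (UNIV - Eo) A i j x * Kt_cond P X Eo A (UNIV - Eo) F j x 0) has_sum a0) Eo"
      by (rule a0(1))
    show "((\<lambda>j. Ht P X Eo (UNIV - Eo) B i j y * Kt_cond P X Eo A (UNIV - Eo) F j 0 y) has_sum b0) Eo"
      using b0(1) by (rule has_sum_cong[THEN iffD1, rotated]) (simp add: cond_swap0)
    have "Kt P X Eo A (UNIV - Eo) F i x y = stay_sum F i x + a + (sw.stay_sum F i y + b)"
      by (rule Kt_eq[OF Kt_x_y[OF a(2) b(2)]])
    moreover have "Kt P X Eo A (UNIV - Eo) F i x 0 = stay_sum F i x + a0 + indicator F i * first_prob P X B i"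
      by (rule Kt_eq[OF Kt_x_0[OF a0(2)]])
    moreover have "Kt P X Eo A (UNIV - Eo) F i 0 y = sw.stay_sum F i y + b0 + indicator F i * first_prob P X A i"
      unfolding sw.Kt_swap[OF ktB0[OF i], symmetric] by (rule Kt_eq[OF sw.Kt_x_0[OF b0(2)]])
    ultimately show "Kt P X Eo A (UNIV - Eo) F i x y =
        Kt P X Eo A (UNIV - Eo) F i x 0 + Kt P X Eo A (UNIV - Eo) F i 0 y + (a + b) - a0 - b0
          - indicator F i * first_prob P X (UNIV - Eo) i"
      by (simp add: first_prob_add algebra_simps)
  qed
qed

lemma conv_main_identity:
  assumes "conv_main P X Eo A B (UNIV - Eo) F i x y" and i: "i \<in> Eo"
  shows "Kt P X Eo A (UNIV - Eo) F i x y =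
    Kt P X Eo A (UNIV - Eo) F i x 0 + Kt P X Eo A (UNIV - Eo) F i 0 y
    + (\<Sum>\<^sub>\<infinity>j\<in>Eo. (Ht P X Eo (UNIV - Eo) A i j x + Ht P X Eo (UNIV - Eo) B i j y)
        * Kt_cond P X Eo A (UNIV - Eo) F j x y)
    - (\<Sum>\<^sub>\<infinity>j\<in>Eo. Ht P X Eo (UNIV - Eo) A i j x * Kt_cond P X Eo A (UNIV - Eo) F j x 0)
    - (\<Sum>\<^sub>\<infinity>j\<in>Eo. Ht P X Eo (UNIV - Eo) B i j y * Kt_cond P X Eo A (UNIV - Eo) F j 0 y)
    - indicator F i * first_prob P X (UNIV - Eo) i"
proof -
  have "half_term Eo A (UNIV - Eo) F j x y summable_on triangle"
    "integrable (P i) (Ht_var X Eo (UNIV - Eo) A j x)"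
    "integrable (P i) (Ht_var X Eo (UNIV - Eo) B j y)" if "j \<in> Eo" for j
    using assms(1) that unfolding conv_main_def abs_summable_iff Kt_term_eq by blast+
  from functional_equation[OF this i] show ?thesis
    by (metis (no_types, lifting) infsumI)
qed

lemma conv_main_unit_disc:
  assumes x: "\<bar>x\<bar> < 1" and y: "\<bar>y\<bar> < 1" and i: "i \<in> Eo"
  shows "conv_main P X Eo A B (UNIV - Eo) F i x y"
proof -
  note kt = half_term_summable[OF x y]
  from functional_equation[OF kt Ht_integrable[OF x] Ht_integrable[OF y] i]
  have "(\<lambda>j. (Ht P X Eo (UNIV - Eo) A i j x + Ht P X Eo (UNIV - Eo) B i j y)
        * Kt_cond P X Eo A (UNIV - Eo) F j x y) summable_on Eo \<and>
    (\<lambda>j. Ht P X Eo (UNIV - Eo) A i j x * Kt_cond P X Eo A (UNIV - Eo) F j x 0) summable_on Eo \<and>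
    (\<lambda>j. Ht P X Eo (UNIV - Eo) B i j y * Kt_cond P X Eo A (UNIV - Eo) F j 0 y) summable_on Eo"
    by (metis (no_types, lifting) has_sum_imp_summable)
  then show ?thesis
    unfolding conv_main_def abs_summable_iff Kt_term_eq
    using kt Ht_integrable[OF x] Ht_integrable[OF y] by blast
qed

lemma conv_boundary_identity:
  assumes "conv_boundary P X F A B i x"
  shows "Kt P X Eo A (UNIV - Eo) F i x 0 =
      G_first P X F A i x - (\<Sum>\<^sub>\<infinity>j\<in>B. H_first P X A B i j x * G P X F j x)
      + indicator F i * first_prob P X B i"
    and "Kt P X Eo B (UNIV - Eo) F i 0 x =
      G_first P X F A i x - (\<Sum>\<^sub>\<infinity>j\<in>B. H_first P X A B i j x * G P X F j x)
      + indicator F i * first_prob P X B i"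
proof -
  have "(half_term Eo A A F i x 0 has_sum
      G_first P X F A i x - (\<Sum>\<^sub>\<infinity>j\<in>B. H_first P X A B i j x * G P X F j x)) triangle"
    by (rule half_boundary) (use assms in \<open>auto simp only: conv_boundary_def abs_summable_iff\<close>)
  note K = Kt_x_0[OF this]
  show 1: "Kt P X Eo A (UNIV - Eo) F i x 0 =
      G_first P X F A i x - (\<Sum>\<^sub>\<infinity>j\<in>B. H_first P X A B i j x * G P X F j x)
      + indicator F i * first_prob P X B i"
    by (rule Kt_eq[OF K])
  show "Kt P X Eo B (UNIV - Eo) F i 0 x =
      G_first P X F A i x - (\<Sum>\<^sub>\<infinity>j\<in>B. H_first P X A B i j x * G P X F j x)
      + indicator F i * first_prob P X B i"
    unfolding Kt_swap[OF has_sum_imp_summable[OF K], symmetric] by (rule 1)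
qed

end

text \<open>
Evaluate the assumptions on the event that the first step already leads to the opposite side:
the passage time of that side is then 1, whereas that of \<open>Eo\<close> is at least 2.
\<close>

lemma (in homogeneous_markov_chain) separated_by_assumptions:
  assumes "Eo \<subseteq> Ed" and Ep: "Ep = Ed - Eo" and Em: "Em = UNIV - Ed"
    and A1: "assumption_A1 P X Eo Ed Em"
    and A2: "assumption_A2 P X Eo Ep Em"
  shows "separated_excursions P X Eo Ep Em"
proof
  show "Ep \<inter> Em = {}" "Ep \<union> Em = UNIV - Eo"
    using assms(1) unfolding Ep Em by auto
  have null: "trans_prob P X k l = 0" if "AE \<omega> in P k. X 1 \<omega> \<noteq> l" for k l
  proof -
    have "depends_upto 1 (\<lambda>u. u 1 = l)" by (intro depends) auto
    from event_depends[OF this] that show ?thesis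
      unfolding trans_prob_def by (subst chain.prob_Collect_eq_0) auto
  qed
  have at_1: "first_at C s u \<longleftrightarrow> s = 1" if "u 1 \<in> C" for C s and u :: "nat \<Rightarrow> 's"
    using that first_at_le[of C s u 1] first_at_pos[of C s u] by (auto simp: first_at_def)
  show "trans_prob P X k l = 0" if "k \<in> Ep" "l \<in> Em" for k l
  proof (rule null)
    have "AE \<omega> in P k. hit X Eo \<omega> \<le> hit X Em \<omega> - 1"
      using A2 \<open>k \<in> Ep\<close> by (auto simp: assumption_A2_def)
    then show "AE \<omega> in P k. X 1 \<omega> \<noteq> l"
    proof eventually_elim
      case (elim \<omega>)
      show ?case
      proof
        assume "X 1 \<omega> = l"
        then have "hit X Em \<omega> - 1 = enat 0"
          using \<open>l \<in> Em\<close> by (simp add: hit_pred_eq at_1)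
        with elim have "hit X Eo \<omega> = enat 0" by (simp add: zero_enat_def[symmetric])
        then show False by (simp add: hit_eq first_at_def)
      qed
    qed
  qed
  show "trans_prob P X k l = 0" if "k \<in> Em" "l \<in> Ep" for k l
  proof (rule null)
    have "AE \<omega> in P k. hit X Eo \<omega> = hit X Ed \<omega>"
      using A1 \<open>k \<in> Em\<close> by (auto simp: assumption_A1_def)
    then show "AE \<omega> in P k. X 1 \<omega> \<noteq> l"
    proof eventually_elim
      case (elim \<omega>)
      show ?case
      proof
        assume "X 1 \<omega> = l"
        then have "X 1 \<omega> \<in> Ed" "X 1 \<omega> \<notin> Eo" using \<open>l \<in> Ep\<close> Ep by auto
        then have "hit X Ed \<omega> = enat 1" by (simp add: hit_eq at_1)
        with elim have "first_at Eo 1 (\<lambda>m. X m \<omega>)" by (simp add: hit_eq[symmetric])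
        with \<open>X 1 \<omega> \<notin> Eo\<close> show False by (simp add: first_at_def)
      qed
    qed
  qed
qed

theorem theorem3p2:
  fixes P :: "'s :: countable \<Rightarrow> 'w measure" and X :: "nat \<Rightarrow> 'w \<Rightarrow> 's"
    and Eo Ed Ep Em Epm F :: "'s set" and i :: 's
  assumes chain: "homogeneous_markov_chain P X"
    and subset: "Eo \<subseteq> Ed"
    and Ep: "Ep = Ed - Eo"
    and Em: "Em = UNIV - Ed"
    and Epm: "Epm = UNIV - Eo"
    and A1: "assumption_A1 P X Eo Ed Em"
    and A2: "assumption_A2 P X Eo Ep Em"
    and i: "i \<in> Eo"
  shows
    "(\<forall>x y. \<bar>x\<bar> < 1 \<and> \<bar>y\<bar> < 1 \<longrightarrow> conv_main P X Eo Ep Em Epm F i x y) \<and>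
     (\<forall>x. \<bar>x\<bar> < 1 \<longrightarrow>
        conv_boundary P X F Ep Em i x \<and> conv_boundary P X F Em Ep i x \<and>
        (\<forall>j\<in>Eo. conv_Ht P X Eo Epm Ep i j x \<and> conv_Ht P X Eo Epm Em i j x) \<and>
        (\<forall>j\<in>Em. conv_H_first P X Ep Em i j x) \<and>
        (\<forall>j\<in>Ep. conv_H_first P X Em Ep i j x)) \<and>
     (\<forall>x y. conv_main P X Eo Ep Em Epm F i x y \<longrightarrow>
        Kt P X Eo Ep Epm F i x y =
          Kt P X Eo Ep Epm F i x 0 + Kt P X Eo Ep Epm F i 0 y
          + (\<Sum>\<^sub>\<infinity>j\<in>Eo. (Ht P X Eo Epm Ep i j x + Ht P X Eo Epm Em i j y)
                      * Kt_cond P X Eo Ep Epm F j x y)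
          - (\<Sum>\<^sub>\<infinity>j\<in>Eo. Ht P X Eo Epm Ep i j x * Kt_cond P X Eo Ep Epm F j x 0)
          - (\<Sum>\<^sub>\<infinity>j\<in>Eo. Ht P X Eo Epm Em i j y * Kt_cond P X Eo Ep Epm F j 0 y)
          - indicator F i * first_prob P X Epm i) \<and>
     ((\<forall>j\<in>Eo. first_prob P X Epm j \<in> {0, 1}) \<longrightarrow>
      (\<forall>x y. conv_main P X Eo Ep Em Epm F i x y \<longrightarrow>
        Kt P X Eo Ep Epm F i x y =
          Kt P X Eo Ep Epm F i x 0 + Kt P X Eo Ep Epm F i 0 y
          + (\<Sum>\<^sub>\<infinity>j\<in>Eo. (Ht P X Eo Epm Ep i j x + Ht P X Eo Epm Em i j y)
                      * Kt P X Eo Ep Epm F j x y)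
          - (\<Sum>\<^sub>\<infinity>j\<in>Eo. Ht P X Eo Epm Ep i j x * Kt P X Eo Ep Epm F j x 0)
          - (\<Sum>\<^sub>\<infinity>j\<in>Eo. Ht P X Eo Epm Em i j y * Kt P X Eo Ep Epm F j 0 y)
          - indicator F i * first_prob P X Epm i)) \<and>
     (\<forall>x. conv_boundary P X F Ep Em i x \<longrightarrow>
        Kt P X Eo Ep Epm F i x 0 =
          G_first P X F Ep i x - (\<Sum>\<^sub>\<infinity>j\<in>Em. H_first P X Ep Em i j x * G P X F j x)
          + indicator F i * first_prob P X Em i) \<and>
     (\<forall>y. conv_boundary P X F Em Ep i y \<longrightarrow>
        Kt P X Eo Ep Epm F i 0 y =
          G_first P X F Em i y - (\<Sum>\<^sub>\<infinity>j\<in>Ep. H_first P X Em Ep i j y * G P X F j y)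
          + indicator F i * first_prob P X Ep i) \<and>
     (\<forall>j\<in>Eo. \<forall>x. conv_Ht P X Eo Epm Ep i j x \<longrightarrow>
        Ht P X Eo Epm Ep i j x =
          x * (\<Sum>\<^sub>\<infinity>(k, l)\<in>Ep \<times> Eo. trans_prob P X i k * H P X Eo k l x * H_pm P X Epm l j x)) \<and>
     (\<forall>j\<in>Eo. \<forall>x. conv_Ht P X Eo Epm Em i j x \<longrightarrow>
        Ht P X Eo Epm Em i j x =
          x * (\<Sum>\<^sub>\<infinity>(k, l)\<in>Em \<times> Eo. trans_prob P X i k * H P X Eo k l x * H_pm P X Epm l j x)) \<and>
     (\<forall>j\<in>Em. \<forall>x. conv_H_first P X Ep Em i j x \<longrightarrow>
        H_first P X Ep Em i j x = x * (\<Sum>\<^sub>\<infinity>k\<in>Ep. trans_prob P X i k * H P X Em k j x)) \<and>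
     (\<forall>j\<in>Ep. \<forall>x. conv_H_first P X Em Ep i j x \<longrightarrow>
        H_first P X Em Ep i j x = x * (\<Sum>\<^sub>\<infinity>k\<in>Em. trans_prob P X i k * H P X Ep k j x))"
proof -
  interpret homogeneous_markov_chain P X by (rule chain)
  interpret pos: separated_excursions P X Eo Ep Em
    by (rule separated_by_assumptions[OF subset Ep Em A1 A2])
  interpret neg: separated_excursions P X Eo Em Ep by (rule pos.swapped)
  note main = pos.conv_main_identity[OF _ i, folded Epm]
  show ?thesis
  proof (intro conjI allI impI ballI)
    fix x y :: real
    show "conv_main P X Eo Ep Em Epm F i x y" if "\<bar>x\<bar> < 1 \<and> \<bar>y\<bar> < 1"
      unfolding Epm using that i by (intro pos.conv_main_unit_disc) auto
    show "Kt P X Eo Ep Epm F i x y =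
          Kt P X Eo Ep Epm F i x 0 + Kt P X Eo Ep Epm F i 0 y
          + (\<Sum>\<^sub>\<infinity>j\<in>Eo. (Ht P X Eo Epm Ep i j x + Ht P X Eo Epm Em i j y)
                      * Kt_cond P X Eo Ep Epm F j x y)
          - (\<Sum>\<^sub>\<infinity>j\<in>Eo. Ht P X Eo Epm Ep i j x * Kt_cond P X Eo Ep Epm F j x 0)
          - (\<Sum>\<^sub>\<infinity>j\<in>Eo. Ht P X Eo Epm Em i j y * Kt_cond P X Eo Ep Epm F j 0 y)
          - indicator F i * first_prob P X Epm i" if "conv_main P X Eo Ep Em Epm F i x y"
      using that by (rule main)
    show "Kt P X Eo Ep Epm F i x y =
          Kt P X Eo Ep Epm F i x 0 + Kt P X Eo Ep Epm F i 0 y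
          + (\<Sum>\<^sub>\<infinity>j\<in>Eo. (Ht P X Eo Epm Ep i j x + Ht P X Eo Epm Em i j y)
                      * Kt P X Eo Ep Epm F j x y)
          - (\<Sum>\<^sub>\<infinity>j\<in>Eo. Ht P X Eo Epm Ep i j x * Kt P X Eo Ep Epm F j x 0)
          - (\<Sum>\<^sub>\<infinity>j\<in>Eo. Ht P X Eo Epm Em i j y * Kt P X Eo Ep Epm F j 0 y)
          - indicator F i * first_prob P X Epm i"
      if q: "\<forall>j\<in>Eo. first_prob P X Epm j \<in> {0, 1}" and conv: "conv_main P X Eo Ep Em Epm F i x y"
    proof -
      have "Kt_cond P X Eo Ep Epm F j x y = Kt P X Eo Ep Epm F j x y" if "j \<in> Eo" for j x y
        using q that by (intro Kt_cond_eq_Kt) blast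
      then show ?thesis using main[OF conv] by (simp cong: infsum_cong)
    qed
  next
    fix x :: real
    assume x: "\<bar>x\<bar> < 1"
    show "conv_boundary P X F Ep Em i x" "conv_boundary P X F Em Ep i x"
      by (rule conv_boundary_unit_disc[OF x])+
    show "conv_Ht P X Eo Epm Ep i j x" "conv_Ht P X Eo Epm Em i j x" for j
      unfolding Epm by (rule conv_Ht_unit_disc[OF pos.A_Eo x], rule conv_Ht_unit_disc[OF pos.B_Eo x])
    show "conv_H_first P X Ep Em i j x" "conv_H_first P X Em Ep i j x" for j
      by (rule conv_H_first_unit_disc[OF pos.disjoint x], rule conv_H_first_unit_disc[OF neg.disjoint x])
  next
    fix x
    assume "conv_boundary P X F Ep Em i x"
    then show "Kt P X Eo Ep Epm F i x 0 =
          G_first P X F Ep i x - (\<Sum>\<^sub>\<infinity>j\<in>Em. H_first P X Ep Em i j x * G P X F j x)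
          + indicator F i * first_prob P X Em i"
      unfolding Epm by (rule pos.conv_boundary_identity(1))
  next
    fix y
    assume "conv_boundary P X F Em Ep i y"
    then show "Kt P X Eo Ep Epm F i 0 y =
          G_first P X F Em i y - (\<Sum>\<^sub>\<infinity>j\<in>Ep. H_first P X Em Ep i j y * G P X F j y)
          + indicator F i * first_prob P X Ep i"
      unfolding Epm by (rule neg.conv_boundary_identity(2))
  next
    fix j x
    assume "conv_Ht P X Eo Epm Ep i j x"
    then show "Ht P X Eo Epm Ep i j x =
          x * (\<Sum>\<^sub>\<infinity>(k, l)\<in>Ep \<times> Eo. trans_prob P X i k * H P X Eo k l x * H_pm P X Epm l j x)"
      unfolding Epm by (rule conv_Ht_identity[OF pos.A_Eo])
  next
    fix j x
    assume "conv_Ht P X Eo Epm Em i j x"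
    then show "Ht P X Eo Epm Em i j x =
          x * (\<Sum>\<^sub>\<infinity>(k, l)\<in>Em \<times> Eo. trans_prob P X i k * H P X Eo k l x * H_pm P X Epm l j x)"
      unfolding Epm by (rule conv_Ht_identity[OF pos.B_Eo])
  next
    fix j x
    assume "conv_H_first P X Ep Em i j x"
    then show "H_first P X Ep Em i j x = x * (\<Sum>\<^sub>\<infinity>k\<in>Ep. trans_prob P X i k * H P X Em k j x)"
      by (rule conv_H_first_identity[OF pos.disjoint])
  next
    fix j x
    assume "conv_H_first P X Em Ep i j x"
    then show "H_first P X Em Ep i j x = x * (\<Sum>\<^sub>\<infinity>k\<in>Em. trans_prob P X i k * H P X Ep k j x)"
      by (rule conv_H_first_identity[OF neg.disjoint])
  qed
qed

end
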